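(* Let $m\ge1$, $N\ge0$, $T\ge1$ be integers, $\omega$ a primitive $T$-th root of unity and $z_1,\dots,z_N\in\mathbb C^\times$ points with pairwise disjoint orbits under multiplication by powers of $\omega$. Let $\mathcal C_{0,N;m}$ be the arrangement in $\mathbb C^m$ consisting of the hyperplanes $t_i=\omega^kt_j$ ($1\le i<j\le m$, $k\in\mathbb Z/T\mathbb Z$), $t_i=\omega^kz_j$ ($1\le i\le m$, $1\le j\le N$, $k\in\mathbb Z/T\mathbb Z$) and $t_i=0$ ($1\le i\le m$). Then $$\sum_{p=0}^mx^p\dim\mathcal F^p(\mathcal C_{0,N;m})=\prod_{p=0}^{m-1}\Big(1+\big(1+(p+N)T\big)x\Big).$$
   Context: For an arrangement $\mathcal C$ in $\mathbb C^m$, an edge is a non-empty intersection of hyperplanes of $\mathcal C$ ($\mathbb C^m$ included). The flag space $\mathcal F^p(\mathcal C)$ is the complex vector space generated by the flags $\mathbb C^m=L^0\supset L^1\supset\dots\supset L^p$ of edges with $\operatorname{codim}L^j=j$, modulo the relations: for each $0<i<p$ and each chain of edges $L^0\supset\dots\supset L^{i-1}\supset L^{i+1}\supset\dots\supset L^p$ with $\operatorname{codim}L^j=j$, the sum of all flags obtained by inserting an edge of codimension $i$ between $L^{i-1}$ and $L^{i+1}$ is $0$. (It is dual to the degree-$p$ part of the Orlik–Solomon algebra of $\mathcal C$.) *)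

theory Defs
  imports
    "HOL-Algebra.QuotRing"
    "Jordan_Normal_Form.VS_Connect"
    "HOL-Library.Disjoint_Sets"
    "HOL-Computational_Algebra.Polynomial"
begin

section \<open>Free vector spaces and quotient spaces\<close>

text \<open>
  Vector spaces are records in the sense of \<^locale>\<open>vectorspace\<close>; their fields \<open>mult\<close> and \<open>one\<close>,
  which are inherited from rings, carry no meaning.
\<close>

definition free_vs :: "'b set \<Rightarrow> (complex, 'b \<Rightarrow> complex) module" where
  "free_vs S = \<lparr>carrier = {f. finite {s. f s \<noteq> 0} \<and> {s. f s \<noteq> 0} \<subseteq> S},
     mult = undefined, one = undefined, zero = (\<lambda>s. 0), add = (\<lambda>f g s. f s + g s),
     smult = (\<lambda>c f s. c * f s)\<rparr>"

definition free_gen :: "'b \<Rightarrow> 'b \<Rightarrow> complex" where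
  "free_gen s = (\<lambda>s'. if s' = s then 1 else 0)"

text \<open>The quotient of \<open>V\<close> by a subspace \<open>W\<close>, built from cosets in the same way as \<^const>\<open>FactRing\<close>.\<close>

definition quot_vs :: "(complex, 'v) module \<Rightarrow> 'v set \<Rightarrow> (complex, 'v set) module" where
  "quot_vs V W = \<lparr>carrier = a_rcosets\<^bsub>V\<^esub> W,
     mult = undefined, one = undefined, zero = W, add = (\<lambda>A B. A <+>\<^bsub>V\<^esub> B),
     smult = (\<lambda>c A. \<Union>a\<in>A. W +>\<^bsub>V\<^esub> (c \<odot>\<^bsub>V\<^esub> a))\<rparr>"

section \<open>Flag spaces of arrangements\<close>

text \<open>
  Affine space of dimension \<open>m\<close> is \<^term>\<open>carrier_vec m :: complex vec set\<close>, with coordinates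
  indexed by \<open>0, \<dots>, m - 1\<close>. An arrangement is given by its set of hyperplanes.
\<close>

type_synonym arrangement = "complex vec set set"

definition edges :: "nat \<Rightarrow> arrangement \<Rightarrow> complex vec set set" where
  "edges m \<C> = {L. L \<noteq> {} \<and> (\<exists>\<B>\<subseteq>\<C>. L = carrier_vec m \<inter> \<Inter>\<B>)}"

text \<open>The dimension of a non-empty affine subspace is that of its space of directions.\<close>

definition codim :: "nat \<Rightarrow> complex vec set \<Rightarrow> nat" where
  "codim m L = m - vectorspace.dim class_ring
     ((module_vec TYPE(complex) m)\<lparr>carrier := {x - y |x y. x \<in> L \<and> y \<in> L}\<rparr>)"

text \<open>
  Descending chains of edges starting at the whole space, whose codimensions are prescribed by the
  list \<open>ns\<close>.
\<close>

definition edge_chains :: "nat \<Rightarrow> arrangement \<Rightarrow> nat list \<Rightarrow> complex vec set list set" where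
  "edge_chains m \<C> ns = {Ls. set Ls \<subseteq> edges m \<C> \<and> map (codim m) Ls = ns \<and>
     Ls \<noteq> [] \<and> hd Ls = carrier_vec m \<and> sorted_wrt (\<supset>) Ls}"

definition flags :: "nat \<Rightarrow> arrangement \<Rightarrow> nat \<Rightarrow> complex vec set list set" where
  "flags m \<C> p = edge_chains m \<C> [0..<Suc p]"

text \<open>
  A chain with a gap in codimension \<open>i\<close> is \<open>Ls @ Ls'\<close>, where \<open>Ls\<close> has the codimensions below \<open>i\<close>
  and \<open>Ls'\<close> those above.
\<close>

definition flag_relations ::
    "nat \<Rightarrow> arrangement \<Rightarrow> nat \<Rightarrow> (complex vec set list \<Rightarrow> complex) set" where
  "flag_relations m \<C> p =
     {\<Oplus>\<^bsub>free_vs (flags m \<C> p)\<^esub> F \<in> {F \<in> flags m \<C> p. \<exists>M. F = Ls @ M # Ls'}. free_gen F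
      |Ls Ls' i. 0 < i \<and> i < p \<and> length Ls = i \<and>
         Ls @ Ls' \<in> edge_chains m \<C> ([0..<i] @ [Suc i..<Suc p])}"

definition flag_space ::
    "nat \<Rightarrow> arrangement \<Rightarrow> nat \<Rightarrow> (complex, (complex vec set list \<Rightarrow> complex) set) module" where
  "flag_space m \<C> p =
     (let V = free_vs (flags m \<C> p)
      in quot_vs V (LinearCombinations.module.span class_ring V (flag_relations m \<C> p)))"

section \<open>The arrangement\<close>

definition primitive_root :: "nat \<Rightarrow> complex \<Rightarrow> bool" where
  "primitive_root T \<omega> \<longleftrightarrow> \<omega> ^ T = 1 \<and> (\<forall>k. 0 < k \<and> k < T \<longrightarrow> \<omega> ^ k \<noteq> 1)"

text \<open>The coordinates are \<open>t\<^sub>1 = t $ 0, \<dots>, t\<^sub>m = t $ (m - 1)\<close>; the points are \<open>z 1, \<dots>, z N\<close>.\<close>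

definition cyclotomic_arrangement ::
    "nat \<Rightarrow> nat \<Rightarrow> nat \<Rightarrow> complex \<Rightarrow> (nat \<Rightarrow> complex) \<Rightarrow> arrangement" where
  "cyclotomic_arrangement m N T \<omega> z =
     {{t \<in> carrier_vec m. t $ i = \<omega> ^ k * t $ j} |i j k. i < j \<and> j < m \<and> k < T} \<union>
     {{t \<in> carrier_vec m. t $ i = \<omega> ^ k * z j} |i j k. i < m \<and> j \<in> {1..N} \<and> k < T} \<union>
     {{t \<in> carrier_vec m. t $ i = 0} |i. i < m}"

end

(*
  Projecting away the last coordinate makes the arrangement fibre-type: a hyperplane in dimension m + 1
  is either a cylinder over a hyperplane in dimension m or the graph of one of 1 + (m + N) T affine
  functions, and two such graphs meet over a hyperplane in dimension m or not at all. Hence every edge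
  is a cylinder over an edge K or a graph over K, and a flag is a flag downstairs that is either lifted
  to cylinders throughout, or lifted to graphs of one function f from some step on. The relation at the
  step where the cylinders end rewrites a flag of the second kind as a signed sum of flags consisting of
  graphs from codimension one on; the remaining relations are those downstairs. So F^p in dimension
  m + 1 is F^p in dimension m plus one copy of F^(p-1) in dimension m for each of the functions, which
  is the recursion satisfied by the coefficients of the product.
*)

theory Submission
  imports Defs "HOL-Library.Function_Algebras"
begin

section \<open>Linear algebra of quotients of free spaces\<close>

text \<open>The dimension of the quotient is found through functionals on flags that vanish on all
  relations: a basis is certified by a dual family of such functionals together with an expansion of
  every such functional. Membership in the span of the relations is then needed only once, where a
  vector outside a span is separated from it by a functional. The obstacle is that an edge does not
  determine the function whose graph it is: two of the affine functions may agree over an edge K and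
  then have the same graph over K. The functional belonging to a function g must therefore see every
  flag whose first graph lies in the graph of g, also when that flag is presented with another
  function f. Different functions meet only in the relation at the step where the cylinders end. Of
  the flags in that relation g sees either none or exactly two, one with an additional cylinder and
  one whose graphs start a step earlier. Both come from the same flag downstairs, and a sign that
  alternates with the number of cylinders makes them cancel.\<close>

lemma carrier_free_vs: "carrier (free_vs S) = {f. finite {s. f s \<noteq> 0} \<and> {s. f s \<noteq> 0} \<subseteq> S}"
  by (simp add: free_vs_def)

lemma free_vs_sel [simp]:
  "\<zero>\<^bsub>free_vs S\<^esub> = (\<lambda>s. 0)"
  "f \<oplus>\<^bsub>free_vs S\<^esub> g = (\<lambda>s. f s + g s)"
  "c \<odot>\<^bsub>free_vs S\<^esub> f = (\<lambda>s. c * f s)"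
  by (simp_all add: free_vs_def)

lemma free_vs_carrier_finite:
  "finite S \<Longrightarrow> f \<in> carrier (free_vs S) \<longleftrightarrow> (\<forall>s. s \<notin> S \<longrightarrow> f s = 0)"
  by (auto simp: carrier_free_vs intro: finite_subset)

lemma vectorspace_free_vs: "vectorspace class_ring (free_vs S)"
proof (rule vs_criteria)
  show "field (class_ring :: complex ring)" by (rule class_field)
  show "\<forall>v w. v \<in> carrier (free_vs S) \<and> w \<in> carrier (free_vs S) \<longrightarrow>
    v \<oplus>\<^bsub>free_vs S\<^esub> w \<in> carrier (free_vs S)"
  proof (intro allI impI)
    fix v w :: "'a \<Rightarrow> complex"
    assume "v \<in> carrier (free_vs S) \<and> w \<in> carrier (free_vs S)"
    then have *: "finite ({s. v s \<noteq> 0} \<union> {s. w s \<noteq> 0})" "{s. v s \<noteq> 0} \<union> {s. w s \<noteq> 0} \<subseteq> S"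
      by (auto simp: carrier_free_vs)
    have "{s. v s + w s \<noteq> 0} \<subseteq> {s. v s \<noteq> 0} \<union> {s. w s \<noteq> 0}" by auto
    with * show "v \<oplus>\<^bsub>free_vs S\<^esub> w \<in> carrier (free_vs S)"
      by (auto simp: carrier_free_vs intro: finite_subset)
  qed
  show "\<forall>v\<in>carrier (free_vs S). \<exists>neg_v\<in>carrier (free_vs S).
    v \<oplus>\<^bsub>free_vs S\<^esub> neg_v = \<zero>\<^bsub>free_vs S\<^esub>"
  proof
    fix v assume "v \<in> carrier (free_vs S)"
    then show "\<exists>neg_v\<in>carrier (free_vs S). v \<oplus>\<^bsub>free_vs S\<^esub> neg_v = \<zero>\<^bsub>free_vs S\<^esub>"
      by (intro bexI[of _ "\<lambda>s. - v s"]) (auto simp: carrier_free_vs)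
  qed
next
  show "\<forall>c v. c \<in> carrier class_ring \<and> v \<in> carrier (free_vs S) \<longrightarrow>
    c \<odot>\<^bsub>free_vs S\<^esub> v \<in> carrier (free_vs S)"
  proof (intro allI impI)
    fix c :: complex and v :: "'a \<Rightarrow> complex"
    assume "c \<in> carrier class_ring \<and> v \<in> carrier (free_vs S)"
    then have v: "finite {s. v s \<noteq> 0}" "{s. v s \<noteq> 0} \<subseteq> S"
      by (auto simp: carrier_free_vs)
    have "{s. c * v s \<noteq> 0} \<subseteq> {s. v s \<noteq> 0}" by auto
    with v show "c \<odot>\<^bsub>free_vs S\<^esub> v \<in> carrier (free_vs S)"
      by (auto simp: carrier_free_vs intro: finite_subset)
  qed
qed (simp_all add: carrier_free_vs algebra_simps)

lemma finsum_free_vs: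
  assumes "finite A" "\<And>a. a \<in> A \<Longrightarrow> g a \<in> carrier (free_vs S)"
  shows "(\<Oplus>\<^bsub>free_vs S\<^esub>a\<in>A. g a) = (\<lambda>s. \<Sum>a\<in>A. g a s)"
proof -
  interpret V: vectorspace class_ring "free_vs S" by (rule vectorspace_free_vs)
  show ?thesis
    using assms
  proof (induction A rule: finite_induct)
    case (insert x A)
    then have "finsum (free_vs S) g (insert x A) = g x \<oplus>\<^bsub>free_vs S\<^esub> finsum (free_vs S) g A"
      by (intro V.finsum_insert) auto
    with insert show ?case by (simp add: fun_eq_iff)
  qed simp
qed

lemma free_gen_carrier: "s \<in> S \<Longrightarrow> free_gen s \<in> carrier (free_vs S)"
  by (auto simp: carrier_free_vs free_gen_def)

lemma dim_free_vs:
  assumes "finite B"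
  shows "vectorspace.fin_dim class_ring (free_vs B)"
    and "vectorspace.dim class_ring (free_vs B) = card B"
proof -
  interpret V: vectorspace class_ring "free_vs B" by (rule vectorspace_free_vs)
  have inj: "inj_on free_gen B"
    by (rule inj_onI) (metis free_gen_def zero_neq_one)
  have sub: "free_gen ` B \<subseteq> carrier (free_vs B)"
    by (rule image_subsetI) (rule free_gen_carrier)
  have fin: "finite (free_gen ` B)" using assms by simp
  have lc: "V.lincomb a (free_gen ` B) = (\<lambda>s. if s \<in> B then a (free_gen s) else 0)" for a
  proof -
    have "V.lincomb a (free_gen ` B) = (\<lambda>s. \<Sum>v\<in>free_gen ` B. (a v \<odot>\<^bsub>free_vs B\<^esub> v) s)"
      unfolding V.lincomb_def
      by (rule finsum_free_vs[OF fin], rule V.smult_closed) (use sub in auto)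
    also have "\<dots> = (\<lambda>s. \<Sum>b\<in>B. a (free_gen b) * free_gen b s)"
      by (subst sum.reindex[OF inj]) simp
    also have "\<dots> = (\<lambda>s. if s \<in> B then a (free_gen s) else 0)"
      using assms by (simp add: free_gen_def if_distrib[of "(*) _"] cong: if_cong)
    finally show ?thesis .
  qed
  have gen: "V.gen_set (free_gen ` B)"
  proof (rule antisym)
    show "V.span (free_gen ` B) \<subseteq> carrier (free_vs B)"
      by (rule V.span_is_subset2[OF sub])
    show "carrier (free_vs B) \<subseteq> V.span (free_gen ` B)"
    proof
      fix f assume f: "f \<in> carrier (free_vs B)"
      have "f = V.lincomb (\<lambda>v. f (inv_into B free_gen v)) (free_gen ` B)"
        unfolding lc using f inj by (auto simp: carrier_free_vs fun_eq_iff)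
      then show "f \<in> V.span (free_gen ` B)"
        using fin unfolding V.span_def by auto
    qed
  qed
  have li: "V.lin_indpt (free_gen ` B)"
  proof (rule V.finite_lin_indpt2[OF fin sub])
    fix a assume "V.lincomb a (free_gen ` B) = \<zero>\<^bsub>free_vs B\<^esub>"
    then show "\<forall>v\<in>free_gen ` B. a v = \<zero>\<^bsub>class_ring\<^esub>"
      unfolding lc by (auto simp: fun_eq_iff split: if_splits)
  qed
  show "V.fin_dim" unfolding V.fin_dim_def using gen fin sub by blast
  have "V.basis (free_gen ` B)" using gen li sub unfolding V.basis_def by blast
  from V.dim_basis[OF fin this] show "V.dim = card B"
    by (simp add: card_image[OF inj])
qed

text \<open>The vector space axioms are equations and closure conditions, so they pass along any
  surjection that respects the operations. In this form \<open>Q\<close> may be a bare record about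
  which nothing is known beforehand, as \<open>quot_vs\<close> is.\<close>

lemma vectorspace_surj_image:
  fixes V :: "(complex, 'v) module" and Q :: "(complex, 'w) module"
  assumes "vectorspace class_ring V"
    and car: "carrier Q = T ` carrier V"
    and zero: "\<zero>\<^bsub>Q\<^esub> = T \<zero>\<^bsub>V\<^esub>"
    and add: "\<And>v w. v \<in> carrier V \<Longrightarrow> w \<in> carrier V \<Longrightarrow> T v \<oplus>\<^bsub>Q\<^esub> T w = T (v \<oplus>\<^bsub>V\<^esub> w)"
    and smult: "\<And>a v. v \<in> carrier V \<Longrightarrow> a \<odot>\<^bsub>Q\<^esub> T v = T (a \<odot>\<^bsub>V\<^esub> v)"
  shows "vectorspace class_ring Q"
proof -
  interpret V: vectorspace class_ring V by fact
  have neg: "\<exists>w\<in>carrier V. T v \<oplus>\<^bsub>Q\<^esub> T w = T \<zero>\<^bsub>V\<^esub>" if "v \<in> carrier V" for v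
    using that by (intro bexI[of _ "\<ominus>\<^bsub>V\<^esub> v"]) (simp_all add: add V.r_neg)
  have closed: "a \<odot>\<^bsub>V\<^esub> v \<in> carrier V" if "v \<in> carrier V" for a v
    using V.smult_closed[of a v] that by simp
  note V_ax = V.smult_r_distr[of a for a, simplified] V.smult_l_distr[of a b for a b, simplified]
    V.smult_assoc1[of a b for a b, simplified]
  show ?thesis
  proof (rule vs_criteria)
    show "\<forall>v w. v \<in> carrier Q \<and> w \<in> carrier Q \<longrightarrow> v \<oplus>\<^bsub>Q\<^esub> w = w \<oplus>\<^bsub>Q\<^esub> v"
      unfolding car by (auto simp: add V.a_comm)
    show "\<forall>v w x. v \<in> carrier Q \<and> w \<in> carrier Q \<and> x \<in> carrier Q \<longrightarrow>
      v \<oplus>\<^bsub>Q\<^esub> w \<oplus>\<^bsub>Q\<^esub> x = v \<oplus>\<^bsub>Q\<^esub> (w \<oplus>\<^bsub>Q\<^esub> x)"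
      unfolding car by (auto simp: add V.a_assoc)
    show "\<forall>a b v. a \<in> carrier class_ring \<and> b \<in> carrier class_ring \<and> v \<in> carrier Q \<longrightarrow>
      (a \<otimes>\<^bsub>class_ring\<^esub> b) \<odot>\<^bsub>Q\<^esub> v = a \<odot>\<^bsub>Q\<^esub> (b \<odot>\<^bsub>Q\<^esub> v)"
      unfolding car by (auto simp: smult closed V_ax)
    show "\<forall>a b v. a \<in> carrier class_ring \<and> b \<in> carrier class_ring \<and> v \<in> carrier Q \<longrightarrow>
      (a \<oplus>\<^bsub>class_ring\<^esub> b) \<odot>\<^bsub>Q\<^esub> v = (a \<odot>\<^bsub>Q\<^esub> v) \<oplus>\<^bsub>Q\<^esub> (b \<odot>\<^bsub>Q\<^esub> v)"
      unfolding car by (auto simp: smult add closed V_ax)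
    show "\<forall>a v w. a \<in> carrier class_ring \<and> v \<in> carrier Q \<and> w \<in> carrier Q \<longrightarrow>
      a \<odot>\<^bsub>Q\<^esub> (v \<oplus>\<^bsub>Q\<^esub> w) = (a \<odot>\<^bsub>Q\<^esub> v) \<oplus>\<^bsub>Q\<^esub> (a \<odot>\<^bsub>Q\<^esub> w)"
      unfolding car by (auto simp: smult add closed V_ax)
    show "\<forall>v\<in>carrier Q. \<one>\<^bsub>class_ring\<^esub> \<odot>\<^bsub>Q\<^esub> v = v"
      using V.smult_one unfolding car by (auto simp: smult)
    show "\<forall>v\<in>carrier Q. \<exists>neg_v\<in>carrier Q. v \<oplus>\<^bsub>Q\<^esub> neg_v = \<zero>\<^bsub>Q\<^esub>"
      using neg unfolding car zero by blast
  qed (auto simp: car zero add smult closed class_field)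
qed

text \<open>Gives access to the hand-built quotient through its projection: linear, surjective, with
  kernel \<open>W\<close>. Nothing else about cosets is used later.\<close>

lemma linear_map_quot_vs:
  fixes V :: "(complex, 'v) module"
  assumes "vectorspace class_ring V" and W: "submodule class_ring W V"
  shows "linear_map class_ring V (quot_vs V W) (\<lambda>v. W +>\<^bsub>V\<^esub> v)"
    and "carrier (quot_vs V W) = (\<lambda>v. W +>\<^bsub>V\<^esub> v) ` carrier V"
    and "v \<in> carrier V \<Longrightarrow> W +>\<^bsub>V\<^esub> v = \<zero>\<^bsub>quot_vs V W\<^esub> \<longleftrightarrow> v \<in> W"
proof -
  interpret V: vectorspace class_ring V by fact
  interpret W: submodule class_ring W V by fact
  let ?Q = "quot_vs V W" and ?c = "\<lambda>v. W +>\<^bsub>V\<^esub> v"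
  have neg: "\<ominus>\<^bsub>V\<^esub> w \<in> W" if "w \<in> W" for w
  proof -
    have "(- 1) \<odot>\<^bsub>V\<^esub> w \<in> W" using W.smult_closed[of "-1" w] that by simp
    moreover have "(- 1) \<odot>\<^bsub>V\<^esub> w = \<ominus>\<^bsub>V\<^esub> w"
      using V.smult_minus_1[of w] W.subset that by (simp add: subset_iff class_ring_simps)
    ultimately show ?thesis by simp
  qed
  have add: "additive_subgroup W V"
  proof (rule additive_subgroupI, rule group.subgroupI)
    show "group (add_monoid V)" by (rule V.a_group)
    show "W \<noteq> {}" using W.zero_closed by blast
  qed (use W.subset neg in \<open>auto simp: a_inv_def\<close>)
  interpret W: abelian_subgroup W V
    by (rule abelian_subgroupI3[OF add V.abelian_group_axioms])
  show car: "carrier ?Q = ?c ` carrier V"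
    by (auto simp: quot_vs_def A_RCOSETS_def' )
  have add: "?c v \<oplus>\<^bsub>?Q\<^esub> ?c w = ?c (v \<oplus>\<^bsub>V\<^esub> w)" if "v \<in> carrier V" "w \<in> carrier V" for v w
    using that by (simp add: quot_vs_def W.a_rcos_sum)
  \<comment> \<open>The union over all representatives in the definition of scalar multiplication
    collapses, because multiples of congruent vectors are congruent.\<close>
  have smult: "a \<odot>\<^bsub>?Q\<^esub> ?c v = ?c (a \<odot>\<^bsub>V\<^esub> v)" if v: "v \<in> carrier V" for a v
  proof -
    have "?c (a \<odot>\<^bsub>V\<^esub> u) = ?c (a \<odot>\<^bsub>V\<^esub> v)" if u: "u \<in> ?c v" for u
    proof -
      obtain w where w: "w \<in> W" "u = w \<oplus>\<^bsub>V\<^esub> v" using u by (auto simp: a_r_coset_def')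
      then have "w \<in> carrier V" using W.subset by blast
      with w v have "a \<odot>\<^bsub>V\<^esub> u = a \<odot>\<^bsub>V\<^esub> w \<oplus>\<^bsub>V\<^esub> a \<odot>\<^bsub>V\<^esub> v"
        by (simp add: V.smult_r_distr)
      moreover have "a \<odot>\<^bsub>V\<^esub> w \<in> W" using w by simp
      ultimately have "a \<odot>\<^bsub>V\<^esub> u \<in> ?c (a \<odot>\<^bsub>V\<^esub> v)"
        by (auto simp: a_r_coset_def')
      then show ?thesis
        using v by (intro V.a_repr_independence[symmetric] W.a_subgroup) auto
    qed
    moreover have "v \<in> ?c v" using v by (rule W.a_rcos_self)
    ultimately have "(\<Union>u\<in>?c v. ?c (a \<odot>\<^bsub>V\<^esub> u)) = ?c (a \<odot>\<^bsub>V\<^esub> v)" by blast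
    then show ?thesis by (simp add: quot_vs_def)
  qed
  have zero: "\<zero>\<^bsub>?Q\<^esub> = ?c \<zero>\<^bsub>V\<^esub>"
    using V.a_coset_join2[OF _ W.a_subgroup, of "\<zero>\<^bsub>V\<^esub>"] by (simp add: quot_vs_def)
  have "vectorspace class_ring ?Q"
    by (rule vectorspace_surj_image[where T = ?c, OF assms(1) car zero add smult])
  moreover have "?c \<in> LinearCombinations.module_hom class_ring V ?Q"
    unfolding LinearCombinations.module_hom_def using car add smult by auto
  ultimately show "linear_map class_ring V ?Q ?c"
    by (intro linear_map.intro mod_hom.intro mod_hom_axioms.intro assms(1))
       (simp_all only: vectorspace_def V.module_axioms)
  show "?c v = \<zero>\<^bsub>?Q\<^esub> \<longleftrightarrow> v \<in> W" if v: "v \<in> carrier V"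
  proof -
    have "\<zero>\<^bsub>?Q\<^esub> = W" by (simp add: quot_vs_def)
    then show ?thesis
      using W.a_rcos_self[OF v] V.a_coset_join2[OF v W.a_subgroup] by metis
  qed
qed

text \<open>A basis of the span of \<open>R\<close> stays independent when \<open>v\<close> is
  added, so there is a functional that is 1 at \<open>v\<close> and 0 on \<open>R\<close>. On a
  finite free space a functional is the family of its values \<open>\<chi>\<close> on generators,
  whence the sums over \<open>S\<close>.\<close>

lemma span_free_vs_separation:
  fixes S :: "'b set"
  assumes fin: "finite S" and R: "R \<subseteq> carrier (free_vs S)"
    and v: "v \<in> carrier (free_vs S)"
    and nin: "v \<notin> LinearCombinations.module.span class_ring (free_vs S) R"
  obtains \<chi> where "\<And>r. r \<in> R \<Longrightarrow> (\<Sum>s\<in>S. r s * \<chi> s) = 0" and "(\<Sum>s\<in>S. v s * \<chi> s) \<noteq> 0"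
proof -
  interpret V: vectorspace class_ring "free_vs S" by (rule vectorspace_free_vs)
  interpret F: vector_space_pair "\<lambda>(c::complex) (f::'b \<Rightarrow> complex) s. c * f s" "(*) :: complex \<Rightarrow> _"
    by unfold_locales (auto simp: fun_eq_iff algebra_simps)
  let ?W = "V.span R"
  interpret W: submodule class_ring ?W "free_vs S" by (rule V.span_is_submodule[OF R])
  \<comment> \<open>Functionals are extended in the setting of vector spaces on a whole type; this
    inclusion of its span in the span relative to the carrier transfers \<open>nin\<close> to that
    setting.\<close>
  have "F.vs1.span R \<subseteq> ?W"
  proof (rule F.vs1.span_minimal)
    show "R \<subseteq> ?W" by (rule V.in_own_span[OF R])
    show "F.vs1.subspace ?W"
      unfolding F.vs1.subspace_def
      using W.zero_closed W.m_closed W.smult_closed by (simp add: zero_fun_def plus_fun_def)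
  qed
  then have nin': "v \<notin> F.vs1.span R" using nin by blast
  obtain B where B: "B \<subseteq> R" "F.vs1.independent B" "R \<subseteq> F.vs1.span B"
    by (rule F.vs1.basis_exists[of R])
  have "v \<notin> F.vs1.span B" using nin' F.vs1.span_mono[OF B(1)] by blast
  then have ind: "F.vs1.independent (insert v B)" by (rule F.vs1.independent_insertI[OF _ B(2)])
  have "v \<notin> B" using \<open>v \<notin> F.vs1.span B\<close> F.vs1.span_base by blast
  obtain g where g: "Vector_Spaces.linear (\<lambda>(c::complex) (f::'b \<Rightarrow> complex) s. c * f s) (*) g"
      "\<And>x. x \<in> insert v B \<Longrightarrow> g x = (if x = v then 1 else 0)"
    using F.linear_independent_extend[OF ind, of "\<lambda>x. if x = v then 1 else 0"] by blast
  have g_sum: "(\<Sum>s\<in>S. w s * g (free_gen s)) = g w" if w: "w \<in> carrier (free_vs S)" for w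
  proof -
    have sum_apply: "(\<Sum>s\<in>A. h s) t = (\<Sum>s\<in>A. h s t)" for A :: "'b set" and h :: "'b \<Rightarrow> 'b \<Rightarrow> complex" and t
      by (induction A rule: infinite_finite_induct) auto
    have "w = (\<Sum>s\<in>S. (\<lambda>t. w s * free_gen s t))"
      using w fin by (auto simp: free_vs_carrier_finite fun_eq_iff sum_apply free_gen_def if_distrib[of "(*) _"] cong: if_cong)
    then have "g w = g (\<Sum>s\<in>S. (\<lambda>t. w s * free_gen s t))" by simp
    also have "\<dots> = (\<Sum>s\<in>S. w s * g (free_gen s))"
      by (simp add: F.linear_sum[OF g(1)] F.linear_scale[OF g(1)])
    finally show ?thesis by simp
  qed
  show thesis
  proof (rule that)
    show "(\<Sum>s\<in>S. v s * g (free_gen s)) \<noteq> 0" using g_sum[OF v] g(2)[of v] by simp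
    fix r assume r: "r \<in> R"
    have "g r = 0"
      by (rule F.linear_eq_0_on_span[OF g(1), of B]) (use g(2) \<open>v \<notin> B\<close> B(3) r in auto)
    then show "(\<Sum>s\<in>S. r s * g (free_gen s)) = 0" using g_sum r R by auto
  qed
qed

text \<open>The linear map from \<open>free_vs B\<close> to the quotient is injective because the
  functionals \<open>\<phi> b\<close> descend to the quotient and are dual to \<open>B\<close>. It
  is surjective because \<open>expand\<close> makes every functional that kills \<open>R\<close>
  also kill the difference between a vector and its combination of \<open>B\<close>; separation then
  puts this difference into the span.\<close>

lemma dim_quot_free_vs:
  fixes S :: "'b set" and \<phi> :: "'b \<Rightarrow> 'b \<Rightarrow> complex"
  assumes fin: "finite S" and R: "R \<subseteq> carrier (free_vs S)" and B: "B \<subseteq> S"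
    and dual: "\<And>b b'. b \<in> B \<Longrightarrow> b' \<in> B \<Longrightarrow> \<phi> b b' = (if b = b' then 1 else 0)"
    and ann: "\<And>b r. b \<in> B \<Longrightarrow> r \<in> R \<Longrightarrow> (\<Sum>s\<in>S. r s * \<phi> b s) = 0"
    and expand: "\<And>\<chi> s. (\<And>r. r \<in> R \<Longrightarrow> (\<Sum>s\<in>S. r s * \<chi> s) = 0) \<Longrightarrow> s \<in> S \<Longrightarrow>
      \<chi> s = (\<Sum>b\<in>B. \<phi> b s * \<chi> b)"
  shows "vectorspace.dim class_ring
    (quot_vs (free_vs S) (LinearCombinations.module.span class_ring (free_vs S) R)) = card B"
proof -
  interpret V: vectorspace class_ring "free_vs S" by (rule vectorspace_free_vs)
  interpret U: vectorspace class_ring "free_vs B" by (rule vectorspace_free_vs)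
  have finB: "finite B" using fin B by (rule finite_subset[rotated])
  let ?W = "V.span R"
  let ?Q = "quot_vs (free_vs S) ?W"
  have sm: "submodule class_ring ?W (free_vs S)" by (rule V.span_is_submodule[OF R])
  interpret W: submodule class_ring ?W "free_vs S" by (rule sm)
  note quot = linear_map_quot_vs[OF V.vectorspace_axioms sm]
  interpret P: linear_map class_ring "free_vs S" ?Q "\<lambda>v. ?W +>\<^bsub>free_vs S\<^esub> v" by (rule quot(1))
  have sub: "carrier (free_vs B) \<subseteq> carrier (free_vs S)" using B by (auto simp: carrier_free_vs)
  \<comment> \<open>The kernel of a functional is a submodule, so vanishing on \<open>R\<close>
    extends to the span.\<close>
  have ann_W: "(\<Sum>s\<in>S. w s * \<phi> b s) = 0" if "b \<in> B" "w \<in> ?W" for b w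
  proof -
    let ?K = "{w \<in> carrier (free_vs S). (\<Sum>s\<in>S. w s * \<phi> b s) = 0}"
    have "submodule class_ring ?K (free_vs S)"
    proof (unfold_locales)
      show "?K \<subseteq> carrier (free_vs S)" by blast
      show "\<zero>\<^bsub>free_vs S\<^esub> \<in> ?K" using V.zero_closed by simp
      show "v \<oplus>\<^bsub>free_vs S\<^esub> w \<in> ?K" if "v \<in> ?K" "w \<in> ?K" for v w
        using that V.a_closed[of v w] by (simp add: algebra_simps sum.distrib)
      show "c \<odot>\<^bsub>free_vs S\<^esub> v \<in> ?K" if "c \<in> carrier class_ring" "v \<in> ?K" for c v
        using that V.smult_closed[of c v] by (simp add: algebra_simps flip: sum_distrib_left)
    qed
    from V.span_is_subset[OF _ this, of R] R ann that show ?thesis by blast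
  qed
  have inj_aux: "f = (\<lambda>s. 0)" if f: "f \<in> carrier (free_vs B)" "f \<in> ?W" for f
  proof
    fix s
    show "f s = 0"
    proof (cases "s \<in> B")
      case True
      have "0 = (\<Sum>t\<in>S. f t * \<phi> s t)" using ann_W[OF True f(2)] by simp
      also have "\<dots> = (\<Sum>t\<in>B. f t * \<phi> s t)"
        using f(1) fin B by (intro sum.mono_neutral_right) (auto simp: carrier_free_vs)
      also have "\<dots> = f s" using finB True dual by (simp add: if_distrib[of "(*) _"] cong: if_cong)
      finally show ?thesis by simp
    qed (use f in \<open>auto simp: carrier_free_vs\<close>)
  qed
  have ops: "x \<oplus>\<^bsub>free_vs B\<^esub> y = x \<oplus>\<^bsub>free_vs S\<^esub> y" "c \<odot>\<^bsub>free_vs B\<^esub> x = c \<odot>\<^bsub>free_vs S\<^esub> x" for x y c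
    by simp_all
  interpret T: linear_map class_ring "free_vs B" ?Q "\<lambda>v. ?W +>\<^bsub>free_vs S\<^esub> v"
  proof (intro linear_map.intro mod_hom.intro mod_hom_axioms.intro)
    show "(\<lambda>v. ?W +>\<^bsub>free_vs S\<^esub> v) \<in> LinearCombinations.module_hom class_ring (free_vs B) ?Q"
      unfolding LinearCombinations.module_hom_def
    proof (rule CollectI, intro conjI allI impI Pi_I)
      fix v w :: "'b \<Rightarrow> complex" and c :: complex
      show "?W +>\<^bsub>free_vs S\<^esub> v \<in> carrier ?Q" if "v \<in> carrier (free_vs B)"
        using P.f_im[of v] sub that by blast
      show "?W +>\<^bsub>free_vs S\<^esub> (v \<oplus>\<^bsub>free_vs B\<^esub> w) =
          (?W +>\<^bsub>free_vs S\<^esub> v) \<oplus>\<^bsub>?Q\<^esub> (?W +>\<^bsub>free_vs S\<^esub> w)"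
        if "v \<in> carrier (free_vs B) \<and> w \<in> carrier (free_vs B)"
        unfolding ops by (rule P.f_add) (use sub that in blast)+
      show "?W +>\<^bsub>free_vs S\<^esub> (c \<odot>\<^bsub>free_vs B\<^esub> v) = c \<odot>\<^bsub>?Q\<^esub> (?W +>\<^bsub>free_vs S\<^esub> v)"
        if "c \<in> carrier class_ring \<and> v \<in> carrier (free_vs B)"
        unfolding ops by (rule P.f_smult) (use sub that in blast)+
    qed
  qed (use quot(1) U.vectorspace_axioms in \<open>simp_all only: linear_map_def vectorspace_def\<close>)
  have "inj_on (\<lambda>v. ?W +>\<^bsub>free_vs S\<^esub> v) (carrier (free_vs B))"
  proof (rule T.Ke0_imp_inj)
    have "T.kerT = {\<zero>\<^bsub>free_vs B\<^esub>}"
    proof (rule equalityI)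
      show "T.kerT \<subseteq> {\<zero>\<^bsub>free_vs B\<^esub>}"
        using inj_aux quot(3) sub by (auto simp: T.ker_def)
      show "{\<zero>\<^bsub>free_vs B\<^esub>} \<subseteq> T.kerT"
        unfolding T.ker_def using U.zero_closed T.f0_is_0 by blast
    qed
    then show "carrier (free_vs B\<lparr>carrier := T.kerT\<rparr>) = {\<zero>\<^bsub>free_vs B\<^esub>}" by simp
  qed
  moreover have "(\<lambda>v. ?W +>\<^bsub>free_vs S\<^esub> v) ` carrier (free_vs B) = carrier ?Q"
  proof -
    have "\<exists>f\<in>carrier (free_vs B). ?W +>\<^bsub>free_vs S\<^esub> v = ?W +>\<^bsub>free_vs S\<^esub> f"
      if v: "v \<in> carrier (free_vs S)" for v
    proof -
      \<comment> \<open>The coordinate of \<open>v\<close> at \<open>s\<close> is read off by the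
        dual functional \<open>\<phi> s\<close>.\<close>
      define f where "f = (\<lambda>s. if s \<in> B then \<Sum>t\<in>S. v t * \<phi> s t else 0)"
      have f: "f \<in> carrier (free_vs B)"
        unfolding free_vs_carrier_finite[OF finB] by (simp add: f_def)
      define d where "d = (\<lambda>s. v s - f s)"
      have d: "d \<in> carrier (free_vs S)"
        using v f B by (auto simp: d_def free_vs_carrier_finite fin finB)
      have "d \<in> ?W"
      proof (rule ccontr)
        assume "d \<notin> ?W"
        then obtain \<chi> where \<chi>: "\<And>r. r \<in> R \<Longrightarrow> (\<Sum>s\<in>S. r s * \<chi> s) = 0"
            "(\<Sum>s\<in>S. d s * \<chi> s) \<noteq> 0"
          by (rule span_free_vs_separation[OF fin R d]) blast
        have "(\<Sum>s\<in>S. v s * \<chi> s) = (\<Sum>s\<in>S. \<Sum>b\<in>B. v s * \<phi> b s * \<chi> b)"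
          by (intro sum.cong refl) (subst expand[OF \<chi>(1)], auto simp: sum_distrib_left mult.assoc)
        also have "\<dots> = (\<Sum>b\<in>B. f b * \<chi> b)"
          by (subst sum.swap) (simp add: f_def sum_distrib_right)
        also have "\<dots> = (\<Sum>s\<in>S. f s * \<chi> s)"
          using fin B by (intro sum.mono_neutral_left) (auto simp: f_def)
        finally show False using \<chi>(2) by (simp add: d_def algebra_simps sum_subtractf)
      qed
      have "v = d \<oplus>\<^bsub>free_vs S\<^esub> f" by (simp add: d_def)
      then have "?W +>\<^bsub>free_vs S\<^esub> v =
          (?W +>\<^bsub>free_vs S\<^esub> d) \<oplus>\<^bsub>?Q\<^esub> (?W +>\<^bsub>free_vs S\<^esub> f)"
        using P.f_add[of d f] d f sub by (simp del: free_vs_sel add: subset_iff)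
      also have "\<dots> = ?W +>\<^bsub>free_vs S\<^esub> f"
        using quot(3)[OF d] \<open>d \<in> ?W\<close> T.f_im[OF f] by (simp del: free_vs_sel)
      finally show ?thesis using f by blast
    qed
    then show ?thesis using sub unfolding quot(2) by blast
  qed
  ultimately have "U.dim = vectorspace.dim class_ring ?Q"
    by (intro T.dim_eq dim_free_vs finB)
  then show ?thesis using dim_free_vs(2)[OF finB] by simp
qed

section \<open>Bases of flag spaces\<close>

definition edges_between :: "nat \<Rightarrow> arrangement \<Rightarrow> nat \<Rightarrow> complex vec set \<Rightarrow> complex vec set \<Rightarrow> complex vec set set"
  where "edges_between m \<C> i U L = {M \<in> edges m \<C>. codim m M = i \<and> L \<subset> M \<and> M \<subset> U}"

definition gapped_chain :: "nat \<Rightarrow> arrangement \<Rightarrow> nat \<Rightarrow> complex vec set list \<Rightarrow> complex vec set list \<Rightarrow> bool"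
  where "gapped_chain m \<C> p Ls Ls' \<longleftrightarrow> 0 < length Ls \<and> length Ls < p \<and>
    Ls @ Ls' \<in> edge_chains m \<C> ([0..<length Ls] @ [Suc (length Ls)..<Suc p])"

text \<open>A functional is given by its values on flags, and the sum is its value on one relation.
  Each argument \<open>Ls @ M # Ls'\<close> is a flag, so values of \<open>\<chi>\<close> elsewhere
  are never consulted.\<close>

definition annihilates :: "nat \<Rightarrow> arrangement \<Rightarrow> nat \<Rightarrow> (complex vec set list \<Rightarrow> complex) \<Rightarrow> bool"
  where "annihilates m \<C> p \<chi> \<longleftrightarrow> (\<forall>Ls Ls'. gapped_chain m \<C> p Ls Ls' \<longrightarrow>
    (\<Sum>M\<in>edges_between m \<C> (length Ls) (last Ls) (hd Ls'). \<chi> (Ls @ M # Ls')) = 0)"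

text \<open>
  The last clause says dually that \<open>B\<close> spans the flag space. In this form it can be transported along
  maps of flags by composing functionals, without handling the span of the relations.
\<close>

definition has_flag_basis :: "nat \<Rightarrow> arrangement \<Rightarrow> nat \<Rightarrow> nat \<Rightarrow> bool"
  where "has_flag_basis m \<C> p n \<longleftrightarrow> (\<exists>B \<phi>. finite B \<and> card B = n \<and> B \<subseteq> flags m \<C> p \<and>
    (\<forall>b\<in>B. \<forall>b'\<in>B. \<phi> b b' = (if b = b' then 1 else 0)) \<and>
    (\<forall>b\<in>B. annihilates m \<C> p (\<phi> b)) \<and>
    (\<forall>\<chi>. annihilates m \<C> p \<chi> \<longrightarrow> (\<forall>F\<in>flags m \<C> p. \<chi> F = (\<Sum>b\<in>B. \<phi> b F * \<chi> b))))"

text \<open>Allows the basis to be indexed by any set, such as a disjoint sum; duality forces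
  \<open>b\<close> to be injective, so that no two indices share a flag.\<close>

lemma has_flag_basisI:
  assumes fin: "finite I" and b: "\<And>i. i \<in> I \<Longrightarrow> b i \<in> flags m \<C> p"
    and dual: "\<And>i j. i \<in> I \<Longrightarrow> j \<in> I \<Longrightarrow> \<phi> i (b j) = (if i = j then 1 else 0)"
    and ann: "\<And>i. i \<in> I \<Longrightarrow> annihilates m \<C> p (\<phi> i)"
    and expand: "\<And>\<chi> F. annihilates m \<C> p \<chi> \<Longrightarrow> F \<in> flags m \<C> p \<Longrightarrow>
      \<chi> F = (\<Sum>i\<in>I. \<phi> i F * \<chi> (b i))"
  shows "has_flag_basis m \<C> p (card I)"
proof -
  have inj: "inj_on b I"
    using dual by (metis inj_onI zero_neq_one)
  let ?\<phi> = "\<lambda>x. \<phi> (inv_into I b x)"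
  have inv: "inv_into I b (b i) = i" if "i \<in> I" for i using inj that by simp
  show ?thesis
    unfolding has_flag_basis_def
  proof (intro exI[of _ "b ` I"] exI[of _ ?\<phi>] conjI ballI allI impI)
    show "card (b ` I) = card I" by (rule card_image[OF inj])
    show "?\<phi> x y = (if x = y then 1 else 0)" if "x \<in> b ` I" "y \<in> b ` I" for x y
      using that dual inj by (auto simp: inv inj_on_eq_iff)
    show "annihilates m \<C> p (?\<phi> x)" if "x \<in> b ` I" for x
      using that ann by (auto simp: inv)
    show "\<chi> F = (\<Sum>x\<in>b ` I. ?\<phi> x F * \<chi> x)" if "annihilates m \<C> p \<chi>" "F \<in> flags m \<C> p" for \<chi> F
      using expand[OF that] by (simp add: sum.reindex[OF inj] inv cong: sum.cong)
  qed (use fin b in auto)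
qed

lemma finite_edges:
  assumes "finite \<C>"
  shows "finite (edges m \<C>)"
proof -
  have "edges m \<C> \<subseteq> (\<lambda>\<B>. carrier_vec m \<inter> \<Inter>\<B>) ` Pow \<C>"
    by (auto simp: edges_def)
  then show ?thesis by (rule finite_subset) (use assms in simp)
qed

lemma finite_flags:
  assumes "finite \<C>"
  shows "finite (flags m \<C> p)"
proof -
  have "flags m \<C> p \<subseteq> {xs. set xs \<subseteq> edges m \<C> \<and> length xs = Suc p}"
    by (auto simp: flags_def edge_chains_def dest: arg_cong[of _ _ length])
  then show ?thesis by (rule finite_subset) (intro finite_lists_length_eq finite_edges assms)
qed

lemma sorted_wrt_psupset_insert:
  assumes "sorted_wrt (\<supset>) (Ls @ Ls')" "Ls \<noteq> []" "Ls' \<noteq> []"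
  shows "sorted_wrt (\<supset>) (Ls @ M # Ls') \<longleftrightarrow> hd Ls' \<subset> M \<and> M \<subset> last Ls"
proof -
  have *: "sorted_wrt (\<supset>) Ls" "sorted_wrt (\<supset>) Ls'"
    using assms by (auto simp: sorted_wrt_append)
  have "last Ls \<subseteq> x" if "x \<in> set Ls" for x
    using * that assms(2) by (induction Ls) auto
  moreover have "y \<subseteq> hd Ls'" if "y \<in> set Ls'" for y
    using * that assms(3) by (cases Ls') auto
  moreover have "last Ls \<in> set Ls" "hd Ls' \<in> set Ls'" using assms by auto
  ultimately show ?thesis
    using assms(1) by (auto simp: sorted_wrt_append) blast+
qed

lemma gapped_chain_nonempty:
  assumes "gapped_chain m \<C> p Ls Ls'"
  shows "Ls \<noteq> []" "Ls' \<noteq> []"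
proof -
  have "length (Ls @ Ls') = length ([0..<length Ls] @ [Suc (length Ls)..<Suc p])"
    using assms by (metis (mono_tags, lifting) edge_chains_def gapped_chain_def length_map mem_Collect_eq)
  then show "Ls \<noteq> []" "Ls' \<noteq> []"
    using assms by (auto simp: gapped_chain_def)
qed

lemma upt_insert_gap:
  assumes "i < p"
  shows "[0..<Suc p] = [0..<i] @ i # [Suc i..<Suc p]"
  using assms upt_add_eq_append[of 0 i "Suc p - i"] by (simp add: upt_conv_Cons flip: upt_Suc)

text \<open>Turns the index set of a relation from flags into the edges that fill the gap; the
  geometry of the arrangement enters the relations through this set of edges.\<close>

lemma flags_through_gapped_chain:
  assumes "gapped_chain m \<C> p Ls Ls'"
  shows "{F \<in> flags m \<C> p. \<exists>M. F = Ls @ M # Ls'} =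
    (\<lambda>M. Ls @ M # Ls') ` edges_between m \<C> (length Ls) (last Ls) (hd Ls')"
proof -
  let ?i = "length Ls"
  note ne = gapped_chain_nonempty[OF assms]
  have ch: "Ls @ Ls' \<in> edge_chains m \<C> ([0..<?i] @ [Suc ?i..<Suc p])" and i: "?i < p"
    using assms by (auto simp: gapped_chain_def)
  have ranks: "map (codim m) Ls = [0..<?i]" "map (codim m) Ls' = [Suc ?i..<Suc p]"
    using ch by (auto simp: edge_chains_def)
  have "Ls @ M # Ls' \<in> flags m \<C> p \<longleftrightarrow> M \<in> edges_between m \<C> ?i (last Ls) (hd Ls')" for M
    using ch ne sorted_wrt_psupset_insert[of Ls Ls' M]
    by (auto simp: flags_def edge_chains_def edges_between_def upt_insert_gap[OF i] ranks
        simp del: upt_Suc)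
  then show ?thesis by auto
qed

text \<open>Passes from the dual certificate to the dimension: the annihilating functionals are
  exactly those that vanish on \<open>flag_relations\<close>.\<close>

lemma has_flag_basis_imp_dim:
  assumes fin: "finite \<C>" and "has_flag_basis m \<C> p n"
  shows "vectorspace.dim class_ring (flag_space m \<C> p) = n"
proof -
  from assms(2)[unfolded has_flag_basis_def] obtain B \<phi> where B: "card B = n" "B \<subseteq> flags m \<C> p"
      "\<forall>b\<in>B. \<forall>b'\<in>B. \<phi> b b' = (if b = b' then 1 else 0)"
      "\<forall>b\<in>B. annihilates m \<C> p (\<phi> b)"
      "\<forall>\<chi>. annihilates m \<C> p \<chi> \<longrightarrow> (\<forall>F\<in>flags m \<C> p. \<chi> F = (\<Sum>b\<in>B. \<phi> b F * \<chi> b))"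
    by (elim exE conjE) (rule that)
  let ?S = "flags m \<C> p" and ?R = "flag_relations m \<C> p"
  have finS: "finite ?S" by (rule finite_flags[OF fin])
  \<comment> \<open>The relation as a function on flags: coefficient 1 at each flag through the
    gapped chain.\<close>
  define rel where "rel Ls Ls' = (\<lambda>F. if F \<in> ?S \<and> (\<exists>M. F = Ls @ M # Ls') then 1 else (0::complex))" for Ls Ls'
  have fsum: "(\<Oplus>\<^bsub>free_vs ?S\<^esub>F\<in>{F \<in> ?S. \<exists>M. F = Ls @ M # Ls'}. free_gen F) = rel Ls Ls'" for Ls Ls'
  proof -
    let ?A = "{F \<in> ?S. \<exists>M. F = Ls @ M # Ls'}"
    have "finite ?A" using finS by simp
    then have "(\<Oplus>\<^bsub>free_vs ?S\<^esub>F\<in>?A. free_gen F) = (\<lambda>s. \<Sum>F\<in>?A. free_gen F s)"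
      by (rule finsum_free_vs) (simp add: free_gen_carrier)
    then show ?thesis using \<open>finite ?A\<close> by (auto simp: rel_def free_gen_def fun_eq_iff)
  qed
  have R: "?R = {rel Ls Ls' |Ls Ls'. gapped_chain m \<C> p Ls Ls'}"
    unfolding flag_relations_def fsum gapped_chain_def by blast
  have ann: "annihilates m \<C> p \<chi> \<longleftrightarrow> (\<forall>r\<in>?R. (\<Sum>F\<in>?S. r F * \<chi> F) = 0)" for \<chi>
  proof -
    have eq: "(\<Sum>F\<in>?S. rel Ls Ls' F * \<chi> F) =
        (\<Sum>M\<in>edges_between m \<C> (length Ls) (last Ls) (hd Ls'). \<chi> (Ls @ M # Ls'))"
      if "gapped_chain m \<C> p Ls Ls'" for Ls Ls'
    proof -
      have "(\<Sum>F\<in>?S. rel Ls Ls' F * \<chi> F) = (\<Sum>F\<in>{F \<in> ?S. \<exists>M. F = Ls @ M # Ls'}. \<chi> F)"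
        using finS by (intro sum.mono_neutral_cong_right) (auto simp: rel_def)
      also have "\<dots> = (\<Sum>M\<in>edges_between m \<C> (length Ls) (last Ls) (hd Ls'). \<chi> (Ls @ M # Ls'))"
        unfolding flags_through_gapped_chain[OF that] by (subst sum.reindex) (auto simp: inj_on_def)
      finally show ?thesis .
    qed
    have "annihilates m \<C> p \<chi> \<longleftrightarrow>
        (\<forall>Ls Ls'. gapped_chain m \<C> p Ls Ls' \<longrightarrow> (\<Sum>F\<in>?S. rel Ls Ls' F * \<chi> F) = 0)"
      unfolding annihilates_def using eq by simp
    then show ?thesis unfolding R by blast
  qed
  have "vectorspace.dim class_ring (quot_vs (free_vs ?S)
      (LinearCombinations.module.span class_ring (free_vs ?S) ?R)) = card B"
  proof (rule dim_quot_free_vs[where \<phi> = \<phi>, OF finS _ B(2)])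
    show "?R \<subseteq> carrier (free_vs ?S)"
      unfolding R using finS by (auto simp: free_vs_carrier_finite rel_def)
    show "\<phi> b b' = (if b = b' then 1 else 0)" if "b \<in> B" "b' \<in> B" for b b'
      using B(3) that by blast
    show "(\<Sum>F\<in>?S. r F * \<phi> b F) = 0" if "b \<in> B" "r \<in> ?R" for b r
      using B(4) that ann by blast
    show "\<chi> F = (\<Sum>b\<in>B. \<phi> b F * \<chi> b)"
      if "\<And>r. r \<in> ?R \<Longrightarrow> (\<Sum>F\<in>?S. r F * \<chi> F) = 0" "F \<in> ?S" for \<chi> F
      using B(5) that ann by blast
  qed
  then show ?thesis by (simp add: flag_space_def B(1) Let_def)
qed

section \<open>Flags of a fibred arrangement\<close>

definition cylinder :: "nat \<Rightarrow> complex vec set \<Rightarrow> complex vec set"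
  where "cylinder m K = {t \<in> carrier_vec (Suc m). vec_first t m \<in> K}"

definition graph_over :: "nat \<Rightarrow> (complex vec \<Rightarrow> complex) \<Rightarrow> complex vec set \<Rightarrow> complex vec set"
  where "graph_over m f K = {t \<in> carrier_vec (Suc m). vec_first t m \<in> K \<and> t $ m = f (vec_first t m)}"

definition extend_vec :: "nat \<Rightarrow> complex vec \<Rightarrow> complex \<Rightarrow> complex vec"
  where "extend_vec m x a = vec (Suc m) (\<lambda>i. if i < m then x $ i else a)"

lemma extend_vec [simp]:
  shows "extend_vec m x a \<in> carrier_vec (Suc m)" "extend_vec m x a $ m = a"
    and "x \<in> carrier_vec m \<Longrightarrow> vec_first (extend_vec m x a) m = x"
  by (auto simp: extend_vec_def vec_first_def)

lemma cylinder_carrier: "cylinder m (carrier_vec m) = carrier_vec (Suc m)"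
  by (auto simp: cylinder_def)

context
  fixes m :: nat and K :: "complex vec set"
  assumes K: "K \<subseteq> carrier_vec m"
begin

lemma ex_over:
  assumes "x \<in> K"
  shows "\<exists>t\<in>cylinder m K. vec_first t m = x \<and> t $ m = a"
  using assms K by (intro bexI[of _ "extend_vec m x a"]) (auto simp: cylinder_def)

lemma image_cylinder: "(\<lambda>t. vec_first t m) ` cylinder m K = K"
  using ex_over by (fastforce simp: cylinder_def)

lemma image_graph_over: "(\<lambda>t. vec_first t m) ` graph_over m f K = K"
  using ex_over by (fastforce simp: cylinder_def graph_over_def)

lemma cylinder_subset_iff: "cylinder m K \<subseteq> cylinder m K' \<longleftrightarrow> K \<subseteq> K'"
  using ex_over by (fastforce simp: cylinder_def)

text \<open>The graph over \<open>K\<close> only remembers \<open>f\<close> on \<open>K\<close>, so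
  one edge can be the graph of several functions. Later arguments therefore compare graphs over an
  edge rather than the functions themselves.\<close>

lemma graph_over_subset_iff: "graph_over m f K \<subseteq> graph_over m g K' \<longleftrightarrow> K \<subseteq> K' \<and> (\<forall>x\<in>K. f x = g x)"
proof
  assume *: "graph_over m f K \<subseteq> graph_over m g K'"
  have "x \<in> K' \<and> f x = g x" if "x \<in> K" for x
    using ex_over[OF that, of "f x"] * that by (force simp: cylinder_def graph_over_def)
  then show "K \<subseteq> K' \<and> (\<forall>x\<in>K. f x = g x)" by blast
qed (auto simp: graph_over_def)

lemma graph_over_subset_cylinder: "graph_over m f K \<subseteq> cylinder m K' \<longleftrightarrow> K \<subseteq> K'"
proof
  assume *: "graph_over m f K \<subseteq> cylinder m K'"
  have "x \<in> K'" if "x \<in> K" for x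
    using ex_over[OF that, of "f x"] * that by (force simp: cylinder_def graph_over_def)
  then show "K \<subseteq> K'" by blast
qed (auto simp: graph_over_def cylinder_def)

lemma not_cylinder_subset_graph_over:
  assumes "K \<noteq> {}"
  shows "\<not> cylinder m K \<subseteq> graph_over m f K'"
proof -
  from assms obtain x where "x \<in> K" by blast
  \<comment> \<open>A point of the cylinder over \<open>x\<close> at a height other than
    \<open>f x\<close>.\<close>
  with ex_over[OF this, of "f x + 1"] show ?thesis by (force simp: graph_over_def)
qed

end

lemma graph_over_cong: "(\<And>x. x \<in> K \<Longrightarrow> f x = g x) \<Longrightarrow> graph_over m f K = graph_over m g K"
  by (auto simp: graph_over_def)

section \<open>Descending chains upstairs as cylinders followed by graphs\<close>

lemma sorted_wrt_psupset_last:
  "sorted_wrt (\<supset>) Ls \<Longrightarrow> L \<in> set Ls \<Longrightarrow> last Ls \<subseteq> L"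
  by (induction Ls) auto

lemma sorted_wrt_psupset_hd:
  "sorted_wrt (\<supset>) Ls \<Longrightarrow> L \<in> set Ls \<Longrightarrow> L \<subseteq> hd Ls"
  by (cases Ls) auto

lemma map_diff_upt: "0 < a \<Longrightarrow> map (\<lambda>x. x - Suc 0) [a..<b] = [a - Suc 0..<b - Suc 0]"
  by (rule nth_equalityI) auto

text \<open>
  Both \<open>As\<close> and \<open>Cs\<close> run over edges downstairs; the section part \<open>Cs\<close> has codimensions one higher
  upstairs.
\<close>

lemma ranks_split:
  assumes "map r As @ map (\<lambda>K. Suc (r K)) Cs = [0..<i] @ [Suc i..<n]" "i < n"
  shows "i < length As \<Longrightarrow> map r As = [0..<i] @ [Suc i..<Suc (length As)]"
    and "i < length As \<Longrightarrow> map r Cs = [length As..<n - 1]"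
    and "length As \<le> i \<Longrightarrow> map r As = [0..<length As]"
    and "length As \<le> i \<Longrightarrow> 0 < length As \<Longrightarrow> map r Cs = [length As - 1..<i - 1] @ [i..<n - 1]"
proof -
  let ?a = "length As"
  have len: "?a + length Cs = n - 1" using arg_cong[OF assms(1), of length] assms(2) by simp
  have A: "map r As = take ?a ([0..<i] @ [Suc i..<n])"
    using arg_cong[OF assms(1), of "take ?a"] by simp
  have "map (\<lambda>K. Suc (r K)) Cs = drop ?a ([0..<i] @ [Suc i..<n])"
    using arg_cong[OF assms(1), of "drop ?a"] by simp
  then have "map (\<lambda>x. x - 1) (map (\<lambda>K. Suc (r K)) Cs) = map (\<lambda>x. x - 1) (drop ?a ([0..<i] @ [Suc i..<n]))"
    by simp
  then have C: "map r Cs = map (\<lambda>x. x - 1) (drop ?a ([0..<i] @ [Suc i..<n]))" by (simp add: o_def)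
  show "map r As = [0..<i] @ [Suc i..<Suc ?a]" if "i < ?a"
    using that len assms(2) unfolding A by (simp add: take_upt del: upt_Suc)
  show "map r Cs = [?a..<n - 1]" if "i < ?a"
    using that len assms(2) unfolding C by (simp add: map_diff_upt del: upt_Suc)
  show "map r As = [0..<?a]" if "?a \<le> i"
    using that len assms(2) unfolding A by (simp add: take_upt del: upt_Suc)
  show "map r Cs = [?a - 1..<i - 1] @ [i..<n - 1]" if "?a \<le> i" "0 < ?a"
    using that len assms(2) unfolding C by (simp add: map_diff_upt del: upt_Suc)
qed

lemma ranks_split_full:
  assumes "map r As @ map (\<lambda>K. Suc (r K)) Cs = [0..<n]"
  shows "map r As = [0..<length As]"
    and "0 < length As \<Longrightarrow> map r Cs = [length As - 1..<n - 1]"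
proof -
  let ?a = "length As"
  have len: "?a + length Cs = n" using arg_cong[OF assms(1), of length] by simp
  have "map r As = take ?a [0..<n]" using arg_cong[OF assms(1), of "take ?a"] by simp
  then show "map r As = [0..<?a]" using len by (simp add: take_upt)
  have "map (\<lambda>K. Suc (r K)) Cs = drop ?a [0..<n]"
    using arg_cong[OF assms(1), of "drop ?a"] by simp
  then have "map (\<lambda>x. x - 1) (map (\<lambda>K. Suc (r K)) Cs) = map (\<lambda>x. x - 1) (drop ?a [0..<n])"
    by simp
  then show "map r Cs = [?a - 1..<n - 1]" if "0 < ?a"
    using that by (simp add: o_def map_diff_upt del: upt_Suc)
qed

text \<open>Collects what the combinatorics of flags uses of the geometry: the shape of the edges
  upstairs, their codimensions, and strict growth of codimension. Elements of \<open>B\<close> are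
  functions on all complex vectors, so \<open>distinct_B\<close> asks that they be told apart
  already by their values on \<open>carrier_vec m\<close>.\<close>

locale fibred_arrangement =
  fixes m :: nat and \<C> \<C>' :: arrangement and B :: "(complex vec \<Rightarrow> complex) set"
  assumes fin_B: "finite B"
    and edges': "edges (Suc m) \<C>' = cylinder m ` edges m \<C> \<union> {graph_over m f K |f K. f \<in> B \<and> K \<in> edges m \<C>}"
    and codim_cylinder: "K \<in> edges m \<C> \<Longrightarrow> codim (Suc m) (cylinder m K) = codim m K"
    and codim_graph_over: "f \<in> B \<Longrightarrow> K \<in> edges m \<C> \<Longrightarrow> codim (Suc m) (graph_over m f K) = Suc (codim m K)"
    and codim_less: "K \<in> edges m \<C> \<Longrightarrow> K' \<in> edges m \<C> \<Longrightarrow> K \<subset> K' \<Longrightarrow> codim m K' < codim m K"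
    and distinct_B: "f \<in> B \<Longrightarrow> g \<in> B \<Longrightarrow> (\<And>x. x \<in> carrier_vec m \<Longrightarrow> f x = g x) \<Longrightarrow> f = g"
begin

abbreviation "cyl \<equiv> cylinder m"
abbreviation "gr \<equiv> graph_over m"

lemma edge_carrier: "K \<in> edges m \<C> \<Longrightarrow> K \<subseteq> carrier_vec m" "K \<in> edges m \<C> \<Longrightarrow> K \<noteq> {}"
  by (auto simp: edges_def)

lemma carrier_edge: "carrier_vec m \<in> edges m \<C>"
  unfolding edges_def by (auto intro!: exI[of _ "{}"] intro: zero_carrier_vec)

lemma edge_eqI:
  assumes "K \<in> edges m \<C>" "K' \<in> edges m \<C>" "K \<subseteq> K'" "codim m K \<le> codim m K'"
  shows "K = K'"
  using codim_less[OF assms(1,2)] assms(3,4) by auto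

lemma cyl_edge: "K \<in> edges m \<C> \<Longrightarrow> cyl K \<in> edges (Suc m) \<C>'"
  and gr_edge: "f \<in> B \<Longrightarrow> K \<in> edges m \<C> \<Longrightarrow> gr f K \<in> edges (Suc m) \<C>'"
  unfolding edges' by auto

lemmas sub_iffs = cylinder_subset_iff[OF edge_carrier(1)] graph_over_subset_iff[OF edge_carrier(1)]
  graph_over_subset_cylinder[OF edge_carrier(1)] not_cylinder_subset_graph_over[OF edge_carrier]

lemma psub_iffs:
  assumes "K \<in> edges m \<C>" "K' \<in> edges m \<C>"
  shows "cyl K \<subset> cyl K' \<longleftrightarrow> K \<subset> K'"
    and "gr f K \<subset> gr g K' \<longleftrightarrow> K \<subset> K' \<and> (\<forall>x\<in>K. f x = g x)"
    and "gr f K \<subset> cyl K' \<longleftrightarrow> K \<subseteq> K'"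
    and "\<not> cyl K \<subset> gr f K'"
proof -
  show "gr f K \<subset> gr g K' \<longleftrightarrow> K \<subset> K' \<and> (\<forall>x\<in>K. f x = g x)"
    unfolding less_le_not_le using assms by (simp add: sub_iffs) (metis subset_iff)
qed (use assms in \<open>simp_all add: less_le_not_le sub_iffs\<close>)

lemma inj_cyl: "inj_on cyl (edges m \<C>)"
  by (rule inj_onI) (metis edge_carrier(1) image_cylinder)

lemma inj_gr: "inj_on (gr f) (edges m \<C>)"
  by (rule inj_onI) (metis edge_carrier(1) image_graph_over)

text \<open>A graph contains no cylinder over an edge, so a gap between two cylinders can be filled
  by cylinders only and the relation there is the one downstairs.\<close>

lemma between_cyl:
  assumes "U \<in> edges m \<C>" "L \<in> edges m \<C>"
  shows "edges_between (Suc m) \<C>' i (cyl U) (cyl L) = cyl ` edges_between m \<C> i U L"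
proof (intro equalityI subsetI)
  fix M assume M: "M \<in> edges_between (Suc m) \<C>' i (cyl U) (cyl L)"
  then have "M \<in> edges (Suc m) \<C>'" by (simp add: edges_between_def)
  then consider K where "M = cyl K" "K \<in> edges m \<C>" | g K where "M = gr g K" "g \<in> B" "K \<in> edges m \<C>"
    unfolding edges' by blast
  then show "M \<in> cyl ` edges_between m \<C> i U L"
    by cases (use M assms in \<open>simp_all add: edges_between_def psub_iffs codim_cylinder\<close>)
next
  fix M assume "M \<in> cyl ` edges_between m \<C> i U L"
  then obtain K where "M = cyl K" "K \<in> edges_between m \<C> i U L" by blast
  then show "M \<in> edges_between (Suc m) \<C>' i (cyl U) (cyl L)"
    using assms by (simp add: edges_between_def psub_iffs codim_cylinder cyl_edge)
qed

text \<open>A cylinder does not fit inside a graph, and a graph inside the graph of \<open>f\<close>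
  belongs to a function that agrees with \<open>f\<close> over its base, so it is itself a graph of
  \<open>f\<close>. The shift \<open>Suc i\<close> is the extra codimension of graphs.\<close>

lemma between_gr:
  assumes "f \<in> B" "U \<in> edges m \<C>" "L \<in> edges m \<C>"
  shows "edges_between (Suc m) \<C>' (Suc i) (gr f U) (gr f L) = gr f ` edges_between m \<C> i U L"
proof (intro equalityI subsetI)
  fix M assume M: "M \<in> edges_between (Suc m) \<C>' (Suc i) (gr f U) (gr f L)"
  then have "M \<in> edges (Suc m) \<C>'" by (simp add: edges_between_def)
  then consider K where "M = cyl K" "K \<in> edges m \<C>" | g K where "M = gr g K" "g \<in> B" "K \<in> edges m \<C>"
    unfolding edges' by blast
  then show "M \<in> gr f ` edges_between m \<C> i U L"
  proof cases
    case 1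
    with M assms show ?thesis by (simp add: edges_between_def psub_iffs)
  next
    case 2
    with M assms have "K \<in> edges_between m \<C> i U L" "\<forall>x\<in>K. g x = f x"
      by (simp_all add: edges_between_def psub_iffs codim_graph_over)
    moreover from this(2) have "gr g K = gr f K" by (intro graph_over_cong) blast
    ultimately show ?thesis using 2 by blast
  qed
next
  fix M assume "M \<in> gr f ` edges_between m \<C> i U L"
  then obtain K where "M = gr f K" "K \<in> edges_between m \<C> i U L" by blast
  then show "M \<in> edges_between (Suc m) \<C>' (Suc i) (gr f U) (gr f L)"
    using assms by (simp add: edges_between_def psub_iffs codim_graph_over gr_edge)
qed

text \<open>Codimension leaves two possibilities: a cylinder has to lie over \<open>L\<close>, a
  graph has to lie over \<open>U\<close>. The function of such a graph may be any \<open>h\<close>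
  in \<open>B\<close> that agrees with \<open>f\<close> on \<open>L\<close>; this is where sums over
  several functions originate.\<close>

lemma between_junction:
  assumes f: "f \<in> B" and UL: "U \<in> edges m \<C>" "L \<in> edges m \<C>" "L \<subset> U"
    and codim: "codim m U = i" "codim m L = Suc i"
  shows "edges_between (Suc m) \<C>' (Suc i) (cyl U) (gr f L) =
    insert (cyl L) ((\<lambda>h. gr h U) ` {h \<in> B. \<forall>x\<in>L. f x = h x})"
proof (intro equalityI subsetI)
  fix M assume M: "M \<in> edges_between (Suc m) \<C>' (Suc i) (cyl U) (gr f L)"
  then have "M \<in> edges (Suc m) \<C>'" by (simp add: edges_between_def)
  then consider K where "M = cyl K" "K \<in> edges m \<C>" | g K where "M = gr g K" "g \<in> B" "K \<in> edges m \<C>"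
    unfolding edges' by blast
  then show "M \<in> insert (cyl L) ((\<lambda>h. gr h U) ` {h \<in> B. \<forall>x\<in>L. f x = h x})"
  proof cases
    case 1
    with M UL have "L \<subseteq> K" "codim m K = Suc i"
      by (simp_all add: edges_between_def psub_iffs codim_cylinder)
    then have "L = K" using edge_eqI[of L K] UL 1 codim by simp
    with 1 show ?thesis by simp
  next
    case 2
    with M UL have *: "K \<subseteq> U" "codim m K = i" "\<forall>x\<in>L. f x = g x"
      by (simp_all add: edges_between_def psub_iffs codim_graph_over)
    then have "K = U" using edge_eqI[of K U] UL 2 codim by simp
    with 2 * show ?thesis by blast
  qed
next
  fix M assume "M \<in> insert (cyl L) ((\<lambda>h. gr h U) ` {h \<in> B. \<forall>x\<in>L. f x = h x})"
  then consider "M = cyl L" | h where "M = gr h U" "h \<in> B" "\<forall>x\<in>L. f x = h x" by blast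
  then show "M \<in> edges_between (Suc m) \<C>' (Suc i) (cyl U) (gr f L)"
    by cases (use f UL codim in \<open>simp_all add: edges_between_def psub_iffs less_imp_le
      codim_graph_over codim_cylinder cyl_edge gr_edge\<close>)
qed

text \<open>Cylinders precede graphs because no graph contains a cylinder. One function serves all
  the graphs: they lie in the first one, so its function agrees over their bases with any other that
  represents them.\<close>

lemma sorted_edges_cases:
  assumes "set Ls \<subseteq> edges (Suc m) \<C>'" "sorted_wrt (\<supset>) Ls"
  shows "\<exists>As Cs f. Ls = map cyl As @ map (gr f) Cs \<and> set As \<subseteq> edges m \<C> \<and> set Cs \<subseteq> edges m \<C> \<and>
    (Cs \<noteq> [] \<longrightarrow> f \<in> B)"
  using assms
proof (induction Ls)
  case (Cons L Ls)
  then obtain As Cs f where IH: "Ls = map cyl As @ map (gr f) Cs" "set As \<subseteq> edges m \<C>"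
      "set Cs \<subseteq> edges m \<C>" "Cs \<noteq> [] \<longrightarrow> f \<in> B"
    by auto
  have "L \<in> edges (Suc m) \<C>'" using Cons.prems by simp
  then consider K where "L = cyl K" "K \<in> edges m \<C>" | g K where "L = gr g K" "g \<in> B" "K \<in> edges m \<C>"
    unfolding edges' by blast
  then show ?case
  proof cases
    case 1
    with IH show ?thesis
      by (intro exI[of _ "K # As"] exI[of _ Cs] exI[of _ f]) auto
  next
    case 2
    have sub: "M \<subset> gr g K" if "M \<in> set Ls" for M using Cons.prems 2 that by simp
    have "As = []"
    proof (rule ccontr)
      assume "As \<noteq> []"
      then have "hd As \<in> set As" by simp
      with sub[of "cyl (hd As)"] IH 2 show False by (auto simp: psub_iffs subset_iff)
    qed
    moreover have "gr f C = gr g C" if "C \<in> set Cs" for C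
    proof (rule graph_over_cong)
      fix x assume "x \<in> C"
      with sub[of "gr f C"] IH 2 that show "f x = g x" by (auto simp: psub_iffs subset_iff)
    qed
    ultimately show ?thesis
      using IH 2 by (intro exI[of _ "[]"] exI[of _ "K # Cs"] exI[of _ g]) auto
  qed
qed simp

text \<open>The inclusion \<open>hd Cs \<subseteq> last As\<close> need not be strict, since
  \<open>gr f K\<close> lies properly in \<open>cyl K\<close>. \<open>As\<close> is non-empty
  because the chain starts with the whole space, which is a cylinder; \<open>f\<close> is arbitrary
  when \<open>Cs\<close> is empty.\<close>

lemma chain_cases:
  assumes "Ls \<in> edge_chains (Suc m) \<C>' ns"
  obtains As Cs f where "Ls = map cyl As @ map (gr f) Cs" "As \<noteq> []" "hd As = carrier_vec m"
    "set As \<subseteq> edges m \<C>" "set Cs \<subseteq> edges m \<C>" "sorted_wrt (\<supset>) As" "sorted_wrt (\<supset>) Cs"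
    "Cs \<noteq> [] \<longrightarrow> f \<in> B \<and> hd Cs \<subseteq> last As"
    "map (codim m) As @ map (\<lambda>K. Suc (codim m K)) Cs = ns"
proof -
  have Ls: "set Ls \<subseteq> edges (Suc m) \<C>'" "sorted_wrt (\<supset>) Ls" "map (codim (Suc m)) Ls = ns"
      "Ls \<noteq> []" "hd Ls = carrier_vec (Suc m)"
    using assms by (auto simp: edge_chains_def)
  from sorted_edges_cases[OF Ls(1,2)] obtain As Cs f where *: "Ls = map cyl As @ map (gr f) Cs"
      "set As \<subseteq> edges m \<C>" "set Cs \<subseteq> edges m \<C>" "Cs \<noteq> [] \<longrightarrow> f \<in> B"
    by blast
  have sorted: "sorted_wrt (\<lambda>K K'. cyl K' \<subset> cyl K) As" "sorted_wrt (\<lambda>K K'. gr f K' \<subset> gr f K) Cs"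
      "\<forall>A\<in>set As. \<forall>C\<in>set Cs. gr f C \<subset> cyl A"
    using Ls(2) unfolding * by (auto simp: sorted_wrt_append sorted_wrt_map)
  have "As \<noteq> []"
  proof
    assume "As = []"
    then have "Cs \<noteq> []" "gr f (hd Cs) = cyl (carrier_vec m)"
      using Ls(4,5) by (auto simp: * hd_map cylinder_carrier)
    moreover have "hd Cs \<in> edges m \<C>" using * \<open>Cs \<noteq> []\<close> by (auto simp: subset_iff)
    ultimately show False
      using sub_iffs(4)[OF carrier_edge carrier_edge, of f "hd Cs"] by simp
  qed
  moreover have "hd As = carrier_vec m"
  proof -
    have "cyl (hd As) = cyl (carrier_vec m)"
      using Ls(5) \<open>As \<noteq> []\<close> by (simp add: * hd_map cylinder_carrier)
    then show ?thesis
      using inj_cyl * \<open>As \<noteq> []\<close> carrier_edge by (simp add: inj_on_eq_iff subset_iff)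
  qed
  moreover have "sorted_wrt (\<supset>) As"
    using sorted(1) by (rule sorted_wrt_mono_rel[rotated]) (use * in \<open>auto simp: psub_iffs subset_iff\<close>)
  moreover have "sorted_wrt (\<supset>) Cs"
    using sorted(2) by (rule sorted_wrt_mono_rel[rotated]) (use * in \<open>auto simp: psub_iffs subset_iff\<close>)
  moreover have "hd Cs \<subseteq> last As" if "Cs \<noteq> []"
  proof -
    have "last As \<in> set As" "hd Cs \<in> set Cs" using that \<open>As \<noteq> []\<close> by auto
    with sorted(3) * show ?thesis by (metis psub_iffs(3) subset_iff)
  qed
  moreover have "map (codim m) As @ map (\<lambda>K. Suc (codim m K)) Cs = ns"
    using * by (auto simp: codim_cylinder codim_graph_over subset_iff simp flip: Ls(3)
      dest: length_pos_if_in_set)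
  ultimately show thesis using that * by blast
qed

lemma chainI:
  assumes "As \<noteq> []" "hd As = carrier_vec m" "set As \<subseteq> edges m \<C>" "set Cs \<subseteq> edges m \<C>"
    "sorted_wrt (\<supset>) As" "sorted_wrt (\<supset>) Cs" "Cs \<noteq> [] \<Longrightarrow> f \<in> B" "Cs \<noteq> [] \<Longrightarrow> hd Cs \<subseteq> last As"
    "map (codim m) As @ map (\<lambda>K. Suc (codim m K)) Cs = ns"
  shows "map cyl As @ map (gr f) Cs \<in> edge_chains (Suc m) \<C>' ns"
proof -
  have "gr f C \<subset> cyl A" if "A \<in> set As" "C \<in> set Cs" for A C
  proof -
    have "C \<subseteq> hd Cs" by (rule sorted_wrt_psupset_hd[OF assms(6) that(2)])
    also have "\<dots> \<subseteq> last As" using assms(8) that(2) by (cases Cs) auto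
    also have "\<dots> \<subseteq> A" by (rule sorted_wrt_psupset_last[OF assms(5) that(1)])
    finally show ?thesis using that assms(3,4) by (auto simp: psub_iffs subset_iff)
  qed
  moreover have "sorted_wrt (\<lambda>K K'. cyl K' \<subset> cyl K) As"
    using assms(5) by (rule sorted_wrt_mono_rel[rotated]) (use assms(3) in \<open>auto simp: psub_iffs subset_iff\<close>)
  moreover have "sorted_wrt (\<lambda>K K'. gr f K' \<subset> gr f K) Cs"
    using assms(6) by (rule sorted_wrt_mono_rel[rotated]) (use assms(4) in \<open>auto simp: psub_iffs subset_iff\<close>)
  ultimately have "sorted_wrt (\<supset>) (map cyl As @ map (gr f) Cs)"
    by (simp add: sorted_wrt_append sorted_wrt_map)
  moreover have "f \<in> B" if "C \<in> set Cs" for C using assms(7) that by (cases Cs) auto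
  ultimately show ?thesis
    unfolding edge_chains_def using assms(1-4) assms(9)
    by (auto simp: hd_map cylinder_carrier codim_cylinder codim_graph_over subset_iff
        intro: cyl_edge gr_edge)
qed

end

section \<open>Functionals upstairs built from functionals downstairs\<close>

context fibred_arrangement
begin

definition is_cyl :: "complex vec set \<Rightarrow> bool"
  where "is_cyl L \<longleftrightarrow> L \<in> cyl ` edges m \<C>"

definition base :: "complex vec set \<Rightarrow> complex vec set"
  where "base L = (\<lambda>t. vec_first t m) ` L"

definition cyl_functional :: "(complex vec set list \<Rightarrow> complex) \<Rightarrow> complex vec set list \<Rightarrow> complex"
  where "cyl_functional \<phi> Ls = (if list_all is_cyl Ls then \<phi> (map base Ls) else 0)"

text \<open>
  On a flag that passes from cylinders to graphs of \<open>f\<close> over an edge where \<open>f\<close> and \<open>g\<close> agree, this is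
  up to sign \<open>\<psi>\<close> of the flag downstairs; that flag repeats no edge, hence the \<open>tl\<close>.
\<close>

definition section_functional ::
    "(complex vec \<Rightarrow> complex) \<Rightarrow> (complex vec set list \<Rightarrow> complex) \<Rightarrow> complex vec set list \<Rightarrow> complex"
  where "section_functional g \<psi> Ls = (let As = takeWhile is_cyl Ls; Cs = dropWhile is_cyl Ls in
    if Cs \<noteq> [] \<and> hd Cs \<subseteq> gr g (carrier_vec m)
    then (-1) ^ Suc (length As) * \<psi> (map base (As @ tl Cs)) else 0)"

lemma is_cyl_simps:
  assumes "K \<in> edges m \<C>"
  shows "is_cyl (cyl K)" "\<not> is_cyl (gr f K)"
proof -
  show "\<not> is_cyl (gr f K)"
    using assms sub_iffs(4) unfolding is_cyl_def by (metis image_iff order_refl)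
qed (use assms in \<open>simp add: is_cyl_def\<close>)

lemma base_simps:
  assumes "K \<in> edges m \<C>"
  shows "base (cyl K) = K" "base (gr f K) = K"
  using assms by (simp_all add: base_def image_cylinder image_graph_over edge_carrier)

lemma map_base:
  assumes "set Ks \<subseteq> edges m \<C>"
  shows "map base (map cyl Ks) = Ks" "map base (map (gr f) Ks) = Ks"
  using assms by (auto simp: base_simps subset_iff intro!: map_idI)

lemma cyl_functional_eval:
  assumes "set As \<subseteq> edges m \<C>" "set Cs \<subseteq> edges m \<C>"
  shows "cyl_functional \<phi> (map cyl As @ map (gr f) Cs) = (if Cs = [] then \<phi> As else 0)"
proof (cases Cs)
  case Nil
  then show ?thesis
    using assms map_base(1)[OF assms(1)] by (auto simp: cyl_functional_def list_all_iff is_cyl_simps subset_iff)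
next
  case (Cons C Cs')
  then show ?thesis using assms by (simp add: cyl_functional_def is_cyl_simps)
qed

text \<open>The containment test in the definition does not mention \<open>f\<close>, so the value
  is independent of how the flag is presented. For a given presentation the test becomes agreement
  of \<open>f\<close> and \<open>g\<close> on the base of the first graph.\<close>

lemma section_functional_eval:
  assumes "set As \<subseteq> edges m \<C>" "set Cs \<subseteq> edges m \<C>"
  shows "section_functional g \<psi> (map cyl As @ map (gr f) Cs) =
    (if Cs \<noteq> [] \<and> (\<forall>x\<in>hd Cs. f x = g x) then (-1) ^ Suc (length As) * \<psi> (As @ tl Cs) else 0)"
proof -
  have 1: "takeWhile is_cyl (map cyl As @ map (gr f) Cs) = map cyl As"
    using assms by (cases Cs) (auto simp: takeWhile_append is_cyl_simps subset_iff)
  have 2: "dropWhile is_cyl (map cyl As @ map (gr f) Cs) = map (gr f) Cs"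
    using assms by (cases Cs) (auto simp: dropWhile_append is_cyl_simps subset_iff)
  show ?thesis
  proof (cases "Cs = []")
    case False
    then have C: "hd Cs \<in> edges m \<C>" using assms(2) by (auto simp: subset_iff)
    have "set (tl Cs) \<subseteq> edges m \<C>" using assms(2) False by (cases Cs) auto
    then have "map base (map cyl As @ tl (map (gr f) Cs)) = As @ tl Cs"
      using map_base assms(1) by (simp flip: map_tl)
    then show ?thesis
      using False C edge_carrier(1)[OF C]
      by (simp add: section_functional_def 1 2 Let_def hd_map sub_iffs(2)[OF C])
  next
    case True
    then show ?thesis unfolding section_functional_def 1 2 by simp
  qed
qed

lemma rank_hd_last:
  assumes "map (codim m) As = xs" "As \<noteq> []"
  shows "codim m (hd As) = hd xs" "codim m (last As) = last xs"
  using assms by (auto simp: hd_map last_map)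

text \<open>Nested edges of equal codimension coincide. This detects that a chain passes from
  cylinders to graphs over one and the same edge.\<close>

lemma hd_eq_last:
  assumes "As \<noteq> []" "Cs \<noteq> []" "set As \<subseteq> edges m \<C>" "set Cs \<subseteq> edges m \<C>" "hd Cs \<subseteq> last As"
    "codim m (hd Cs) = codim m (last As)"
  shows "hd Cs = last As"
  by (rule edge_eqI) (use assms in \<open>auto simp: subset_iff\<close>)

text \<open>When the last cylinder and the first graph have the same base, projecting the chain
  repeats this edge; \<open>tl\<close> removes the repetition and leaves a strictly descending
  chain.\<close>

lemma base_chainI:
  assumes "As \<noteq> []" "hd As = carrier_vec m" "set As \<subseteq> edges m \<C>" "set Cs \<subseteq> edges m \<C>"
    "sorted_wrt (\<supset>) As" "sorted_wrt (\<supset>) Cs" "Cs \<noteq> []" "hd Cs = last As"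
    "map (codim m) (As @ tl Cs) = ns"
  shows "As @ tl Cs \<in> edge_chains m \<C> ns"
proof -
  obtain Cs' where Cs: "Cs = last As # Cs'" using assms(7,8) by (cases Cs) auto
  have "C \<subset> A" if "A \<in> set As" "C \<in> set Cs'" for A C
    using sorted_wrt_psupset_last[OF assms(5) that(1)] assms(6) that(2) by (auto simp: Cs)
  then show ?thesis
    using assms by (auto simp: edge_chains_def sorted_wrt_append Cs)
qed

text \<open>If the chain with the gap already contains a graph, so does every flag in the relation
  and all terms are 0. Otherwise both neighbours of the gap are cylinders and the relation is the
  lift of one downstairs.\<close>

lemma annihilates_cyl_functional:
  assumes "annihilates m \<C> p \<phi>"
  shows "annihilates (Suc m) \<C>' p (cyl_functional \<phi>)"
  unfolding annihilates_def
proof (intro allI impI)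
  fix Ls Ls' assume gap: "gapped_chain (Suc m) \<C>' p Ls Ls'"
  let ?i = "length Ls"
  note ne = gapped_chain_nonempty[OF gap]
  have ch: "Ls @ Ls' \<in> edge_chains (Suc m) \<C>' ([0..<?i] @ [Suc ?i..<Suc p])" and i: "0 < ?i" "?i < p"
    using gap by (auto simp: gapped_chain_def)
  obtain As Cs f where ac: "Ls @ Ls' = map cyl As @ map (gr f) Cs" "As \<noteq> []" "hd As = carrier_vec m"
    "set As \<subseteq> edges m \<C>" "set Cs \<subseteq> edges m \<C>" "sorted_wrt (\<supset>) As" "sorted_wrt (\<supset>) Cs"
    "Cs \<noteq> [] \<longrightarrow> f \<in> B \<and> hd Cs \<subseteq> last As"
    "map (codim m) As @ map (\<lambda>K. Suc (codim m K)) Cs = [0..<?i] @ [Suc ?i..<Suc p]"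
    by (rule chain_cases[OF ch])
  let ?X = "edges_between (Suc m) \<C>' ?i (last Ls) (hd Ls')"
  show "(\<Sum>M\<in>?X. cyl_functional \<phi> (Ls @ M # Ls')) = 0"
  proof (cases "Cs = []")
    case False
    have "\<not> list_all is_cyl (Ls @ Ls')"
      using False ac(5) unfolding ac(1) by (cases Cs) (auto simp: is_cyl_simps)
    then have "cyl_functional \<phi> (Ls @ M # Ls') = 0" for M
      by (auto simp: cyl_functional_def)
    then show ?thesis by simp
  next
    case True
    define A1 where "A1 = take ?i As"
    define A2 where "A2 = drop ?i As"
    have "Ls = take ?i (Ls @ Ls')" "Ls' = drop ?i (Ls @ Ls')" by simp_all
    then have Ls: "Ls = map cyl A1" "Ls' = map cyl A2"
      unfolding ac(1) True A1_def A2_def by (simp_all add: take_map drop_map)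
    have As: "As = A1 @ A2" by (simp add: A1_def A2_def)
    have ne12: "A1 \<noteq> []" "A2 \<noteq> []" using ne Ls by auto
    have gap': "gapped_chain m \<C> p A1 A2"
      using i ac True unfolding gapped_chain_def edge_chains_def As Ls by simp
    have mem: "last A1 \<in> edges m \<C>" "hd A2 \<in> edges m \<C>"
      using ac(4) ne12 unfolding As by (auto simp: subset_iff)
    have X: "?X = cyl ` edges_between m \<C> (length A1) (last A1) (hd A2)"
      using mem ne12 by (simp add: Ls last_map hd_map between_cyl)
    have "(\<Sum>M\<in>?X. cyl_functional \<phi> (Ls @ M # Ls')) =
        (\<Sum>K\<in>edges_between m \<C> (length A1) (last A1) (hd A2). cyl_functional \<phi> (Ls @ cyl K # Ls'))"
      unfolding X by (subst sum.reindex) (auto intro!: inj_on_subset[OF inj_cyl] simp: edges_between_def)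
    also have "\<dots> = (\<Sum>K\<in>edges_between m \<C> (length A1) (last A1) (hd A2). \<phi> (A1 @ K # A2))"
    proof (rule sum.cong[OF refl])
      fix K assume "K \<in> edges_between m \<C> (length A1) (last A1) (hd A2)"
      then have "set (A1 @ K # A2) \<subseteq> edges m \<C>" using ac(4) by (auto simp: As edges_between_def)
      from cyl_functional_eval[OF this, of "[]"]
      show "cyl_functional \<phi> (Ls @ cyl K # Ls') = \<phi> (A1 @ K # A2)" by (simp add: Ls)
    qed
    also have "\<dots> = 0" using assms gap' unfolding annihilates_def by blast
    finally show ?thesis .
  qed
qed

text \<open>Gaps are sorted by their position relative to the place where the cylinders end. Away
  from that place the sum is a multiple of a relation for \<open>\<psi>\<close> downstairs; at that
  place two terms over the same flag downstairs cancel.\<close>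

lemma annihilates_section_functional:
  assumes \<psi>: "annihilates m \<C> p \<psi>" and g: "g \<in> B"
  shows "annihilates (Suc m) \<C>' (Suc p) (section_functional g \<psi>)"
  unfolding annihilates_def
proof (intro allI impI)
  fix Ls Ls' assume gap: "gapped_chain (Suc m) \<C>' (Suc p) Ls Ls'"
  let ?i = "length Ls"
  note ne = gapped_chain_nonempty[OF gap]
  have ch: "Ls @ Ls' \<in> edge_chains (Suc m) \<C>' ([0..<?i] @ [Suc ?i..<Suc (Suc p)])"
    and i: "0 < ?i" "?i < Suc p"
    using gap by (auto simp: gapped_chain_def)
  obtain As Cs f where ac: "Ls @ Ls' = map cyl As @ map (gr f) Cs" "As \<noteq> []" "hd As = carrier_vec m"
    "set As \<subseteq> edges m \<C>" "set Cs \<subseteq> edges m \<C>" "sorted_wrt (\<supset>) As" "sorted_wrt (\<supset>) Cs"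
    "Cs \<noteq> [] \<longrightarrow> f \<in> B \<and> hd Cs \<subseteq> last As"
    "map (codim m) As @ map (\<lambda>K. Suc (codim m K)) Cs = [0..<?i] @ [Suc ?i..<Suc (Suc p)]"
    by (rule chain_cases[OF ch])
  let ?X = "edges_between (Suc m) \<C>' ?i (last Ls) (hd Ls')"
  have split: "Ls = take ?i (map cyl As @ map (gr f) Cs)" "Ls' = drop ?i (map cyl As @ map (gr f) Cs)"
    unfolding ac(1)[symmetric] by simp_all
  note ranks = ranks_split[OF ac(9)]
  have len: "length As + length Cs = Suc p"
    using arg_cong[OF ac(9), of length] i by simp
  let ?s = "(-1) ^ Suc (length As) :: complex"
  consider "Cs = []" | "Cs \<noteq> []" "?i < length As" | "Cs \<noteq> []" "length As < ?i" | "Cs \<noteq> []" "?i = length As"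
    by linarith
  then show "(\<Sum>M\<in>?X. section_functional g \<psi> (Ls @ M # Ls')) = 0"
  proof cases
    \<comment> \<open>Both neighbours of the gap are cylinders and no graph follows, so every flag
      in the relation consists of cylinders and the functional is 0 on it.\<close>
    case 1
    define A1 where "A1 = take ?i As"
    define A2 where "A2 = drop ?i As"
    have Ls: "Ls = map cyl A1" "Ls' = map cyl A2"
      by (subst split, simp add: 1 A1_def take_map, subst split, simp add: 1 A2_def drop_map)
    have As: "As = A1 @ A2" by (simp add: A1_def A2_def)
    have ne12: "A1 \<noteq> []" "A2 \<noteq> []" using ne Ls by auto
    have mem: "last A1 \<in> edges m \<C>" "hd A2 \<in> edges m \<C>"
      using ac(4) ne12 unfolding As by (auto simp: subset_iff)
    have X: "?X = cyl ` edges_between m \<C> (length A1) (last A1) (hd A2)"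
      using mem ne12 by (simp add: Ls last_map hd_map between_cyl)
    have "section_functional g \<psi> (Ls @ M # Ls') = 0" if "M \<in> ?X" for M
    proof -
      from that obtain K where K: "M = cyl K" "K \<in> edges m \<C>"
        unfolding X by (auto simp: edges_between_def)
      then have "set (A1 @ K # A2) \<subseteq> edges m \<C>" using ac(4) by (auto simp: As)
      from section_functional_eval[OF this, of "[]"] show ?thesis by (simp add: Ls K)
    qed
    then show ?thesis by simp
  next
    case 2
    define A1 where "A1 = take ?i As"
    define A2 where "A2 = drop ?i As"
    have Ls: "Ls = map cyl A1" "Ls' = map cyl A2 @ map (gr f) Cs"
      by (subst split, use 2 in \<open>simp add: A1_def take_map\<close>,
          subst split, use 2 in \<open>simp add: A2_def drop_map\<close>)
    have As: "As = A1 @ A2" by (simp add: A1_def A2_def)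
    have ne12: "A1 \<noteq> []" "A2 \<noteq> []" using ne 2 Ls by (auto simp: A2_def)
    have mem: "last A1 \<in> edges m \<C>" "hd A2 \<in> edges m \<C>"
      using ac(4) ne12 unfolding As by (auto simp: subset_iff)
    have rA: "map (codim m) As = [0..<?i] @ [Suc ?i..<Suc (length As)]"
      and rC: "map (codim m) Cs = [length As..<Suc p]"
      using ranks(1,2) 2 i by (simp_all del: upt_Suc)
    have "length As < Suc p" using len 2 by (cases Cs) auto
    \<comment> \<open>The gap lies among the cylinders and raises their later codimensions by one,
      so \<open>last As\<close> has codimension \<open>length As\<close>, the same as
      \<open>hd Cs\<close>.\<close>
    have hdC: "hd Cs = last As"
      using rank_hd_last(1)[OF rC 2(1)] rank_hd_last(2)[OF rA ac(2)] 2 \<open>length As < Suc p\<close> ac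
      by (intro hd_eq_last) (simp_all del: upt_Suc)
    have gap': "gapped_chain m \<C> p A1 (A2 @ tl Cs)"
    proof -
      have "As @ tl Cs \<in> edge_chains m \<C> ([0..<?i] @ [Suc ?i..<Suc p])"
      proof (rule base_chainI)
        have "map (codim m) (tl Cs) = [Suc (length As)..<Suc p]"
          using rC by (simp add: map_tl tl_upt del: upt_Suc)
        then show "map (codim m) (As @ tl Cs) = [0..<?i] @ [Suc ?i..<Suc p]"
          using rA 2(2) \<open>length As < Suc p\<close> upt_add_eq_append[of "Suc ?i" "Suc (length As)" "p - length As"]
          by (simp del: upt_Suc)
      qed (use ac 2 hdC in auto)
      moreover have "?i < p" using 2(2) \<open>length As < Suc p\<close> by simp
      ultimately show ?thesis using i unfolding gapped_chain_def by (simp add: As Ls)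
    qed
    have X: "?X = cyl ` edges_between m \<C> (length A1) (last A1) (hd A2)"
      using mem ne12 by (simp add: Ls last_map hd_map between_cyl)
    \<comment> \<open>Filling the gap adds one cylinder, hence the additional \<open>Suc\<close> in
      the exponent.\<close>
    define c where "c = (if \<forall>x\<in>hd Cs. f x = g x then (-1) ^ Suc (Suc (length As)) else 0 :: complex)"
    have "(\<Sum>M\<in>?X. section_functional g \<psi> (Ls @ M # Ls')) =
        (\<Sum>K\<in>edges_between m \<C> (length A1) (last A1) (hd A2). section_functional g \<psi> (Ls @ cyl K # Ls'))"
      unfolding X by (subst sum.reindex) (auto intro!: inj_on_subset[OF inj_cyl] simp: edges_between_def)
    also have "\<dots> = (\<Sum>K\<in>edges_between m \<C> (length A1) (last A1) (hd A2). c * \<psi> (A1 @ K # A2 @ tl Cs))"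
    proof (rule sum.cong[OF refl])
      fix K assume "K \<in> edges_between m \<C> (length A1) (last A1) (hd A2)"
      then have "set (A1 @ K # A2) \<subseteq> edges m \<C>" using ac(4) by (auto simp: As edges_between_def)
      from section_functional_eval[OF this ac(5), of g \<psi> f]
      show "section_functional g \<psi> (Ls @ cyl K # Ls') = c * \<psi> (A1 @ K # A2 @ tl Cs)"
        using 2 by (simp add: Ls c_def As)
    qed
    also have "\<dots> = c * (\<Sum>K\<in>edges_between m \<C> (length A1) (last A1) (hd (A2 @ tl Cs)). \<psi> (A1 @ K # A2 @ tl Cs))"
      using ne12 by (simp add: sum_distrib_left)
    also have "\<dots> = 0" using \<psi> gap' unfolding annihilates_def by simp
    finally show ?thesis .
  next
    case 3
    define C1 where "C1 = take (?i - length As) Cs"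
    define C2 where "C2 = drop (?i - length As) Cs"
    have Ls: "Ls = map cyl As @ map (gr f) C1" "Ls' = map (gr f) C2"
      by (subst split, use 3 in \<open>simp add: C1_def take_map\<close>,
          subst split, use 3 in \<open>simp add: C2_def drop_map\<close>)
    have Cs: "Cs = C1 @ C2" by (simp add: C1_def C2_def)
    have ne12: "C1 \<noteq> []" "C2 \<noteq> []"
      using 3 ne(2) unfolding Ls(2) by (simp_all add: C1_def)
    have mem: "last C1 \<in> edges m \<C>" "hd C2 \<in> edges m \<C>"
      using ac(5) ne12 unfolding Cs by (auto simp: subset_iff)
    have f: "f \<in> B" using ac(8) 3 by blast
    have pos: "0 < length As" using ac(2) by simp
    have rA: "map (codim m) As = [0..<length As]"
      and rC: "map (codim m) Cs = [length As - 1..<?i - 1] @ [?i..<Suc p]"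
      using ranks(3,4) 3 i pos by (simp_all del: upt_Suc)
    have lt: "length As - 1 < ?i - 1" using 3 pos by linarith
    then have "hd ([length As - 1..<?i - 1] @ [?i..<Suc p]) = length As - 1"
      by (simp add: hd_append)
    then have hdC: "hd Cs = last As"
      using rank_hd_last(1)[OF rC 3(1)] rank_hd_last(2)[OF rA ac(2)] 3 pos ac
      by (intro hd_eq_last) (simp_all del: upt_Suc)
    have len_i: "?i = length As + length C1" by (simp add: Ls)
    have tl12: "As @ tl Cs = (As @ tl C1) @ C2" using ne12 by (simp add: Cs)
    \<comment> \<open>Downstairs the gap moves one place to the left, because the edge at which the
      cylinders end is shared by \<open>As\<close> and \<open>C1\<close> and counted once.\<close>
    have len': "length (As @ tl C1) = ?i - 1" using ne12 len_i by (cases C1) auto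
    have gap': "gapped_chain m \<C> p (As @ tl C1) C2"
    proof -
      have "As @ tl Cs \<in> edge_chains m \<C> ([0..<?i - 1] @ [?i..<Suc p])"
      proof (rule base_chainI)
        have "map (codim m) (tl Cs) = [length As..<?i - 1] @ [?i..<Suc p]"
          using rC lt pos by (simp add: map_tl del: upt_Suc)
        then show "map (codim m) (As @ tl Cs) = [0..<?i - 1] @ [?i..<Suc p]"
          using rA 3(2) upt_add_eq_append[of 0 "length As" "?i - 1 - length As"]
          by (simp del: upt_Suc)
      qed (use ac 3 hdC in auto)
      moreover have "0 < ?i - 1" "?i - 1 < p" "Suc (?i - 1) = ?i" using 3 pos i by linarith+
      ultimately show ?thesis
        unfolding gapped_chain_def len' tl12[symmetric] by (simp only: simp_thms)
    qed
    \<comment> \<open>If \<open>C1\<close> is a single edge, \<open>tl\<close> leaves nothing of it,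
      but that edge is \<open>last As\<close>.\<close>
    have last1: "last (As @ tl C1) = last C1"
    proof (cases "tl C1 = []")
      case True
      then have "C1 = [hd C1]" using ne12(1) by (cases C1) auto
      moreover have "hd C1 = last As" using hdC ne12 by (simp add: Cs)
      ultimately show ?thesis using True by (cases C1) auto
    next
      case False
      then show ?thesis by (simp add: last_tl)
    qed
    have X: "?X = gr f ` edges_between m \<C> (?i - 1) (last C1) (hd C2)"
      using between_gr[OF f mem, of "?i - 1"] ne12 i by (simp add: Ls last_map hd_map)
    define c where "c = (if \<forall>x\<in>hd Cs. f x = g x then ?s else 0)"
    have "(\<Sum>M\<in>?X. section_functional g \<psi> (Ls @ M # Ls')) =
        (\<Sum>K\<in>edges_between m \<C> (?i - 1) (last C1) (hd C2). section_functional g \<psi> (Ls @ gr f K # Ls'))"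
      unfolding X by (subst sum.reindex) (auto intro!: inj_on_subset[OF inj_gr] simp: edges_between_def)
    also have "\<dots> = (\<Sum>K\<in>edges_between m \<C> (?i - 1) (last C1) (hd C2). c * \<psi> ((As @ tl C1) @ K # C2))"
    proof (rule sum.cong[OF refl])
      fix K assume "K \<in> edges_between m \<C> (?i - 1) (last C1) (hd C2)"
      then have "set (C1 @ K # C2) \<subseteq> edges m \<C>" using ac(5) by (auto simp: Cs edges_between_def)
      from section_functional_eval[OF ac(4) this, of g \<psi> f]
      show "section_functional g \<psi> (Ls @ gr f K # Ls') = c * \<psi> ((As @ tl C1) @ K # C2)"
        using ne12 by (simp add: Ls c_def Cs)
    qed
    also have "\<dots> = c * (\<Sum>K\<in>edges_between m \<C> (length (As @ tl C1)) (last (As @ tl C1)) (hd C2).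
        \<psi> ((As @ tl C1) @ K # C2))"
      by (simp only: sum_distrib_left last1 len')
    also have "\<dots> = 0" using \<psi> gap' unfolding annihilates_def by (simp only: mult_zero_right)
    finally show ?thesis .
  next
    case 4
    have Ls: "Ls = map cyl As" "Ls' = map (gr f) Cs"
      by (subst split, use 4 in simp, subst split, use 4 in simp)
    have f: "f \<in> B" using ac(8) 4 by blast
    have pos: "0 < length As" using ac(2) by simp
    have rA: "map (codim m) As = [0..<length As]"
      and rC: "map (codim m) Cs = [length As..<Suc p]"
      using ranks(3,4) 4 i pos by (simp_all del: upt_Suc)
    have "length As < Suc p" using len 4 by (cases Cs) auto
    let ?U = "last As" and ?L = "hd Cs"
    have mem: "?U \<in> edges m \<C>" "?L \<in> edges m \<C>"
      using ac(2,4,5) 4 by (auto simp: subset_iff)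
    \<comment> \<open>Here the gap is the transition itself, so the first base of a graph lies one
      codimension below the last cylinder instead of coinciding with it.\<close>
    have codims: "codim m ?U = length As - 1" "codim m ?L = Suc (length As - 1)"
      using rank_hd_last(1)[OF rC 4(1)] rank_hd_last(2)[OF rA ac(2)] pos \<open>length As < Suc p\<close>
      by (simp_all del: upt_Suc)
    have sub: "?L \<subset> ?U" using ac(8) 4 codims by auto
    have X: "?X = insert (cyl ?L) ((\<lambda>h. gr h ?U) ` {h \<in> B. \<forall>x\<in>?L. f x = h x})"
      using between_junction[OF f mem sub codims] ac(2) 4 pos by (simp add: Ls last_map hd_map)
    let ?Y = "(\<lambda>h. gr h ?U) ` {h \<in> B. \<forall>x\<in>?L. f x = h x}"
    have cyl_nin: "cyl ?L \<notin> ?Y"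
      using is_cyl_simps mem by (metis (no_types, lifting) imageE)
    have below: "C \<subseteq> ?L" if "C \<in> set Cs" for C by (rule sorted_wrt_psupset_hd[OF ac(7) that])
    have Y: "section_functional g \<psi> (Ls @ gr h ?U # Ls') =
        (if \<forall>x\<in>?U. h x = g x then ?s * \<psi> (As @ Cs) else 0)"
      if "h \<in> B" "\<forall>x\<in>?L. f x = h x" for h
    proof -
      have "map (gr f) Cs = map (gr h) Cs"
        using that(2) below by (intro map_cong refl graph_over_cong) blast
      then have "Ls @ gr h ?U # Ls' = map cyl As @ map (gr h) (?U # Cs)" by (simp add: Ls)
      moreover have "set (?U # Cs) \<subseteq> edges m \<C>" using mem ac(5) by simp
      ultimately show ?thesis using section_functional_eval[OF ac(4), of "?U # Cs"] by simp
    qed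
    \<comment> \<open>The additional cylinder reverses the sign, while the flag downstairs is again
      \<open>As @ Cs\<close>, because \<open>?L\<close> now occurs both as last cylinder and as
      first base of a graph.\<close>
    have cyl_val: "section_functional g \<psi> (Ls @ cyl ?L # Ls') =
        (if \<forall>x\<in>?L. f x = g x then - ?s * \<psi> (As @ Cs) else 0)"
    proof -
      have "set (As @ [?L]) \<subseteq> edges m \<C>" using mem ac(4) by simp
      from section_functional_eval[OF this ac(5), of g \<psi> f] show ?thesis
        using 4 by (simp add: Ls)
    qed
    have finY: "finite ?Y" using fin_B by simp
    have "(\<Sum>M\<in>?Y. section_functional g \<psi> (Ls @ M # Ls')) =
        (\<Sum>M\<in>?Y. if M = gr g ?U then ?s * \<psi> (As @ Cs) else 0)"
    proof (rule sum.cong[OF refl])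
      fix M assume "M \<in> ?Y"
      then obtain h where h: "M = gr h ?U" "h \<in> B" "\<forall>x\<in>?L. f x = h x" by blast
      \<comment> \<open>Agreement with \<open>g\<close> on \<open>?U\<close> depends on the edge
        \<open>M\<close> alone, so the sum over edges has at most one term that can be nonzero,
        whatever the number of functions \<open>h\<close>.\<close>
      have "(\<forall>x\<in>?U. h x = g x) \<longleftrightarrow> M = gr g ?U"
        unfolding h(1) by (metis edge_carrier(1) graph_over_cong graph_over_subset_iff mem(1) order_refl)
      then show "section_functional g \<psi> (Ls @ M # Ls') = (if M = gr g ?U then ?s * \<psi> (As @ Cs) else 0)"
        using Y[OF h(2,3)] by (simp add: h(1))
    qed
    also have "\<dots> = (if gr g ?U \<in> ?Y then ?s * \<psi> (As @ Cs) else 0)" using finY by simp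
    also have "gr g ?U \<in> ?Y \<longleftrightarrow> (\<forall>x\<in>?L. f x = g x)"
    proof
      assume "gr g ?U \<in> ?Y"
      then obtain h where h: "gr g ?U = gr h ?U" "\<forall>x\<in>?L. f x = h x" by blast
      then have "\<forall>x\<in>?U. g x = h x" using sub_iffs(2)[OF mem(1), of g h ?U] by simp
      with h(2) sub show "\<forall>x\<in>?L. f x = g x" by auto
    qed (use g in blast)
    finally show ?thesis
      unfolding X using finY cyl_nin by (simp add: cyl_val)
  qed
qed

end

section \<open>Restricting functionals to lifted flags, and the recursion for bases\<close>

context fibred_arrangement
begin

lemma gr_eq_iff:
  assumes "K \<in> edges m \<C>"
  shows "gr f K = gr g K \<longleftrightarrow> (\<forall>x\<in>K. f x = g x)"
proof
  assume "gr f K = gr g K"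
  then have "gr f K \<subseteq> gr g K" by simp
  then show "\<forall>x\<in>K. f x = g x" unfolding sub_iffs(2)[OF assms] by blast
next
  assume "\<forall>x\<in>K. f x = g x"
  then show "gr f K = gr g K" by (intro graph_over_cong) blast
qed

text \<open>Composition with the lift of flags to cylinders: a relation downstairs lifts to the
  relation upstairs with the gap in the same place.\<close>

lemma annihilates_pullback_cyl:
  assumes "annihilates (Suc m) \<C>' p \<chi>"
  shows "annihilates m \<C> p (\<lambda>Ks. \<chi> (map cyl Ks))"
  unfolding annihilates_def
proof (intro allI impI)
  fix Ks Ks' assume gap: "gapped_chain m \<C> p Ks Ks'"
  note ne = gapped_chain_nonempty[OF gap]
  let ?X = "edges_between m \<C> (length Ks) (last Ks) (hd Ks')"
  have ch: "Ks @ Ks' \<in> edge_chains m \<C> ([0..<length Ks] @ [Suc (length Ks)..<Suc p])"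
    using gap by (simp add: gapped_chain_def del: upt_Suc)
  then have "map cyl (Ks @ Ks') @ map (gr f) [] \<in>
      edge_chains (Suc m) \<C>' ([0..<length Ks] @ [Suc (length Ks)..<Suc p])" for f
    by (intro chainI) (auto simp: edge_chains_def simp del: upt_Suc)
  then have gap': "gapped_chain (Suc m) \<C>' p (map cyl Ks) (map cyl Ks')"
    using gap by (simp add: gapped_chain_def del: upt_Suc)
  have mem: "last Ks \<in> edges m \<C>" "hd Ks' \<in> edges m \<C>"
    using ch ne by (auto simp: edge_chains_def subset_iff)
  have "(\<Sum>M\<in>?X. \<chi> (map cyl (Ks @ M # Ks'))) = (\<Sum>M\<in>cyl ` ?X. \<chi> (map cyl Ks @ M # map cyl Ks'))"
    by (subst sum.reindex) (auto intro!: inj_on_subset[OF inj_cyl] simp: edges_between_def)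
  also have "cyl ` ?X = edges_between (Suc m) \<C>' (length (map cyl Ks)) (last (map cyl Ks)) (hd (map cyl Ks'))"
    using between_cyl[OF mem] ne by (simp add: last_map hd_map)
  also have "(\<Sum>M\<in>\<dots>. \<chi> (map cyl Ks @ M # map cyl Ks')) = 0"
    using assms gap' unfolding annihilates_def by blast
  finally show "(\<Sum>M\<in>?X. \<chi> (map cyl (Ks @ M # Ks'))) = 0" .
qed

text \<open>Composition with the lift to graphs of \<open>g\<close>. The whole space put in front
  shifts flags and gaps by one place, so degree \<open>p\<close> downstairs corresponds to degree
  \<open>Suc p\<close> upstairs.\<close>

lemma annihilates_pullback_gr:
  assumes "annihilates (Suc m) \<C>' (Suc p) \<chi>" and g: "g \<in> B"
  shows "annihilates m \<C> p (\<lambda>Ks. \<chi> (carrier_vec (Suc m) # map (gr g) Ks))"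
  unfolding annihilates_def
proof (intro allI impI)
  fix Ks Ks' assume gap: "gapped_chain m \<C> p Ks Ks'"
  note ne = gapped_chain_nonempty[OF gap]
  let ?i = "length Ks" and ?L = "carrier_vec (Suc m) # map (gr g) Ks" and ?L' = "map (gr g) Ks'"
  let ?X = "edges_between m \<C> ?i (last Ks) (hd Ks')"
  have ch: "Ks @ Ks' \<in> edge_chains m \<C> ([0..<?i] @ [Suc ?i..<Suc p])" and i: "0 < ?i" "?i < p"
    using gap by (auto simp: gapped_chain_def)
  have ranks: "map (codim m) (Ks @ Ks') = [0..<?i] @ [Suc ?i..<Suc p]"
    using ch by (simp add: edge_chains_def)
  have "map (\<lambda>K. Suc (codim m K)) (Ks @ Ks') = map Suc (map (codim m) (Ks @ Ks'))" by simp
  also have "\<dots> = [Suc 0..<Suc ?i] @ [Suc (Suc ?i)..<Suc (Suc p)]"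
    unfolding ranks by (simp add: map_Suc_upt del: upt_Suc)
  finally have ranks': "map (\<lambda>K. Suc (codim m K)) (Ks @ Ks') = [Suc 0..<Suc ?i] @ [Suc (Suc ?i)..<Suc (Suc p)]" .
  \<comment> \<open>The codimension of the whole space is read off from the chain, whose first
    prescribed codimension is 0.\<close>
  have "codim m (hd (Ks @ Ks')) = hd (map (codim m) (Ks @ Ks'))" using ne by (simp add: hd_map)
  then have "codim m (carrier_vec m) = 0"
    using ch i by (simp add: ranks edge_chains_def del: upt_Suc)
  then have "map cyl [carrier_vec m] @ map (gr g) (Ks @ Ks') \<in>
      edge_chains (Suc m) \<C>' ([0..<Suc ?i] @ [Suc (Suc ?i)..<Suc (Suc p)])"
    using ch g carrier_edge ranks'
    by (intro chainI) (auto simp: edge_chains_def upt_conv_Cons[of 0] simp del: upt_Suc)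
  then have gap': "gapped_chain (Suc m) \<C>' (Suc p) ?L ?L'"
    using i by (simp add: gapped_chain_def cylinder_carrier del: upt_Suc)
  have mem: "last Ks \<in> edges m \<C>" "hd Ks' \<in> edges m \<C>"
    using ch ne by (auto simp: edge_chains_def subset_iff)
  have "(\<Sum>M\<in>?X. \<chi> (carrier_vec (Suc m) # map (gr g) (Ks @ M # Ks'))) = (\<Sum>M\<in>gr g ` ?X. \<chi> (?L @ M # ?L'))"
    by (subst sum.reindex) (auto intro!: inj_on_subset[OF inj_gr] simp: edges_between_def)
  also have "gr g ` ?X = edges_between (Suc m) \<C>' (length ?L) (last ?L) (hd ?L')"
    using between_gr[OF g mem] ne by (simp add: last_map hd_map)
  also have "(\<Sum>M\<in>\<dots>. \<chi> (?L @ M # ?L')) = 0"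
    using assms gap' unfolding annihilates_def by blast
  finally show "(\<Sum>M\<in>?X. \<chi> (carrier_vec (Suc m) # map (gr g) (Ks @ M # Ks'))) = 0" .
qed

lemma flag_props:
  assumes "Ks \<in> flags m \<C> p"
  shows "set Ks \<subseteq> edges m \<C>" "length Ks = Suc p" "j \<le> p \<Longrightarrow> codim m (Ks ! j) = j"
    "j \<le> p \<Longrightarrow> Ks ! j \<in> edges m \<C>" "Ks ! 0 = carrier_vec m" "sorted_wrt (\<supset>) Ks" "Ks \<noteq> []"
proof -
  have Ks: "set Ks \<subseteq> edges m \<C>" "map (codim m) Ks = [0..<Suc p]" "Ks \<noteq> []" "hd Ks = carrier_vec m"
    "sorted_wrt (\<supset>) Ks"
    using assms by (auto simp: flags_def edge_chains_def)
  show len: "length Ks = Suc p" using arg_cong[OF Ks(2), of length] by simp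
  show "codim m (Ks ! j) = j" if "j \<le> p"
    using arg_cong[OF Ks(2), of "\<lambda>xs. xs ! j"] that len by (simp del: upt_Suc)
  show "Ks ! j \<in> edges m \<C>" if "j \<le> p"
    using Ks(1) nth_mem[of j Ks] that len by auto
  show "Ks ! 0 = carrier_vec m" using Ks by (simp add: hd_conv_nth)
qed (use assms in \<open>auto simp: flags_def edge_chains_def\<close>)

text \<open>The junction relation pushes the first section edge of a flag up to codimension one.\<close>

lemma section_expansion:
  assumes \<chi>: "annihilates (Suc m) \<C>' (Suc p) \<chi>" and f: "f \<in> B" and Ks: "Ks \<in> flags m \<C> p"
    and "j \<le> p"
  shows "\<chi> (map cyl (take (Suc j) Ks) @ map (gr f) (drop j Ks)) =
    (-1) ^ j * (\<Sum>g\<in>{g \<in> B. \<forall>x\<in>Ks ! j. f x = g x}. \<chi> (carrier_vec (Suc m) # map (gr g) Ks))"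
  using f \<open>j \<le> p\<close>
proof (induction j arbitrary: f)
  case 0
  \<comment> \<open>Over the whole space distinct elements of \<open>B\<close> are separated, so the
    sum reduces to one term.\<close>
  have "{g \<in> B. \<forall>x\<in>carrier_vec m. f x = g x} = {f}"
    using distinct_B 0 by blast
  moreover have "take (Suc 0) Ks = [carrier_vec m]"
    using flag_props[OF Ks] by (cases Ks) auto
  ultimately show ?case
    using flag_props[OF Ks] by (simp add: cylinder_carrier)
next
  case (Suc j)
  note Ks_props = flag_props[OF Ks]
  let ?U = "Ks ! j" and ?L = "Ks ! Suc j"
  let ?As = "take (Suc j) Ks" and ?Cs = "drop (Suc j) Ks"
  have mem: "?U \<in> edges m \<C>" "?L \<in> edges m \<C>" and codims: "codim m ?U = j" "codim m ?L = Suc j"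
    using Ks_props(3,4) Suc.prems by auto
  have sub: "?L \<subset> ?U"
    using sorted_wrt_nth_less[OF Ks_props(6), of j "Suc j"] Ks_props(2) Suc.prems by simp
  have len: "length ?As = Suc j" using Ks_props(2) Suc.prems by simp
  have lt: "Suc j < length Ks" using Ks_props(2) Suc.prems by simp
  then have "drop j Ks = ?U # ?Cs" by (simp add: Cons_nth_drop_Suc)
  moreover have "last ?As = ?U" using lt by (simp add: take_Suc_conv_app_nth)
  moreover have "hd ?As = carrier_vec m" using Ks_props(5,7) by (simp add: hd_conv_nth)
  ultimately have Cs: "?Cs \<noteq> []" "hd ?Cs = ?L" "drop j Ks = ?U # ?Cs" "last ?As = ?U" "?As \<noteq> []"
      "hd ?As = carrier_vec m"
    using lt Ks_props(7) by (simp_all add: hd_drop_conv_nth)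
  have ranks: "map (codim m) Ks = [0..<Suc p]"
    using Ks by (simp add: flags_def edge_chains_def)
  have "map cyl ?As @ map (gr f) ?Cs \<in>
      edge_chains (Suc m) \<C>' ([0..<Suc j] @ [Suc (Suc j)..<Suc (Suc p)])"
  proof (rule chainI)
    show "set ?As \<subseteq> edges m \<C>" "set ?Cs \<subseteq> edges m \<C>"
      using Ks_props(1) by (auto dest: in_set_takeD in_set_dropD)
    show "sorted_wrt (\<supset>) ?As" "sorted_wrt (\<supset>) ?Cs"
      using Ks_props(6) by (auto intro: sorted_wrt_take sorted_wrt_drop)
    have "map (\<lambda>K. Suc (codim m K)) ?Cs = map Suc (drop (Suc j) (map (codim m) Ks))"
      by (simp add: drop_map)
    moreover have "map (codim m) ?As = take (Suc j) (map (codim m) Ks)" by (simp add: take_map)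
    ultimately show "map (codim m) ?As @ map (\<lambda>K. Suc (codim m K)) ?Cs =
        [0..<Suc j] @ [Suc (Suc j)..<Suc (Suc p)]"
      unfolding ranks using Suc.prems by (simp add: take_upt map_Suc_upt del: upt_Suc)
  qed (use Cs Suc.prems sub in auto)
  then have gap: "gapped_chain (Suc m) \<C>' (Suc p) (map cyl ?As) (map (gr f) ?Cs)"
    unfolding gapped_chain_def using len Suc.prems by (simp del: upt_Suc)
  let ?X = "edges_between (Suc m) \<C>' (Suc j) (cyl ?U) (gr f ?L)"
  let ?G = "{g \<in> B. \<forall>x\<in>?L. f x = g x}" and ?v = "\<lambda>g. \<chi> (carrier_vec (Suc m) # map (gr g) Ks)"
  let ?t = "\<lambda>M. \<chi> (map cyl ?As @ M # map (gr f) ?Cs)"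
  have "(\<Sum>M\<in>?X. ?t M) = 0"
  proof -
    have "length (map cyl ?As) = Suc j" "last (map cyl ?As) = cyl ?U" "hd (map (gr f) ?Cs) = gr f ?L"
      by (simp_all only: length_map last_map[OF Cs(5)] hd_map[OF Cs(1)] len Cs(2,4))
    with \<chi>[unfolded annihilates_def, rule_format, OF gap] show ?thesis by (simp only:)
  qed
  moreover have "?X = insert (cyl ?L) ((\<lambda>h. gr h ?U) ` ?G)"
    by (rule between_junction[OF Suc.prems(1) mem sub codims])
  moreover have "cyl ?L \<notin> (\<lambda>h. gr h ?U) ` ?G"
    using is_cyl_simps mem by (metis (no_types, lifting) imageE)
  ultimately have rel: "?t (cyl ?L) = - (\<Sum>M\<in>(\<lambda>h. gr h ?U) ` ?G. ?t M)"
    using fin_B by (simp add: eq_neg_iff_add_eq_0)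
  have below: "C \<subseteq> ?L" if "C \<in> set ?Cs" for C
    using sorted_wrt_psupset_hd[OF sorted_wrt_drop[OF Ks_props(6), of "Suc j"] that] Cs by simp
  \<comment> \<open>Each graph over \<open>?U\<close> occurs once in the relation, however many
    functions describe it. The induction hypothesis for one such \<open>h\<close> produces exactly
    the functions whose graph over \<open>?U\<close> is this edge.\<close>
  have t: "?t M = (-1) ^ j * (\<Sum>g\<in>{g \<in> ?G. gr g ?U = M}. ?v g)" if "M \<in> (\<lambda>h. gr h ?U) ` ?G" for M
  proof -
    from that obtain h where h: "M = gr h ?U" "h \<in> B" "\<forall>x\<in>?L. f x = h x" by blast
    have "map (gr f) ?Cs = map (gr h) ?Cs"
      using h(3) below by (intro map_cong refl graph_over_cong) blast
    then have "?t M = \<chi> (map cyl ?As @ map (gr h) (drop j Ks))"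
      by (simp only: h(1) Cs(3) list.map)
    also have "\<dots> = (-1) ^ j * (\<Sum>g\<in>{g \<in> B. \<forall>x\<in>?U. h x = g x}. ?v g)"
      using Suc h(2) by simp
    also have "{g \<in> B. \<forall>x\<in>?U. h x = g x} = {g \<in> ?G. gr g ?U = M}"
    proof -
      have "gr g ?U = M \<longleftrightarrow> (\<forall>x\<in>?U. h x = g x)" for g
        unfolding h(1) gr_eq_iff[OF mem(1)] by auto
      moreover have "\<forall>x\<in>?L. f x = g x" if "\<forall>x\<in>?U. h x = g x" for g
      proof
        fix x assume x: "x \<in> ?L"
        then have "x \<in> ?U" using sub by blast
        then show "f x = g x" using h(3) that x by simp
      qed
      ultimately show ?thesis by blast
    qed
    finally show ?thesis .
  qed
  have "(\<Sum>M\<in>(\<lambda>h. gr h ?U) ` ?G. ?t M) =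
      (-1) ^ j * (\<Sum>M\<in>(\<lambda>h. gr h ?U) ` ?G. \<Sum>g\<in>{g \<in> ?G. gr g ?U = M}. ?v g)"
    using t by (simp add: sum_distrib_left)
  \<comment> \<open>The functions in \<open>?G\<close> are partitioned by their graphs over
    \<open>?U\<close>.\<close>
  also have "\<dots> = (-1) ^ j * (\<Sum>g\<in>?G. ?v g)"
    using fin_B by (subst sum.group) auto
  finally have "?t (cyl ?L) = (-1) ^ Suc j * (\<Sum>g\<in>?G. ?v g)" using rel by simp
  moreover have "map cyl (take (Suc (Suc j)) Ks) @ map (gr f) ?Cs = map cyl ?As @ cyl ?L # map (gr f) ?Cs"
    using Ks_props(2) Suc.prems by (simp add: take_Suc_conv_app_nth[of "Suc j"])
  ultimately show ?case by simp
qed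

text \<open>No codimension is missing, so the first graph has the same base as the last cylinder. A
  flag of the second kind thus amounts to a flag \<open>Ks\<close> downstairs, the index
  \<open>j\<close> of the edge used twice, and a function.\<close>

lemma flag_cases:
  assumes "F \<in> flags (Suc m) \<C>' p"
  obtains Ks where "F = map cyl Ks" "Ks \<in> flags m \<C> p"
  | Ks f j q where "p = Suc q" "F = map cyl (take (Suc j) Ks) @ map (gr f) (drop j Ks)"
      "f \<in> B" "Ks \<in> flags m \<C> q" "j \<le> q"
proof -
  have "F \<in> edge_chains (Suc m) \<C>' [0..<Suc p]" using assms by (simp add: flags_def)
  then obtain As Cs f where ac: "F = map cyl As @ map (gr f) Cs" "As \<noteq> []" "hd As = carrier_vec m"
    "set As \<subseteq> edges m \<C>" "set Cs \<subseteq> edges m \<C>" "sorted_wrt (\<supset>) As" "sorted_wrt (\<supset>) Cs"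
    "Cs \<noteq> [] \<longrightarrow> f \<in> B \<and> hd Cs \<subseteq> last As"
    "map (codim m) As @ map (\<lambda>K. Suc (codim m K)) Cs = [0..<Suc p]"
    by (rule chain_cases)
  show thesis
  proof (cases "Cs = []")
    case True
    then have "As \<in> flags m \<C> p"
      using ac by (simp add: flags_def edge_chains_def)
    with True ac(1) show thesis by (intro that(1)[of As]) auto
  next
    case False
    have pos: "0 < length As" using ac(2) by simp
    have len: "length As + length Cs = Suc p" using arg_cong[OF ac(9), of length] by simp
    moreover have "0 < length Cs" using False by simp
    ultimately have le: "length As \<le> p" by linarith
    with pos have "0 < p" by linarith
    have rA: "map (codim m) As = [0..<length As]" and rC: "map (codim m) Cs = [length As - 1..<p]"
      using ranks_split_full[OF ac(9)] pos by simp_all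
    have "codim m (hd Cs) = codim m (last As)"
      using rank_hd_last(1)[OF rC False] rank_hd_last(2)[OF rA ac(2)] pos le by simp
    then have hdC: "hd Cs = last As" using hd_eq_last ac False by blast
    let ?Ks = "As @ tl Cs" and ?j = "length As - 1"
    have "?Ks \<in> flags m \<C> (p - 1)"
      unfolding flags_def
    proof (rule base_chainI)
      have "map (codim m) (tl Cs) = [length As..<p]"
        using rC pos by (simp add: map_tl)
      then show "map (codim m) ?Ks = [0..<Suc (p - 1)]"
        using rA pos le upt_add_eq_append[of 0 "length As" "p - length As"] \<open>0 < p\<close>
        by (simp del: upt_Suc)
    qed (use ac False hdC in auto)
    moreover have "take (Suc ?j) ?Ks = As" "drop ?j ?Ks = Cs"
    proof -
      have "As = butlast As @ [last As]" using ac(2) by simp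
      then have "drop ?j As = [last As]" by (metis append_eq_conv_conj length_butlast)
      then show "drop ?j ?Ks = Cs" using False hdC pos by (cases Cs) auto
    qed (use pos in simp)
    ultimately show thesis
      using ac(1,8) False pos le \<open>0 < p\<close> by (intro that(2)[of "p - 1" ?j ?Ks f]) auto
  qed
qed

lemma flags_cyl:
  assumes "Ks \<in> flags m \<C> p"
  shows "map cyl Ks \<in> flags (Suc m) \<C>' p"
proof -
  have "map cyl Ks @ map (gr f) [] \<in> edge_chains (Suc m) \<C>' [0..<Suc p]" for f
    by (rule chainI) (use assms in \<open>auto simp: flags_def edge_chains_def\<close>)
  then show ?thesis by (simp add: flags_def)
qed

lemma flags_section:
  assumes Ks: "Ks \<in> flags m \<C> p" and g: "g \<in> B"
  shows "carrier_vec (Suc m) # map (gr g) Ks \<in> flags (Suc m) \<C>' (Suc p)"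
proof -
  have r: "map (codim m) Ks = [0..<Suc p]" "Ks \<noteq> []" "hd Ks = carrier_vec m"
    using Ks by (auto simp: flags_def edge_chains_def)
  have "map (\<lambda>K. Suc (codim m K)) Ks = map Suc (map (codim m) Ks)" by simp
  then have "map (\<lambda>K. Suc (codim m K)) Ks = [Suc 0..<Suc (Suc p)]"
    unfolding r by (simp only: map_Suc_upt)
  moreover have "codim m (carrier_vec m) = 0"
    using flag_props(3,5)[OF Ks] by (metis le0)
  ultimately have "map cyl [carrier_vec m] @ map (gr g) Ks \<in> edge_chains (Suc m) \<C>' [0..<Suc (Suc p)]"
    using flag_props(1,6)[OF Ks] r g carrier_edge
    by (intro chainI) (auto simp: upt_conv_Cons[of 0] simp del: upt_Suc)
  then show ?thesis by (simp add: flags_def cylinder_carrier)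
qed

text \<open>The new basis consists of basis flags lifted to cylinders and, for each function in
  \<open>B\<close>, of basis flags lifted to graphs and preceded by the whole space. Duality gives
  independence; \<open>section_expansion\<close> and the two pullbacks express every annihilating
  functional through its values on these flags.\<close>

lemma has_flag_basis_Suc:
  assumes "has_flag_basis m \<C> (Suc p) n" "has_flag_basis m \<C> p n'"
  shows "has_flag_basis (Suc m) \<C>' (Suc p) (n + card B * n')"
proof -
  from assms(1)[unfolded has_flag_basis_def] obtain B1 \<phi> where B1: "finite B1" "card B1 = n"
      "B1 \<subseteq> flags m \<C> (Suc p)"
      "\<forall>b\<in>B1. \<forall>b'\<in>B1. \<phi> b b' = (if b = b' then 1 else 0)"
      "\<forall>b\<in>B1. annihilates m \<C> (Suc p) (\<phi> b)"
      "\<forall>\<chi>. annihilates m \<C> (Suc p) \<chi> \<longrightarrow> (\<forall>F\<in>flags m \<C> (Suc p). \<chi> F = (\<Sum>b\<in>B1. \<phi> b F * \<chi> b))"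
    by (elim exE conjE) (rule that)
  from assms(2)[unfolded has_flag_basis_def] obtain B2 \<psi> where B2: "finite B2" "card B2 = n'"
      "B2 \<subseteq> flags m \<C> p"
      "\<forall>b\<in>B2. \<forall>b'\<in>B2. \<psi> b b' = (if b = b' then 1 else 0)"
      "\<forall>b\<in>B2. annihilates m \<C> p (\<psi> b)"
      "\<forall>\<chi>. annihilates m \<C> p \<chi> \<longrightarrow> (\<forall>F\<in>flags m \<C> p. \<chi> F = (\<Sum>b\<in>B2. \<psi> b F * \<chi> b))"
    by (elim exE conjE) (rule that)
  define I where "I = B1 <+> B \<times> B2"
  define b where "b = case_sum (map cyl) (\<lambda>(g, Ks). carrier_vec (Suc m) # map (gr g) Ks)"
  define \<Phi> where "\<Phi> = case_sum (\<lambda>Ks. cyl_functional (\<phi> Ks)) (\<lambda>(g, Ks). section_functional g (\<psi> Ks))"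
  have sec: "carrier_vec (Suc m) # map (gr g) Ks = map cyl [carrier_vec m] @ map (gr g) Ks" for g Ks
    by (simp add: cylinder_carrier)
  have eval_c: "cyl_functional \<phi>' (map cyl Ks) = \<phi>' Ks" "section_functional g \<phi>' (map cyl Ks) = 0"
    if "set Ks \<subseteq> edges m \<C>" for \<phi>' Ks g
    using cyl_functional_eval[OF that, of "[]"] section_functional_eval[OF that, of "[]"] by simp_all
  have eval_s: "cyl_functional \<phi>' (carrier_vec (Suc m) # map (gr g) Ks) = 0"
      "section_functional h \<phi>' (carrier_vec (Suc m) # map (gr g) Ks) = (if g = h then \<phi>' Ks else 0)"
    if "Ks \<in> flags m \<C> p" "g \<in> B" "h \<in> B" for \<phi>' Ks g h
  proof -
    note Ks = flag_props[OF that(1)]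
    have c: "set [carrier_vec m] \<subseteq> edges m \<C>" using carrier_edge by simp
    show "cyl_functional \<phi>' (carrier_vec (Suc m) # map (gr g) Ks) = 0"
      unfolding sec cyl_functional_eval[OF c Ks(1)] using Ks(7) by simp
    have "hd Ks = carrier_vec m" "carrier_vec m # tl Ks = Ks"
      using Ks(5,7) by (cases Ks; simp)+
    \<comment> \<open>The first graph of such a flag lies over the whole space, where different
      functions differ; hence section functionals of other functions vanish on it.\<close>
    moreover have "(\<forall>x\<in>carrier_vec m. g x = h x) \<longleftrightarrow> g = h" using distinct_B that by blast
    ultimately show "section_functional h \<phi>' (carrier_vec (Suc m) # map (gr g) Ks) = (if g = h then \<phi>' Ks else 0)"
      unfolding sec section_functional_eval[OF c Ks(1)] using Ks(7) by simp
  qed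
  have B1_edges: "set Ks \<subseteq> edges m \<C>" if "Ks \<in> B1" for Ks
    using B1(3) that flag_props(1) by blast
  have "has_flag_basis (Suc m) \<C>' (Suc p) (card I)"
  proof (rule has_flag_basisI[where b = b and \<phi> = \<Phi>])
    show "finite I" using B1(1) B2(1) fin_B by (simp add: I_def)
    show "b i \<in> flags (Suc m) \<C>' (Suc p)" if "i \<in> I" for i
      using that B1(3) B2(3) flags_cyl flags_section by (auto simp: I_def b_def)
    show "\<Phi> i (b j) = (if i = j then 1 else 0)" if "i \<in> I" "j \<in> I" for i j
    proof -
      have 1: "\<phi> b b' = (if b = b' then 1 else 0)" if "b \<in> B1" "b' \<in> B1" for b b'
        using B1(4) that by blast
      have 2: "\<psi> b b' = (if b = b' then 1 else 0)" if "b \<in> B2" "b' \<in> B2" for b b'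
        using B2(4) that by blast
      show ?thesis
        using that B2(3)
        by (auto simp: I_def b_def \<Phi>_def eval_c[OF B1_edges] eval_s 1 2 subset_iff split: if_splits)
    qed
    show "annihilates (Suc m) \<C>' (Suc p) (\<Phi> i)" if "i \<in> I" for i
      using that B1(5) B2(5) annihilates_cyl_functional annihilates_section_functional
      by (auto simp: I_def \<Phi>_def)
    show "\<chi> F = (\<Sum>i\<in>I. \<Phi> i F * \<chi> (b i))"
      if \<chi>: "annihilates (Suc m) \<C>' (Suc p) \<chi>" and F: "F \<in> flags (Suc m) \<C>' (Suc p)" for \<chi> F
    proof -
      have sum_I: "(\<Sum>i\<in>I. \<Phi> i F * \<chi> (b i)) = (\<Sum>Ks\<in>B1. cyl_functional (\<phi> Ks) F * \<chi> (map cyl Ks)) +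
          (\<Sum>g\<in>B. \<Sum>Ks\<in>B2. section_functional g (\<psi> Ks) F * \<chi> (carrier_vec (Suc m) # map (gr g) Ks))"
        unfolding I_def using B1(1) B2(1) fin_B
        by (simp add: sum.Plus \<Phi>_def b_def sum.cartesian_product case_prod_beta)
      from F show ?thesis
      proof (cases rule: flag_cases)
        case (1 Ks)
        then have Ks: "set Ks \<subseteq> edges m \<C>" using flag_props by blast
        have "\<chi> (map cyl Ks) = (\<Sum>b\<in>B1. \<phi> b Ks * \<chi> (map cyl b))"
          using B1(6) annihilates_pullback_cyl[OF \<chi>] 1(2) by blast
        then show ?thesis unfolding sum_I by (simp add: 1(1) eval_c[OF Ks])
      next
        case (2 Ks f j q)
        then have q: "q = p" by simp
        note Ks = flag_props[OF 2(4)[unfolded q]]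
        let ?As = "take (Suc j) Ks" and ?Cs = "drop j Ks"
        have sets: "set ?As \<subseteq> edges m \<C>" "set ?Cs \<subseteq> edges m \<C>"
          using Ks(1) by (auto dest: in_set_takeD in_set_dropD)
        have j: "j < length Ks" using 2(5) Ks(2) q by simp
        have Cs: "?Cs \<noteq> []" "hd ?Cs = Ks ! j" "?As @ tl ?Cs = Ks" "length ?As = Suc j"
          using j by (simp_all add: hd_drop_conv_nth tl_drop flip: drop_Suc)
        \<comment> \<open>The flag is rewritten in flags whose graphs start in codimension one; each
          of these is then expanded in \<open>B2\<close> by the pullback along its function.\<close>
        have "\<chi> F = (-1) ^ j * (\<Sum>g\<in>{g \<in> B. \<forall>x\<in>Ks ! j. f x = g x}. \<chi> (carrier_vec (Suc m) # map (gr g) Ks))"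
          unfolding 2(2) by (rule section_expansion[OF \<chi>]) (use 2 q in auto)
        also have "\<dots> = (\<Sum>g\<in>B. if \<forall>x\<in>Ks ! j. f x = g x
            then (-1) ^ j * \<chi> (carrier_vec (Suc m) # map (gr g) Ks) else 0)"
          by (subst sum.inter_filter[OF fin_B]) (simp add: sum_distrib_left if_distrib cong: if_cong)
        also have "\<dots> = (\<Sum>g\<in>B. \<Sum>b\<in>B2. section_functional g (\<psi> b) F * \<chi> (carrier_vec (Suc m) # map (gr g) b))"
        proof (rule sum.cong[OF refl])
          fix g assume g: "g \<in> B"
          define agree where "agree \<longleftrightarrow> (\<forall>x\<in>Ks ! j. f x = g x)"
          have "\<chi> (carrier_vec (Suc m) # map (gr g) Ks) =
              (\<Sum>b\<in>B2. \<psi> b Ks * \<chi> (carrier_vec (Suc m) # map (gr g) b))"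
            using B2(6) annihilates_pullback_gr[OF \<chi> g] 2(4) q by blast
          \<comment> \<open>The functional counts \<open>Suc j\<close> cylinders, so its sign
            \<open>(-1) ^ Suc (Suc j)\<close> is the \<open>(-1) ^ j\<close> of the
            expansion.\<close>
          then show "(if \<forall>x\<in>Ks ! j. f x = g x
              then (-1) ^ j * \<chi> (carrier_vec (Suc m) # map (gr g) Ks) else 0) =
            (\<Sum>b\<in>B2. section_functional g (\<psi> b) F * \<chi> (carrier_vec (Suc m) # map (gr g) b))"
            unfolding 2(2) section_functional_eval[OF sets] Cs agree_def[symmetric]
            using Cs(1) by (cases agree) (simp_all add: sum_distrib_left mult.assoc)
        qed
        also have "\<dots> = (\<Sum>i\<in>I. \<Phi> i F * \<chi> (b i))"
          unfolding sum_I using j by (simp add: 2(2) cyl_functional_eval[OF sets])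
        finally show ?thesis .
      qed
    qed
  qed
  moreover have "card I = n + card B * n'"
    using B1(1,2) B2(1,2) fin_B by (simp add: I_def card_Plus card_cartesian_product)
  ultimately show ?thesis by simp
qed

end

section \<open>Codimensions of affine subspaces\<close>

text \<open>Affine subspaces, the empty set included. The form with three points passes at once to
  intersections and makes the set of directions closed under sums and multiples.\<close>

definition flat :: "nat \<Rightarrow> complex vec set \<Rightarrow> bool"
  where "flat m L \<longleftrightarrow> L \<subseteq> carrier_vec m \<and>
    (\<forall>x\<in>L. \<forall>y\<in>L. \<forall>z\<in>L. \<forall>c. x + c \<cdot>\<^sub>v (y - z) \<in> L)"

definition directions :: "complex vec set \<Rightarrow> complex vec set"
  where "directions L = {x - y |x y. x \<in> L \<and> y \<in> L}"

lemma flat_carrier: "flat m L \<Longrightarrow> x \<in> L \<Longrightarrow> x \<in> carrier_vec m"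
  by (auto simp: flat_def)

lemma flatD: "flat m L \<Longrightarrow> x \<in> L \<Longrightarrow> y \<in> L \<Longrightarrow> z \<in> L \<Longrightarrow> x + c \<cdot>\<^sub>v (y - z) \<in> L"
  by (auto simp: flat_def)

lemma directions_translate:
  assumes "flat m L" "x \<in> L" "d \<in> directions L"
  shows "x + d \<in> L"
proof -
  from assms(3) obtain y z where yz: "d = y - z" "y \<in> L" "z \<in> L" by (auto simp: directions_def)
  from flatD[OF assms(1,2) yz(2,3), of 1] show ?thesis by (simp add: yz(1))
qed

text \<open>Fixing a base point turns differences of two arbitrary points into a membership test,
  from which closure under the operations can be checked directly.\<close>

lemma directions_at:
  assumes "flat m L" "x \<in> L"
  shows "directions L = {d \<in> carrier_vec m. x + d \<in> L}"
proof (intro equalityI subsetI)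
  fix d assume "d \<in> directions L"
  then show "d \<in> {d \<in> carrier_vec m. x + d \<in> L}"
    using directions_translate[OF assms] flat_carrier[OF assms(1)] by (auto simp: directions_def)
next
  fix d assume d: "d \<in> {d \<in> carrier_vec m. x + d \<in> L}"
  moreover have "x \<in> carrier_vec m" using assms flat_carrier by blast
  ultimately have "d = (x + d) - x" by auto
  then show "d \<in> directions L" using d assms(2) unfolding directions_def by blast
qed

lemma directions_subspace:
  assumes "flat m L" "L \<noteq> {}"
  shows "subspace class_ring (directions L) (module_vec TYPE(complex) m)"
proof -
  from assms(2) obtain x where x: "x \<in> L" by blast
  note at = directions_at[OF assms(1) x]
  have xc: "x \<in> carrier_vec m" using assms x flat_carrier by blast
  interpret V: vectorspace class_ring "module_vec TYPE(complex) m" by (rule vec_vs)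
  have smult: "x + c \<cdot>\<^sub>v d \<in> L" if "d \<in> carrier_vec m" "x + d \<in> L" for c d
  proof -
    have "x + d - x = d" using xc that(1) by auto
    then show ?thesis using flatD[OF assms(1) x that(2) x, of c] by simp
  qed
  have add: "x + (d + e) \<in> L" if "d \<in> carrier_vec m" "x + d \<in> L" "e \<in> carrier_vec m" "x + e \<in> L" for d e
  proof -
    have "x + e - x = e" using xc that(3) by auto
    then have "(x + d) + e \<in> L" using flatD[OF assms(1) that(2,4) x, of 1] by simp
    then show ?thesis using xc that by (simp add: assoc_add_vec[of x m])
  qed
  have "submodule class_ring (directions L) (module_vec TYPE(complex) m)"
  proof (unfold_locales)
    show "directions L \<subseteq> carrier (module_vec TYPE(complex) m)"
      unfolding at by (auto simp: module_vec_simps)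
    show "\<zero>\<^bsub>module_vec TYPE(complex) m\<^esub> \<in> directions L"
      unfolding at using x xc by (simp add: module_vec_simps)
    show "v \<oplus>\<^bsub>module_vec TYPE(complex) m\<^esub> w \<in> directions L" if "v \<in> directions L" "w \<in> directions L" for v w
      using that add unfolding at by (simp add: module_vec_simps)
    show "c \<odot>\<^bsub>module_vec TYPE(complex) m\<^esub> v \<in> directions L" if "c \<in> carrier class_ring" "v \<in> directions L" for c v
      using that smult unfolding at by (simp add: module_vec_simps)
  qed
  then show ?thesis by (simp add: subspace_def vec_vs)
qed

abbreviation dir_space :: "nat \<Rightarrow> complex vec set \<Rightarrow> (complex, complex vec) module"
  where "dir_space m L \<equiv> (module_vec TYPE(complex) m)\<lparr>carrier := directions L\<rparr>"

definition flat_dim :: "nat \<Rightarrow> complex vec set \<Rightarrow> nat"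
  where "flat_dim m L = vectorspace.dim class_ring (dir_space m L)"

lemma codim_flat_dim: "codim m L = m - flat_dim m L"
  by (simp add: codim_def flat_dim_def directions_def)

lemma vectorspace_dir_space:
  assumes "flat m L" "L \<noteq> {}"
  shows "vectorspace class_ring (dir_space m L)"
proof -
  interpret V: vectorspace class_ring "module_vec TYPE(complex) m" by (rule vec_vs)
  show ?thesis by (rule V.subspace_is_vs[OF directions_subspace[OF assms]])
qed

lemma lin_indpt_dir_space:
  assumes "flat m L" "L \<noteq> {}" "A \<subseteq> directions L"
  shows "LinearCombinations.module.lin_dep class_ring (dir_space m L) A \<longleftrightarrow>
      LinearCombinations.module.lin_dep class_ring (module_vec TYPE(complex) m) A"
    and "LinearCombinations.module.span class_ring (dir_space m L) A =
      LinearCombinations.module.span class_ring (module_vec TYPE(complex) m) A"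
proof -
  interpret V: vectorspace class_ring "module_vec TYPE(complex) m" by (rule vec_vs)
  have sm: "submodule class_ring (directions L) (module_vec TYPE(complex) m)"
    using directions_subspace[OF assms(1,2)] by (simp add: subspace_def)
  show "LinearCombinations.module.lin_dep class_ring (dir_space m L) A \<longleftrightarrow>
      LinearCombinations.module.lin_dep class_ring (module_vec TYPE(complex) m) A"
    "LinearCombinations.module.span class_ring (dir_space m L) A =
      LinearCombinations.module.span class_ring (module_vec TYPE(complex) m) A"
    using V.span_li_not_depend[OF assms(3) sm] by simp_all
qed

text \<open>Independent directions are independent in the ambient space, so there are at most
  \<open>m\<close> of them, and a maximal independent set is a finite basis. This supplies the
  finite dimensionality on which later comparisons of dimensions rest.\<close>

lemma flat_basis_exists:
  assumes "flat m L" "L \<noteq> {}"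
  obtains A where "finite A" "A \<subseteq> directions L" "card A = flat_dim m L"
    "\<not> LinearCombinations.module.lin_dep class_ring (module_vec TYPE(complex) m) A"
    "LinearCombinations.module.span class_ring (module_vec TYPE(complex) m) A = directions L"
    "vectorspace.fin_dim class_ring (dir_space m L)"
proof -
  interpret V: vec_space "TYPE(complex)" m .
  interpret D: vectorspace class_ring "dir_space m L" by (rule vectorspace_dir_space[OF assms])
  have bound: "finite A \<and> card A \<le> m" if "A \<subseteq> directions L \<and> D.lin_indpt A" for A
  proof -
    have "A \<subseteq> carrier_vec m"
      using that directions_subspace[OF assms]
      by (auto simp: subspace_def submodule_def module_vec_simps)
    moreover have "V.lin_indpt A" using lin_indpt_dir_space(1)[OF assms] that by blast
    ultimately show ?thesis
      using V.li_le_dim[OF V.fin_dim, of A] V.dim_is_n by (simp add: module_vec_simps)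
  qed
  have "{} \<subseteq> directions L \<and> D.lin_indpt {}"
    by (simp add: D.lin_dep_def)
  from maximal_exists[of "\<lambda>A. A \<subseteq> directions L \<and> D.lin_indpt A", OF bound this]
  obtain A where A: "finite A" "maximal A (\<lambda>A. A \<subseteq> directions L \<and> D.lin_indpt A)" by blast
  then have "D.basis A" using D.max_li_is_basis by simp
  then have "D.lin_indpt A" "D.span A = directions L" "A \<subseteq> directions L"
    unfolding D.basis_def by simp_all
  moreover have "card A = flat_dim m L"
    unfolding flat_dim_def using D.dim_basis[OF A(1) \<open>D.basis A\<close>] by simp
  moreover have "D.fin_dim"
    unfolding D.fin_dim_def using A(1) calculation by auto
  ultimately show thesis
    using A(1) lin_indpt_dir_space[OF assms, of A] by (intro that[of A]) simp_all
qed

text \<open>\<open>codim\<close> is a truncated difference of natural numbers; this bound makes it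
  reflect the dimension faithfully.\<close>

lemma flat_dim_le:
  assumes "flat m L" "L \<noteq> {}"
  shows "flat_dim m L \<le> m"
proof -
  interpret V: vec_space "TYPE(complex)" m .
  obtain A where A: "finite A" "A \<subseteq> directions L" "card A = flat_dim m L" "V.lin_indpt A"
    by (rule flat_basis_exists[OF assms])
  have "A \<subseteq> carrier_vec m"
    using A(2) directions_subspace[OF assms]
    by (auto simp: subspace_def submodule_def module_vec_simps)
  then show ?thesis
    using V.li_le_dim(2)[OF V.fin_dim, of A] A V.dim_is_n by (simp add: module_vec_simps)
qed

text \<open>If the dimensions agreed, a basis of the directions of \<open>K\<close> would also be
  one for \<open>L\<close>; equal directions at a common point give equal flats.\<close>

lemma flat_dim_less:
  assumes K: "flat m K" "K \<noteq> {}" and L: "flat m L" "L \<noteq> {}" and "K \<subset> L"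
  shows "flat_dim m K < flat_dim m L"
proof -
  interpret V: vec_space "TYPE(complex)" m .
  interpret D: vectorspace class_ring "dir_space m L" by (rule vectorspace_dir_space[OF L])
  obtain A where A: "finite A" "A \<subseteq> directions K" "card A = flat_dim m K" "V.lin_indpt A"
      "V.span A = directions K"
    by (rule flat_basis_exists[OF K])
  obtain A' where fd: "D.fin_dim"
    by (rule flat_basis_exists[OF L])
  have AL: "A \<subseteq> directions L" using A(2) assms(5) unfolding directions_def by blast
  have li: "D.lin_indpt A" using lin_indpt_dir_space(1)[OF L AL] A(4) by blast
  have le: "card A \<le> D.dim" using D.li_le_dim(2)[OF fd _ li] AL by simp
  have "card A \<noteq> D.dim"
  proof
    assume "card A = D.dim"
    then have "D.basis A" using D.dim_li_is_basis[OF fd A(1) _ li] AL by simp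
    then have "D.span A = directions L" unfolding D.basis_def by simp
    then have dir: "directions K = directions L" using A(5) lin_indpt_dir_space(2)[OF L AL] by simp
    obtain x where x: "x \<in> K" using K(2) by blast
    have "L \<subseteq> K"
    proof
      fix y assume y: "y \<in> L"
      have "y - x \<in> directions L" using y x assms(5) by (auto simp: directions_def)
      then have "x + (y - x) \<in> K" using directions_translate[OF K(1) x] dir by simp
      moreover have "x + (y - x) = y"
        using flat_carrier[OF K(1) x] flat_carrier[OF L(1) y] by auto
      ultimately show "y \<in> K" by simp
    qed
    with assms(5) show False by blast
  qed
  with le A(3) show ?thesis by (simp add: flat_dim_def)
qed

section \<open>Dimensions of cylinders and graphs by projection along the last coordinate\<close>

lemma vec_first_linear:
  fixes x y :: "complex vec"
  assumes "x \<in> carrier_vec (Suc m)" "y \<in> carrier_vec (Suc m)"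
  shows "vec_first (x + y) m = vec_first x m + vec_first y m"
    and "vec_first (x - y) m = vec_first x m - vec_first y m"
    and "vec_first (c \<cdot>\<^sub>v x) m = c \<cdot>\<^sub>v vec_first x m"
  using assms by (auto simp: vec_first_def)

lemma vec_eq_first_last:
  fixes x y :: "complex vec"
  assumes "x \<in> carrier_vec (Suc m)" "y \<in> carrier_vec (Suc m)"
    and "vec_first x m = vec_first y m" "x $ m = y $ m"
  shows "x = y"
proof (rule eq_vecI)
  fix i assume "i < dim_vec y"
  then have "i < m \<or> i = m" using assms(2) by auto
  moreover have "vec_first x m $ i = vec_first y m $ i" using assms(3) by simp
  ultimately show "x $ i = y $ i" using assms(4) by (auto simp: vec_first_def)
qed (use assms in auto)

lemma directions_vec_first:
  assumes "L \<subseteq> carrier_vec (Suc m)"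
  shows "(\<lambda>t. vec_first t m) ` directions L = directions ((\<lambda>t. vec_first t m) ` L)"
proof (intro equalityI subsetI)
  fix d assume "d \<in> (\<lambda>t. vec_first t m) ` directions L"
  then obtain x y where xy: "x \<in> L" "y \<in> L" "d = vec_first (x - y) m"
    by (auto simp: directions_def)
  then have "x \<in> carrier_vec (Suc m)" "y \<in> carrier_vec (Suc m)" using assms by blast+
  then have "d = vec_first x m - vec_first y m" using xy by (simp add: vec_first_linear)
  then show "d \<in> directions ((\<lambda>t. vec_first t m) ` L)"
    using xy unfolding directions_def by blast
next
  fix d assume "d \<in> directions ((\<lambda>t. vec_first t m) ` L)"
  then obtain x y where xy: "x \<in> L" "y \<in> L" "d = vec_first x m - vec_first y m"
    by (auto simp: directions_def)
  then have "x \<in> carrier_vec (Suc m)" "y \<in> carrier_vec (Suc m)" using assms by blast+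
  then have "d = vec_first (x - y) m" using xy by (simp add: vec_first_linear)
  moreover have "x - y \<in> directions L" using xy unfolding directions_def by blast
  ultimately show "d \<in> (\<lambda>t. vec_first t m) ` directions L" by blast
qed

text \<open>Stated with the same three points as \<open>flat\<close>, so that graphs and coincidence
  sets of such functions are flat by substitution.\<close>

definition affine_fun :: "nat \<Rightarrow> (complex vec \<Rightarrow> complex) \<Rightarrow> bool"
  where "affine_fun m f \<longleftrightarrow> (\<forall>x\<in>carrier_vec m. \<forall>y\<in>carrier_vec m. \<forall>z\<in>carrier_vec m. \<forall>c.
    f (x + c \<cdot>\<^sub>v (y - z)) = f x + c * (f y - f z))"

lemma affine_funD:
  "affine_fun m f \<Longrightarrow> x \<in> carrier_vec m \<Longrightarrow> y \<in> carrier_vec m \<Longrightarrow> z \<in> carrier_vec m \<Longrightarrow>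
    f (x + c \<cdot>\<^sub>v (y - z)) = f x + c * (f y - f z)"
  by (simp add: affine_fun_def)

lemma flat_carrier_vec: "flat m (carrier_vec m)"
  by (auto simp: flat_def)

lemma vec_first_affine:
  fixes x y z :: "complex vec"
  assumes "x \<in> carrier_vec (Suc m)" "y \<in> carrier_vec (Suc m)" "z \<in> carrier_vec (Suc m)"
  shows "vec_first (x + c \<cdot>\<^sub>v (y - z)) m = vec_first x m + c \<cdot>\<^sub>v (vec_first y m - vec_first z m)"
proof -
  have "c \<cdot>\<^sub>v (y - z) \<in> carrier_vec (Suc m)" "y - z \<in> carrier_vec (Suc m)" using assms by auto
  then show ?thesis using assms by (simp add: vec_first_linear)
qed

lemma flat_cylinder:
  assumes "flat m K"
  shows "flat (Suc m) (cylinder m K)"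
  unfolding flat_def
proof (intro conjI ballI allI)
  show "cylinder m K \<subseteq> carrier_vec (Suc m)" by (auto simp: cylinder_def)
  fix x y z c assume "x \<in> cylinder m K" "y \<in> cylinder m K" "z \<in> cylinder m K"
  then show "x + c \<cdot>\<^sub>v (y - z) \<in> cylinder m K"
    using flatD[OF assms] by (simp add: cylinder_def vec_first_affine)
qed

lemma flat_graph_over:
  assumes "flat m K" "affine_fun m f"
  shows "flat (Suc m) (graph_over m f K)"
  unfolding flat_def
proof (intro conjI ballI allI)
  show "graph_over m f K \<subseteq> carrier_vec (Suc m)" by (auto simp: graph_over_def)
  fix x y z c assume "x \<in> graph_over m f K" "y \<in> graph_over m f K" "z \<in> graph_over m f K"
  moreover from this have "(x + c \<cdot>\<^sub>v (y - z)) $ m = x $ m + c * (y $ m - z $ m)"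
    by (auto simp: graph_over_def)
  ultimately show "x + c \<cdot>\<^sub>v (y - z) \<in> graph_over m f K"
    using flatD[OF assms(1)] affine_funD[OF assms(2) vec_first_carrier vec_first_carrier vec_first_carrier]
    by (simp add: graph_over_def vec_first_affine)
qed

lemma linear_map_vec_first:
  assumes L: "flat (Suc m) L" "L \<noteq> {}" and K: "flat m K" "K \<noteq> {}"
    and im: "(\<lambda>t. vec_first t m) ` L = K"
  shows "linear_map class_ring (dir_space (Suc m) L) (dir_space m K) (\<lambda>t. vec_first t m)"
    and "(\<lambda>t. vec_first t m) ` directions L = directions K"
proof -
  have sub: "L \<subseteq> carrier_vec (Suc m)" using L by (simp add: flat_def)
  show surj: "(\<lambda>t. vec_first t m) ` directions L = directions K"
    using directions_vec_first[OF sub] im by simp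
  have car: "directions L \<subseteq> carrier_vec (Suc m)" using sub by (auto simp: directions_def intro!: minus_carrier_vec)
  have "(\<lambda>t. vec_first t m) \<in> LinearCombinations.module_hom class_ring (dir_space (Suc m) L) (dir_space m K)"
    unfolding LinearCombinations.module_hom_def
    using surj car by (auto simp: module_vec_simps vec_first_linear subset_iff)
  then show "linear_map class_ring (dir_space (Suc m) L) (dir_space m K) (\<lambda>t. vec_first t m)"
    using vectorspace_dir_space[OF L] vectorspace_dir_space[OF K]
    by (intro linear_map.intro mod_hom.intro mod_hom_axioms.intro) (simp_all only: vectorspace_def)
qed

text \<open>Projection maps the directions of the graph bijectively to those of \<open>K\<close>:
  the last coordinate of a direction is a difference of two values of \<open>f\<close>, which by
  affinity depends only on the difference of the base points.\<close>

lemma flat_dim_graph_over: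
  assumes K: "flat m K" "K \<noteq> {}" and f: "affine_fun m f"
  shows "flat_dim (Suc m) (graph_over m f K) = flat_dim m K"
proof -
  let ?L = "graph_over m f K"
  have Kc: "K \<subseteq> carrier_vec m" using K(1) by (simp add: flat_def)
  have im: "(\<lambda>t. vec_first t m) ` ?L = K" by (rule image_graph_over[OF Kc])
  have L: "flat (Suc m) ?L" "?L \<noteq> {}" using flat_graph_over[OF K(1) f] im K(2) by auto
  interpret T: linear_map class_ring "dir_space (Suc m) ?L" "dir_space m K" "\<lambda>t. vec_first t m"
    by (rule linear_map_vec_first(1)[OF L K im])
  obtain A where fd: "vectorspace.fin_dim class_ring (dir_space (Suc m) ?L)"
    by (rule flat_basis_exists[OF L])
  have "inj_on (\<lambda>t. vec_first t m) (directions ?L)"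
  proof (rule inj_onI)
    fix d e assume "d \<in> directions ?L" "e \<in> directions ?L" and eq: "vec_first d m = vec_first e m"
    then obtain x y x' y' where d: "d = x - y" "x \<in> ?L" "y \<in> ?L" and e: "e = x' - y'" "x' \<in> ?L" "y' \<in> ?L"
      by (auto simp: directions_def)
    have c: "x \<in> carrier_vec (Suc m)" "y \<in> carrier_vec (Suc m)" "x' \<in> carrier_vec (Suc m)" "y' \<in> carrier_vec (Suc m)"
      using d e by (auto simp: graph_over_def)
    let ?t = "\<lambda>t. vec_first t m"
    have diff: "?t x - ?t y = ?t x' - ?t y'" using eq c by (simp add: d e vec_first_linear)
    \<comment> \<open>One base point is written in the form, with factor 1, to which affinity of
      \<open>f\<close> applies.\<close>
    have "?t x = ?t y + 1 \<cdot>\<^sub>v (?t x - ?t y)"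
      using vec_first_carrier[of x m] vec_first_carrier[of y m] by auto
    then have "?t x = ?t y + 1 \<cdot>\<^sub>v (?t x' - ?t y')" by (simp only: diff)
    then have "f (?t x) = f (?t y) + 1 * (f (?t x') - f (?t y'))"
      using affine_funD[OF f vec_first_carrier vec_first_carrier vec_first_carrier, of y 1 x' y'] by simp
    then have "d $ m = e $ m" using d e c by (simp add: graph_over_def)
    then show "d = e"
      using vec_eq_first_last[OF _ _ eq] c by (simp add: d(1) e(1))
  qed
  then show ?thesis
    using T.dim_eq[OF fd] linear_map_vec_first(2)[OF L K im] by (simp add: flat_dim_def)
qed

text \<open>Rank and nullity of the projection: its image is the full space of directions of
  \<open>K\<close>, its kernel the line along the last coordinate.\<close>

lemma flat_dim_cylinder:
  assumes K: "flat m K" "K \<noteq> {}"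
  shows "flat_dim (Suc m) (cylinder m K) = Suc (flat_dim m K)"
proof -
  let ?L = "cylinder m K"
  have Kc: "K \<subseteq> carrier_vec m" using K(1) by (simp add: flat_def)
  have im: "(\<lambda>t. vec_first t m) ` ?L = K" by (rule image_cylinder[OF Kc])
  have L: "flat (Suc m) ?L" "?L \<noteq> {}" using flat_cylinder[OF K(1)] im K(2) by auto
  interpret T: linear_map class_ring "dir_space (Suc m) ?L" "dir_space m K" "\<lambda>t. vec_first t m"
    by (rule linear_map_vec_first(1)[OF L K im])
  obtain A where fd: "vectorspace.fin_dim class_ring (dir_space (Suc m) ?L)"
    by (rule flat_basis_exists[OF L])
  have rn: "vectorspace.dim class_ring (T.W.vs T.imT) + vectorspace.dim class_ring (T.V.vs T.kerT) =
      flat_dim (Suc m) ?L"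
    using T.rank_nullity[OF fd] by (simp add: flat_dim_def)
  have "T.imT = directions K"
    using linear_map_vec_first(2)[OF L K im] by (simp add: T.im_def)
  then have 1: "vectorspace.dim class_ring (T.W.vs T.imT) = flat_dim m K" by (simp add: flat_dim_def)
  obtain x where x: "x \<in> ?L" using L(2) by blast
  have xc: "x \<in> carrier_vec (Suc m)" using x by (simp add: cylinder_def)
  let ?e = "unit_vec (Suc m) m :: complex vec"
  have T_e: "vec_first (c \<cdot>\<^sub>v ?e) m = 0\<^sub>v m" for c by (auto simp: vec_first_def)
  have ker: "T.kerT = {c \<cdot>\<^sub>v ?e |c. True}"
  proof (intro equalityI subsetI)
    fix d assume "d \<in> T.kerT"
    then have "d \<in> directions ?L" "vec_first d m = 0\<^sub>v m"
      by (simp_all add: T.ker_def module_vec_simps)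
    then have d: "d \<in> carrier_vec (Suc m)" "vec_first d m = 0\<^sub>v m"
      by (simp_all add: directions_at[OF L(1) x])
    have "d = (d $ m) \<cdot>\<^sub>v ?e"
      by (rule vec_eq_first_last) (use d T_e in auto)
    then show "d \<in> {c \<cdot>\<^sub>v ?e |c. True}" by blast
  next
    fix d assume "d \<in> {c \<cdot>\<^sub>v ?e |c. True}"
    then obtain c where d: "d = c \<cdot>\<^sub>v ?e" by blast
    have "vec_first (x + d) m = vec_first x m"
      using vec_first_linear(1)[OF xc, of d] T_e[of c] vec_first_carrier[of x m] by (simp add: d)
    then have "x + d \<in> ?L" using x xc by (simp add: cylinder_def d)
    then have "d \<in> directions ?L" by (simp add: directions_at[OF L(1) x] d)
    then show "d \<in> T.kerT" using T_e by (simp add: T.ker_def d module_vec_simps)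
  qed
  interpret Ker: vectorspace class_ring "T.V.vs T.kerT"
    by (rule T.V.subspace_is_vs[OF T.kerT_is_subspace])
  have e: "?e \<in> T.kerT" unfolding ker by (intro CollectI exI[of _ 1]) auto
  have "Ker.dim = 1"
  proof (rule Ker.dim1I)
    show "?e \<in> carrier (T.V.vs T.kerT)" using e by simp
    show "?e \<noteq> \<zero>\<^bsub>T.V.vs T.kerT\<^esub>"
      using arg_cong[of ?e "0\<^sub>v (Suc m)" "\<lambda>v. v $ m"] by (auto simp: module_vec_simps)
    have se: "{?e} \<subseteq> carrier (T.V.vs T.kerT)" using e by simp
    interpret S: submodule class_ring "Ker.span {?e}" "T.V.vs T.kerT"
      by (rule Ker.span_is_submodule[OF se])
    have "c \<cdot>\<^sub>v ?e \<in> Ker.span {?e}" for c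
      using S.smult_closed[of c ?e] Ker.in_own_span[OF se] by (simp add: module_vec_simps)
    then show "Ker.gen_set {?e}"
      using Ker.span_is_subset2[OF se] by (auto simp: ker)
  qed
  with rn 1 show ?thesis by simp
qed

lemma codim_carrier_vec: "codim m (carrier_vec m) = 0"
proof -
  interpret V: vec_space "TYPE(complex)" m .
  have dir: "directions (carrier_vec m) = carrier_vec m"
    using directions_at[OF flat_carrier_vec, of "0\<^sub>v m" m] by auto
  have eq: "(module_vec TYPE(complex) m)\<lparr>carrier := carrier_vec m\<rparr> = module_vec TYPE(complex) m"
    by (simp add: module_vec_def)
  have "flat_dim m (carrier_vec m) = m"
    unfolding flat_dim_def dir eq by (rule V.dim_is_n)
  then show ?thesis by (simp add: codim_flat_dim)
qed

section \<open>Fibre-type arrangements\<close>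

lemma flat_edge:
  assumes "\<And>H. H \<in> \<C> \<Longrightarrow> flat m H" "L \<in> edges m \<C>"
  shows "flat m L" "L \<noteq> {}"
proof -
  from assms(2) obtain \<B> where B: "\<B> \<subseteq> \<C>" "L = carrier_vec m \<inter> \<Inter>\<B>" "L \<noteq> {}"
    by (auto simp: edges_def)
  show "flat m L"
    unfolding flat_def
  proof (intro conjI ballI allI)
    fix x y z c assume xyz: "x \<in> L" "y \<in> L" "z \<in> L"
    have "x + c \<cdot>\<^sub>v (y - z) \<in> carrier_vec m"
      using flatD[OF flat_carrier_vec] xyz unfolding B(2) by blast
    moreover have "x + c \<cdot>\<^sub>v (y - z) \<in> H" if "H \<in> \<B>" for H
      using flatD[OF assms(1)] xyz that B(1) unfolding B(2) by blast
    ultimately show "x + c \<cdot>\<^sub>v (y - z) \<in> L" unfolding B(2) by blast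
  qed (use B in blast)
  show "L \<noteq> {}" by (rule B(3))
qed

lemma cylinder_Inter:
  "cylinder m (carrier_vec m \<inter> \<Inter>\<B>) = carrier_vec (Suc m) \<inter> \<Inter>(cylinder m ` \<B>)"
  by (auto simp: cylinder_def)

lemma graph_over_Inter:
  "graph_over m f (carrier_vec m \<inter> \<Inter>\<B>) =
    carrier_vec (Suc m) \<inter> \<Inter>(insert (graph_over m f (carrier_vec m)) (cylinder m ` \<B>))"
  by (auto simp: cylinder_def graph_over_def)

text \<open>Hyperplanes that are all cylinders meet in a cylinder. Once a graph of \<open>f\<close>
  is among them, every further graph of some \<open>g\<close> only imposes \<open>f = g\<close> on
  the base, and by \<open>coincide\<close> this condition is empty or a hyperplane
  downstairs.\<close>

lemma edges_fibred:
  assumes C': "\<C>' = cylinder m ` \<C> \<union> (\<lambda>f. graph_over m f (carrier_vec m)) ` B"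
    and coincide: "\<And>f g. f \<in> B \<Longrightarrow> g \<in> B \<Longrightarrow> f \<noteq> g \<Longrightarrow> {x \<in> carrier_vec m. f x = g x} \<in> insert {} \<C>"
  shows "edges (Suc m) \<C>' = cylinder m ` edges m \<C> \<union> {graph_over m f K |f K. f \<in> B \<and> K \<in> edges m \<C>}"
proof (intro equalityI subsetI)
  fix L assume "L \<in> edges (Suc m) \<C>'"
  then obtain \<B>' where B': "\<B>' \<subseteq> \<C>'" "L = carrier_vec (Suc m) \<inter> \<Inter>\<B>'" "L \<noteq> {}"
    by (auto simp: edges_def)
  define \<B> where "\<B> = {H \<in> \<C>. cylinder m H \<in> \<B>'}"
  define G where "G = {f \<in> B. graph_over m f (carrier_vec m) \<in> \<B>'}"
  have split: "\<B>' = cylinder m ` \<B> \<union> (\<lambda>f. graph_over m f (carrier_vec m)) ` G"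
  proof (intro equalityI subsetI)
    fix X assume X: "X \<in> \<B>'"
    then consider H where "X = cylinder m H" "H \<in> \<C>" | f where "X = graph_over m f (carrier_vec m)" "f \<in> B"
      using B'(1) unfolding C' by auto
    then show "X \<in> cylinder m ` \<B> \<union> (\<lambda>f. graph_over m f (carrier_vec m)) ` G"
      by cases (use X in \<open>auto simp: \<B>_def G_def\<close>)
  qed (auto simp: \<B>_def G_def)
  have L_iff: "t \<in> L \<longleftrightarrow> t \<in> carrier_vec (Suc m) \<and> (\<forall>H\<in>\<B>. vec_first t m \<in> H) \<and> (\<forall>g\<in>G. t $ m = g (vec_first t m))" for t
  proof
    assume t: "t \<in> L"
    then have "t \<in> X" if "X \<in> \<B>'" for X using B'(2) that by blast
    from this[unfolded split] t show "t \<in> carrier_vec (Suc m) \<and> (\<forall>H\<in>\<B>. vec_first t m \<in> H) \<and>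
        (\<forall>g\<in>G. t $ m = g (vec_first t m))"
      using B'(2) by (simp add: ball_Un image_iff cylinder_def graph_over_def) blast
  next
    assume t: "t \<in> carrier_vec (Suc m) \<and> (\<forall>H\<in>\<B>. vec_first t m \<in> H) \<and>
        (\<forall>g\<in>G. t $ m = g (vec_first t m))"
    then have "t \<in> X" if "X \<in> \<B>'" for X
      using that unfolding split by (auto simp: cylinder_def graph_over_def)
    with t show "t \<in> L" unfolding B'(2) by blast
  qed
  show "L \<in> cylinder m ` edges m \<C> \<union> {graph_over m f K |f K. f \<in> B \<and> K \<in> edges m \<C>}"
  proof (cases "G = {}")
    case True
    let ?K = "carrier_vec m \<inter> \<Inter>\<B>"
    have L: "L = cylinder m ?K" unfolding cylinder_Inter B'(2) split True by simp
    have "?K \<noteq> {}"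
    proof
      assume "?K = {}"
      with L have "L = cylinder m {}" by (simp only:)
      then show False using B'(3) by (simp add: cylinder_def)
    qed
    then have "?K \<in> edges m \<C>" unfolding edges_def \<B>_def by blast
    with L show ?thesis by blast
  next
    case False
    then obtain f where f: "f \<in> G" by blast
    \<comment> \<open>The graph of \<open>f\<close> is kept, and each other graph is traded for its
      coincidence set with \<open>f\<close>.\<close>
    let ?\<D> = "\<B> \<union> (\<lambda>g. {x \<in> carrier_vec m. f x = g x}) ` (G - {f})"
    let ?K = "carrier_vec m \<inter> \<Inter>?\<D>"
    have agree: "(\<forall>g\<in>G. a = g y) \<longleftrightarrow> (\<forall>g\<in>G. f y = g y) \<and> a = f y" for a y
    proof
      assume a: "\<forall>g\<in>G. a = g y"
      from bspec[OF a f] have "a = f y" .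
      with a show "(\<forall>g\<in>G. f y = g y) \<and> a = f y" by simp
    qed simp
    have L: "L = graph_over m f ?K"
    proof (rule Set.set_eqI)
      fix t :: "complex vec"
      have "vec_first t m \<in> ?K \<longleftrightarrow>
          (\<forall>H\<in>\<B>. vec_first t m \<in> H) \<and> (\<forall>g\<in>G. f (vec_first t m) = g (vec_first t m))"
        by (auto simp: ball_Un)
      then have "t \<in> graph_over m f ?K \<longleftrightarrow> t \<in> carrier_vec (Suc m) \<and>
          ((\<forall>H\<in>\<B>. vec_first t m \<in> H) \<and> (\<forall>g\<in>G. f (vec_first t m) = g (vec_first t m))) \<and>
          t $ m = f (vec_first t m)"
        by (simp only: graph_over_def mem_Collect_eq)
      then show "t \<in> L \<longleftrightarrow> t \<in> graph_over m f ?K"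
        unfolding L_iff by (subst agree) (simp only: conj_assoc)
    qed
    have ne: "?K \<noteq> {}"
    proof
      assume "?K = {}"
      with L have "L = graph_over m f {}" by (simp only:)
      then show False using B'(3) by (simp add: graph_over_def)
    qed
    \<comment> \<open>Empty coincidence sets are ruled out because the whole intersection is
      non-empty.\<close>
    have "?\<D> \<subseteq> \<C>"
    proof
      fix D assume D: "D \<in> ?\<D>"
      have "D \<noteq> {}" using D ne by blast
      moreover have "D \<in> insert {} \<C>"
        using D f coincide unfolding \<B>_def G_def by blast
      ultimately show "D \<in> \<C>" by simp
    qed
    with ne have "?K \<in> edges m \<C>" unfolding edges_def by blast
    moreover have "f \<in> B" using f by (simp add: G_def)
    ultimately show ?thesis using L by blast
  qed
next
  fix L assume "L \<in> cylinder m ` edges m \<C> \<union> {graph_over m f K |f K. f \<in> B \<and> K \<in> edges m \<C>}"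
  then consider K where "L = cylinder m K" "K \<in> edges m \<C>"
    | f K where "L = graph_over m f K" "f \<in> B" "K \<in> edges m \<C>" by blast
  then show "L \<in> edges (Suc m) \<C>'"
  proof cases
    case 1
    then obtain \<B> where B: "\<B> \<subseteq> \<C>" "K = carrier_vec m \<inter> \<Inter>\<B>" "K \<noteq> {}" by (auto simp: edges_def)
    have "cylinder m ` \<B> \<subseteq> \<C>'" using B(1) unfolding C' by blast
    moreover have "L \<noteq> {}" using 1 image_cylinder[of K m] B(2,3) by auto
    ultimately show ?thesis
      unfolding edges_def using 1(1) cylinder_Inter[of m \<B>] B(2) by blast
  next
    case 2
    then obtain \<B> where B: "\<B> \<subseteq> \<C>" "K = carrier_vec m \<inter> \<Inter>\<B>" "K \<noteq> {}" by (auto simp: edges_def)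
    have "insert (graph_over m f (carrier_vec m)) (cylinder m ` \<B>) \<subseteq> \<C>'"
      using B(1) 2 unfolding C' by blast
    moreover have "L \<noteq> {}" using 2 image_graph_over[of K m f] B(2,3) by auto
    ultimately show ?thesis
      unfolding edges_def using 2(1) graph_over_Inter[of m f \<B>] B(2) by blast
  qed
qed

lemma fibred_arrangementI:
  assumes B: "finite B" "\<And>f. f \<in> B \<Longrightarrow> affine_fun m f"
    and C: "\<And>H. H \<in> \<C> \<Longrightarrow> flat m H" "carrier_vec m \<notin> \<C>"
    and C': "\<C>' = cylinder m ` \<C> \<union> (\<lambda>f. graph_over m f (carrier_vec m)) ` B"
    and coincide: "\<And>f g. f \<in> B \<Longrightarrow> g \<in> B \<Longrightarrow> f \<noteq> g \<Longrightarrow> {x \<in> carrier_vec m. f x = g x} \<in> insert {} \<C>"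
  shows "fibred_arrangement m \<C> \<C>' B"
proof
  show "edges (Suc m) \<C>' = cylinder m ` edges m \<C> \<union> {graph_over m f K |f K. f \<in> B \<and> K \<in> edges m \<C>}"
    by (rule edges_fibred[OF C' coincide])
  show "codim (Suc m) (cylinder m K) = codim m K" if "K \<in> edges m \<C>" for K
    using flat_dim_cylinder[OF flat_edge[OF C(1) that]] by (simp add: codim_flat_dim)
  show "codim (Suc m) (graph_over m f K) = Suc (codim m K)" if "f \<in> B" "K \<in> edges m \<C>" for f K
    using flat_dim_graph_over[OF flat_edge[OF C(1) that(2)] B(2)[OF that(1)]]
      flat_dim_le[OF flat_edge[OF C(1) that(2)]]
    by (simp add: codim_flat_dim)
  show "codim m K' < codim m K" if "K \<in> edges m \<C>" "K' \<in> edges m \<C>" "K \<subset> K'" for K K'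
    using flat_dim_less[OF flat_edge[OF C(1) that(1)] flat_edge[OF C(1) that(2)] that(3)]
      flat_dim_le[OF flat_edge[OF C(1) that(2)]]
    by (simp add: codim_flat_dim)
  show "f = g" if "f \<in> B" "g \<in> B" "\<And>x. x \<in> carrier_vec m \<Longrightarrow> f x = g x" for f g
  proof (rule ccontr)
    \<comment> \<open>The coincidence set would then be the whole space, which is neither empty nor
      a member of \<open>\<C>\<close>.\<close>
    assume "f \<noteq> g"
    then have "{x \<in> carrier_vec m. f x = g x} \<in> insert {} \<C>" by (rule coincide[OF that(1,2)])
    moreover have "{x \<in> carrier_vec m. f x = g x} = carrier_vec m" using that(3) by blast
    moreover have "0\<^sub>v m \<in> (carrier_vec m :: complex vec set)" by simp
    ultimately show False using C(2) by auto
  qed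
qed (rule B(1))

text \<open>Degree 0 has a single flag and leaves no room for a gap, so the constant 1 is the dual
  functional.\<close>

lemma has_flag_basis_0: "has_flag_basis m \<C> 0 1"
proof -
  have "carrier_vec m \<in> edges m \<C>"
    unfolding edges_def by (auto intro!: exI[of _ "{}"] intro: zero_carrier_vec)
  then have flags: "flags m \<C> 0 = {[carrier_vec m]}"
    by (auto simp: flags_def edge_chains_def codim_carrier_vec length_Suc_conv map_eq_Cons_conv)
  have "has_flag_basis m \<C> 0 (card {()})"
    by (rule has_flag_basisI[where b = "\<lambda>_. [carrier_vec m]" and \<phi> = "\<lambda>_ _. 1"])
       (auto simp: flags annihilates_def gapped_chain_def)
  then show ?thesis by simp
qed

text \<open>In dimension 0 every codimension is 0, so no flag can reach a positive
  codimension.\<close>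

lemma has_flag_basis_dim_0: "has_flag_basis 0 \<C> (Suc p) 0"
proof -
  have "Ls \<notin> flags 0 \<C> (Suc p)" for Ls
  proof
    assume "Ls \<in> flags 0 \<C> (Suc p)"
    then have "map (codim 0) Ls = [0..<Suc (Suc p)]" by (simp add: flags_def edge_chains_def)
    moreover have "codim 0 = (\<lambda>L. 0)" by (auto simp: codim_def)
    ultimately have "set [0..<Suc (Suc p)] \<subseteq> {0}" by (metis (no_types, lifting) image_subset_iff insertI1 set_map)
    then show False by auto
  qed
  then have "flags 0 \<C> (Suc p) = {}" by blast
  then show ?thesis unfolding has_flag_basis_def by (intro exI[of _ "{}"]) auto
qed

section \<open>The cyclotomic arrangement\<close>

lemma flat_coincide:
  assumes f: "affine_fun m f" and g: "affine_fun m g"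
  shows "flat m {x \<in> carrier_vec m. f x = g x}"
  unfolding flat_def
proof (intro conjI ballI allI)
  fix x y z c
  assume "x \<in> {x \<in> carrier_vec m. f x = g x}" "y \<in> {x \<in> carrier_vec m. f x = g x}"
    "z \<in> {x \<in> carrier_vec m. f x = g x}"
  then show "x + c \<cdot>\<^sub>v (y - z) \<in> {x \<in> carrier_vec m. f x = g x}"
    using flatD[OF flat_carrier_vec, of x m y z c] by (simp add: affine_funD[OF f] affine_funD[OF g])
qed blast

lemma affine_fun_const: "affine_fun m (\<lambda>t. a)"
  by (simp add: affine_fun_def)

lemma affine_fun_coord: "i < m \<Longrightarrow> affine_fun m (\<lambda>t. a * t $ i)"
  by (auto simp: affine_fun_def algebra_simps)

lemma primitive_root_nonzero:
  assumes "primitive_root T \<omega>" "T \<ge> 1"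
  shows "\<omega> \<noteq> 0"
  using assms by (auto simp: primitive_root_def power_0_left)

lemma primitive_root_eq_iff:
  assumes \<omega>: "primitive_root T \<omega>" "T \<ge> 1" and "k < T" "l < T"
  shows "\<omega> ^ k = \<omega> ^ l \<longleftrightarrow> k = l"
proof -
  have "k = l" if "\<omega> ^ k = \<omega> ^ l" "k \<le> l" "l < T" for k l
  proof (rule ccontr)
    assume "k \<noteq> l"
    have "\<omega> ^ l = \<omega> ^ k * \<omega> ^ (l - k)" using that(2) by (simp flip: power_add)
    then have "\<omega> ^ (l - k) = 1"
      using that(1) primitive_root_nonzero[OF \<omega>] by simp
    then show False
      using \<omega>(1) that \<open>k \<noteq> l\<close> unfolding primitive_root_def by (metis le_neq_implies_less less_imp_diff_less zero_less_diff)
  qed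
  from this[of k l] this[of l k] assms show ?thesis by (metis nle_le)
qed

text \<open>Solves an equation between two multiples for \<open>a\<close>, with an exponent brought
  back into the range that indexes the hyperplanes. One \<open>r\<close> serves all \<open>a\<close>
  and \<open>b\<close>, so it can be applied to coordinates of a varying point.\<close>

lemma root_quotient:
  assumes \<omega>: "primitive_root T \<omega>" "T \<ge> 1"
  shows "\<exists>r<T. \<forall>a b. \<omega> ^ k * a = \<omega> ^ l * b \<longleftrightarrow> a = \<omega> ^ r * b"
proof -
  have one: "\<omega> ^ T = 1" using \<omega>(1) by (simp add: primitive_root_def)
  \<comment> \<open>Modulo \<open>T\<close> this is \<open>l - k\<close>, written so that natural
    subtraction does not truncate.\<close>
  let ?s = "l + (T - 1) * k"
  have "\<omega> ^ ?s = \<omega> ^ (?s mod T + T * (?s div T))" by simp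
  then have s: "\<omega> ^ (?s mod T) = \<omega> ^ ?s"
    by (simp only: power_add power_mult one power_one mult_1_right)
  have "k + ?s = l + T * k" using \<omega>(2) by (cases T) auto
  then have "\<omega> ^ k * \<omega> ^ ?s = \<omega> ^ l"
    by (simp only: power_add[symmetric]) (simp add: power_add power_mult one)
  then have "\<omega> ^ l * b = \<omega> ^ k * (\<omega> ^ (?s mod T) * b)" for b
    by (simp only: s mult.assoc[symmetric])
  then have "\<omega> ^ k * a = \<omega> ^ l * b \<longleftrightarrow> \<omega> ^ k * a = \<omega> ^ k * (\<omega> ^ (?s mod T) * b)" for a b
    by (simp only:)
  then have "\<omega> ^ k * a = \<omega> ^ l * b \<longleftrightarrow> a = \<omega> ^ (?s mod T) * b" for a b
    using primitive_root_nonzero[OF \<omega>] by simp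
  then show ?thesis using \<omega>(2) by (intro exI[of _ "?s mod T"]) simp
qed

text \<open>
  The hyperplanes of the arrangement in dimension \<open>m + 1\<close> that involve the last coordinate \<open>s\<close> are
  the graphs \<open>s = f(t)\<close> of these functions of the first \<open>m\<close> coordinates.
\<close>

definition cyclotomic_sections ::
    "nat \<Rightarrow> nat \<Rightarrow> nat \<Rightarrow> complex \<Rightarrow> (nat \<Rightarrow> complex) \<Rightarrow> (complex vec \<Rightarrow> complex) set" where
  "cyclotomic_sections m N T \<omega> z = {\<lambda>t. 0} \<union> (\<lambda>(j, k) t. \<omega> ^ k * z j) ` ({1..N} \<times> {..<T}) \<union>
     (\<lambda>(i, k) t. \<omega> ^ k * t $ i) ` ({..<m} \<times> {..<T})"

lemma cyclotomic_sections_cases: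
  assumes "f \<in> cyclotomic_sections m N T \<omega> z"
  obtains "f = (\<lambda>t. 0)"
  | j k where "f = (\<lambda>t. \<omega> ^ k * z j)" "j \<in> {1..N}" "k < T"
  | i k where "f = (\<lambda>t. \<omega> ^ k * t $ i)" "i < m" "k < T"
  using assms unfolding cyclotomic_sections_def by auto

lemma cyclotomic_arrangement_cases:
  assumes "H \<in> cyclotomic_arrangement m N T \<omega> z"
  obtains i j k where "H = {t \<in> carrier_vec m. t $ i = \<omega> ^ k * t $ j}" "i < j" "j < m" "k < T"
  | i j k where "H = {t \<in> carrier_vec m. t $ i = \<omega> ^ k * z j}" "i < m" "j \<in> {1..N}" "k < T"
  | i where "H = {t \<in> carrier_vec m. t $ i = 0}" "i < m"
  using assms unfolding cyclotomic_arrangement_def by blast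

lemma cyclotomic_arrangementI:
  "i < j \<Longrightarrow> j < m \<Longrightarrow> k < T \<Longrightarrow>
    {t \<in> carrier_vec m. t $ i = \<omega> ^ k * t $ j} \<in> cyclotomic_arrangement m N T \<omega> z"
  "i < m \<Longrightarrow> j \<in> {1..N} \<Longrightarrow> k < T \<Longrightarrow>
    {t \<in> carrier_vec m. t $ i = \<omega> ^ k * z j} \<in> cyclotomic_arrangement m N T \<omega> z"
  "i < m \<Longrightarrow> {t \<in> carrier_vec m. t $ i = 0} \<in> cyclotomic_arrangement m N T \<omega> z"
  unfolding cyclotomic_arrangement_def by blast+

lemma flat_cyclotomic:
  assumes "H \<in> cyclotomic_arrangement m N T \<omega> z"
  shows "flat m H"
  using assms
proof (cases rule: cyclotomic_arrangement_cases)
  case (1 i j k)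
  then show ?thesis
    using flat_coincide[OF affine_fun_coord[of i m 1] affine_fun_coord[of j m "\<omega> ^ k"]] by simp
next
  case (2 i j k)
  then show ?thesis
    using flat_coincide[OF affine_fun_coord[of i m 1] affine_fun_const] by simp
next
  case (3 i)
  then show ?thesis
    using flat_coincide[OF affine_fun_coord[of i m 1] affine_fun_const] by simp
qed

lemma finite_cyclotomic_sections: "finite (cyclotomic_sections m N T \<omega> z)"
  by (simp add: cyclotomic_sections_def)

lemma finite_cyclotomic_arrangement: "finite (cyclotomic_arrangement m N T \<omega> z)"
proof -
  have "cyclotomic_arrangement m N T \<omega> z \<subseteq>
      (\<lambda>(i, j, k). {t \<in> carrier_vec m. t $ i = \<omega> ^ k * t $ j}) ` ({..<m} \<times> {..<m} \<times> {..<T}) \<union>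
      (\<lambda>(i, j, k). {t \<in> carrier_vec m. t $ i = \<omega> ^ k * z j}) ` ({..<m} \<times> {1..N} \<times> {..<T}) \<union>
      (\<lambda>i. {t \<in> carrier_vec m. t $ i = 0}) ` {..<m}"
  proof
    fix H assume "H \<in> cyclotomic_arrangement m N T \<omega> z"
    then show "H \<in> (\<lambda>(i, j, k). {t \<in> carrier_vec m. t $ i = \<omega> ^ k * t $ j}) ` ({..<m} \<times> {..<m} \<times> {..<T}) \<union>
      (\<lambda>(i, j, k). {t \<in> carrier_vec m. t $ i = \<omega> ^ k * z j}) ` ({..<m} \<times> {1..N} \<times> {..<T}) \<union>
      (\<lambda>i. {t \<in> carrier_vec m. t $ i = 0}) ` {..<m}"
    proof (cases rule: cyclotomic_arrangement_cases)
      case (1 i j k)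
      then show ?thesis by (intro UnI1 image_eqI[of _ _ "(i, j, k)"]) auto
    next
      case (2 i j k)
      then show ?thesis by (intro UnI1 UnI2 image_eqI[of _ _ "(i, j, k)"]) auto
    next
      case (3 i)
      then show ?thesis by (intro UnI2 image_eqI[of _ _ i]) auto
    qed
  qed
  then show ?thesis by (rule finite_subset) simp
qed

locale cyclotomic =
  fixes N T :: nat and \<omega> :: complex and z :: "nat \<Rightarrow> complex"
  assumes T: "T \<ge> 1" and \<omega>: "primitive_root T \<omega>"
    and z_nonzero: "\<And>j. j \<in> {1..N} \<Longrightarrow> z j \<noteq> 0"
    and z_disjoint: "disjoint_family_on (\<lambda>j. {\<omega> ^ k * z j |k. True}) {1..N}"
begin

lemma \<omega>_nonzero: "\<omega> \<noteq> 0"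
  by (rule primitive_root_nonzero[OF \<omega> T])

text \<open>Disjointness of the orbits gives \<open>j = j'\<close>; cancelling the nonzero point,
  primitivity of \<open>\<omega>\<close> gives \<open>k = k'\<close>.\<close>

lemma orbit_eq_iff:
  assumes "j \<in> {1..N}" "j' \<in> {1..N}" "k < T" "k' < T"
  shows "\<omega> ^ k * z j = \<omega> ^ k' * z j' \<longleftrightarrow> j = j' \<and> k = k'"
proof
  assume eq: "\<omega> ^ k * z j = \<omega> ^ k' * z j'"
  have "j = j'"
  proof (rule ccontr)
    assume "j \<noteq> j'"
    then have "{\<omega> ^ k * z j |k. True} \<inter> {\<omega> ^ k * z j' |k. True} = {}"
      using z_disjoint assms by (auto simp: disjoint_family_on_def)
    with eq show False by blast
  qed
  moreover from this eq have "\<omega> ^ k = \<omega> ^ k'" using z_nonzero assms by simp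
  ultimately show "j = j' \<and> k = k'"
    using primitive_root_eq_iff[OF \<omega> T assms(3,4)] by simp
qed simp

text \<open>The summand 1 is the zero function, \<open>N * T\<close> counts the multiples of points
  and \<open>m * T\<close> the multiples of coordinates. The families are told apart by their zeros:
  multiples of coordinates vanish at the zero vector but not identically, and multiples of points
  vanish nowhere.\<close>

lemma card_cyclotomic_sections: "card (cyclotomic_sections m N T \<omega> z) = 1 + (m + N) * T"
proof -
  let ?P = "(\<lambda>(j, k) (t::complex vec). \<omega> ^ k * z j) ` ({1..N} \<times> {..<T})"
  let ?Q = "(\<lambda>(i, k) (t::complex vec). \<omega> ^ k * t $ i) ` ({..<m} \<times> {..<T})"
  have "inj_on (\<lambda>(j, k) (t::complex vec). \<omega> ^ k * z j) ({1..N} \<times> {..<T})"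
  proof (rule inj_onI)
    fix x y assume *: "x \<in> {1..N} \<times> {..<T}" "y \<in> {1..N} \<times> {..<T}"
      "(case x of (j, k) \<Rightarrow> \<lambda>t::complex vec. \<omega> ^ k * z j) = (case y of (j, k) \<Rightarrow> \<lambda>t. \<omega> ^ k * z j)"
    obtain j k j' k' where xy: "x = (j, k)" "y = (j', k')" by (cases x, cases y)
    from fun_cong[OF *(3)] have "\<omega> ^ k * z j = \<omega> ^ k' * z j'" by (simp add: xy)
    then show "x = y" using orbit_eq_iff[of j j' k k'] * by (simp add: xy)
  qed
  then have P: "card ?P = N * T" by (simp add: card_image card_cartesian_product)
  have "inj_on (\<lambda>(i, k) (t::complex vec). \<omega> ^ k * t $ i) ({..<m} \<times> {..<T})"
  proof (rule inj_onI)
    fix x y assume *: "x \<in> {..<m} \<times> {..<T}" "y \<in> {..<m} \<times> {..<T}"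
      "(case x of (i, k) \<Rightarrow> \<lambda>t::complex vec. \<omega> ^ k * t $ i) = (case y of (i, k) \<Rightarrow> \<lambda>t. \<omega> ^ k * t $ i)"
    obtain i k i' k' where xy: "x = (i, k)" "y = (i', k')" by (cases x, cases y)
    \<comment> \<open>This unit vector separates both the coordinates and the powers of
      \<open>\<omega>\<close>.\<close>
    from fun_cong[OF *(3), of "unit_vec m i"]
    have eq: "\<omega> ^ k = \<omega> ^ k' * (if i' = i then 1 else 0)" using *(1,2) by (simp add: xy)
    then have "i' = i" using \<omega>_nonzero by (auto split: if_splits)
    then show "x = y" using eq primitive_root_eq_iff[OF \<omega> T] * by (simp add: xy)
  qed
  then have Q: "card ?Q = m * T" by (simp add: card_image card_cartesian_product)
  have 0: "f (0\<^sub>v m) = 0" "\<exists>t. f t \<noteq> 0" if f: "f \<in> ?Q" for f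
  proof -
    from f obtain i k where ik: "f = (\<lambda>t. \<omega> ^ k * t $ i)" "i < m" by auto
    then show "f (0\<^sub>v m) = 0" by simp
    have "f (unit_vec m i) \<noteq> 0" using ik \<omega>_nonzero by simp
    then show "\<exists>t. f t \<noteq> 0" by blast
  qed
  have 1: "f t \<noteq> 0" if f: "f \<in> ?P" for f t
    using f \<omega>_nonzero z_nonzero by auto
  have "(\<lambda>t. 0) \<notin> ?P \<union> ?Q" using 0(2) 1 by blast
  moreover have "?P \<inter> ?Q = {}" using 0(1) 1 by blast
  moreover have "finite ?P" "finite ?Q" by simp_all
  moreover have "cyclotomic_sections m N T \<omega> z = insert (\<lambda>t. 0) (?P \<union> ?Q)"
    by (simp add: cyclotomic_sections_def)
  ultimately have "card (cyclotomic_sections m N T \<omega> z) = Suc (card ?P + card ?Q)"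
    by (simp add: card_Un_disjoint)
  then show ?thesis unfolding P Q by (simp add: algebra_simps)
qed

text \<open>Distinct constants never agree. A multiple of a coordinate agrees with a constant on a
  hyperplane in that coordinate, and with a multiple of another coordinate on a diagonal hyperplane.
  Two different multiples of the same coordinate agree where it vanishes, so the hyperplanes
  \<open>t $ i = 0\<close> have to belong to the arrangement.\<close>

lemma coincidence_cyclotomic:
  assumes "f \<in> cyclotomic_sections m N T \<omega> z" "g \<in> cyclotomic_sections m N T \<omega> z" "f \<noteq> g"
  shows "{x \<in> carrier_vec m. f x = g x} \<in> insert {} (cyclotomic_arrangement m N T \<omega> z)"
proof -
  let ?A = "insert {} (cyclotomic_arrangement m N T \<omega> z)"
  have zero: "{t \<in> carrier_vec m. \<omega> ^ k * t $ i = 0} \<in> ?A" if "i < m" for i k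
    using cyclotomic_arrangementI(3)[OF that] \<omega>_nonzero by simp
  have point: "{t \<in> carrier_vec m. \<omega> ^ k * t $ i = \<omega> ^ l * z j} \<in> ?A" if "i < m" "j \<in> {1..N}" for i j k l
  proof -
    obtain r where "r < T" "\<And>a b. \<omega> ^ k * a = \<omega> ^ l * b \<longleftrightarrow> a = \<omega> ^ r * b"
      using root_quotient[OF \<omega> T, of k l] by blast
    then show ?thesis using cyclotomic_arrangementI(2)[OF that] by simp
  qed
  have diag: "{t \<in> carrier_vec m. \<omega> ^ k * t $ i = \<omega> ^ l * t $ j} \<in> ?A" if "i < j" "j < m" for i j k l
  proof -
    obtain r where "r < T" "\<And>a b. \<omega> ^ k * a = \<omega> ^ l * b \<longleftrightarrow> a = \<omega> ^ r * b"
      using root_quotient[OF \<omega> T, of k l] by blast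
    then show ?thesis using cyclotomic_arrangementI(1)[OF that] by simp
  qed
  have const: "{t \<in> carrier_vec m. a = b} \<in> ?A" if "a \<noteq> b" for a b :: complex
    using that by simp
  have eq_comm: "{x \<in> carrier_vec m. f x = g x} = {x \<in> carrier_vec m. g x = f x}" for f g :: "complex vec \<Rightarrow> complex"
    by auto
  from assms(1) show ?thesis
  proof (cases rule: cyclotomic_sections_cases)
    case f: 1
    from assms(2) show ?thesis
    proof (cases rule: cyclotomic_sections_cases)
      case 1
      with f assms(3) show ?thesis by simp
    next
      case (2 j k)
      then show ?thesis using f \<omega>_nonzero z_nonzero by simp
    next
      case (3 i k)
      show ?thesis by (subst eq_comm) (use f 3 zero in simp)
    qed
  next
    case f: (2 j k)
    from assms(2) show ?thesis
    proof (cases rule: cyclotomic_sections_cases)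
      case 1
      then show ?thesis using f \<omega>_nonzero z_nonzero by simp
    next
      case (2 j' k')
      then have "\<omega> ^ k * z j \<noteq> \<omega> ^ k' * z j'" using assms(3) f by auto
      with const f 2 show ?thesis by simp
    next
      case (3 i l)
      show ?thesis by (subst eq_comm) (use f 3 point in simp)
    qed
  next
    case f: (3 i k)
    from assms(2) show ?thesis
    proof (cases rule: cyclotomic_sections_cases)
      case 1
      then show ?thesis using f zero by simp
    next
      case (2 j l)
      then show ?thesis using f point by simp
    next
      case (3 i' l)
      consider "i < i'" | "i' < i" | "i = i'" by linarith
      then show ?thesis
      proof cases
        case 1
        then show ?thesis using f 3 diag by simp
      next
        case 2
        \<comment> \<open>Diagonal hyperplanes are listed with the smaller index on the left, so the
          equation is reversed.\<close>
        show ?thesis by (subst eq_comm) (use f 3 2 diag in simp)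
      next
        case eq: 3
        then have "\<omega> ^ k \<noteq> \<omega> ^ l" using assms(3) f 3 by auto
        then have "{x \<in> carrier_vec m. f x = g x} = {x \<in> carrier_vec m. x $ i = 0}"
          using f 3 eq by auto
        then show ?thesis using cyclotomic_arrangementI(3) f by simp
      qed
    qed
  qed
qed

lemma carrier_not_cyclotomic: "carrier_vec m \<notin> cyclotomic_arrangement m N T \<omega> z"
proof
  assume "carrier_vec m \<in> cyclotomic_arrangement m N T \<omega> z"
  then show False
  proof (cases rule: cyclotomic_arrangement_cases)
    case (1 i j k)
    \<comment> \<open>This point has coordinate \<open>i\<close> equal to 1 and coordinate
      \<open>j\<close> equal to 0.\<close>
    have "unit_vec m i \<in> (carrier_vec m :: complex vec set)" by simp
    then have "unit_vec m i $ i = \<omega> ^ k * unit_vec m i $ j" using 1(1) by blast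
    then show False using 1 by simp
  next
    case (2 i j k)
    have "0\<^sub>v m \<in> (carrier_vec m :: complex vec set)" by simp
    then have "0\<^sub>v m $ i = \<omega> ^ k * z j" using 2(1) by blast
    then show False using 2 \<omega>_nonzero z_nonzero by simp
  next
    case (3 i)
    have "unit_vec m i \<in> (carrier_vec m :: complex vec set)" by simp
    then have "unit_vec m i $ i = (0::complex)" using 3(1) by blast
    then show False using 3 by simp
  qed
qed

text \<open>Hyperplanes not involving the last coordinate are cylinders. The diagonal ones that
  involve it are listed as \<open>t $ i = \<omega> ^ k * t $ m\<close> and have to be solved for
  \<open>t $ m\<close>, which inverts the root of unity.\<close>

lemma cyclotomic_arrangement_Suc:
  "cyclotomic_arrangement (Suc m) N T \<omega> z = cylinder m ` cyclotomic_arrangement m N T \<omega> z \<union>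
    (\<lambda>f. graph_over m f (carrier_vec m)) ` cyclotomic_sections m N T \<omega> z"
proof -
  let ?A' = "cyclotomic_arrangement (Suc m) N T \<omega> z" and ?A = "cyclotomic_arrangement m N T \<omega> z"
    and ?S = "cyclotomic_sections m N T \<omega> z"
  have first: "vec_first t m $ i = t $ i" if "i < m" for t :: "complex vec" and i
    using that by (simp add: vec_first_def)
  have cyl_coord: "cylinder m {t \<in> carrier_vec m. t $ i = \<omega> ^ k * t $ j} = {t \<in> carrier_vec (Suc m). t $ i = \<omega> ^ k * t $ j}"
    if "i < m" "j < m" for i j k
    using that by (auto simp: cylinder_def first)
  have cyl_const: "cylinder m {t \<in> carrier_vec m. t $ i = a} = {t \<in> carrier_vec (Suc m). t $ i = a}"
    if "i < m" for i a
    using that by (auto simp: cylinder_def first)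
  have graph: "graph_over m f (carrier_vec m) = {t \<in> carrier_vec (Suc m). t $ m = f (vec_first t m)}" for f
    by (auto simp: graph_over_def)
  have graph_coord: "graph_over m (\<lambda>t. \<omega> ^ k * t $ i) (carrier_vec m) =
      {t \<in> carrier_vec (Suc m). t $ m = \<omega> ^ k * t $ i}" if "i < m" for i k
    using that by (auto simp: graph first)
  show ?thesis
  proof (intro equalityI subsetI)
    fix H assume "H \<in> ?A'"
    then show "H \<in> cylinder m ` ?A \<union> (\<lambda>f. graph_over m f (carrier_vec m)) ` ?S"
    proof (cases rule: cyclotomic_arrangement_cases)
      case (1 i j k)
      show ?thesis
      proof (cases "j = m")
        case True
        \<comment> \<open>With exponent 0 on the right, \<open>r\<close> is the negative of
          \<open>k\<close> modulo \<open>T\<close>.\<close>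
        obtain r where r: "r < T" "\<And>a b. \<omega> ^ k * a = \<omega> ^ 0 * b \<longleftrightarrow> a = \<omega> ^ r * b"
          using root_quotient[OF \<omega> T, of k 0] by blast
        have "t $ i = \<omega> ^ k * t $ m \<longleftrightarrow> t $ m = \<omega> ^ r * t $ i" for t
          using r(2)[of "t $ m" "t $ i"] by auto
        then have "H = graph_over m (\<lambda>t. \<omega> ^ r * t $ i) (carrier_vec m)"
          using 1 True by (simp add: graph_coord)
        moreover have "(\<lambda>t. \<omega> ^ r * t $ i) \<in> ?S"
          using 1 True r(1) unfolding cyclotomic_sections_def
          by (intro UnI2 image_eqI[of _ _ "(i, r)"]) auto
        ultimately show ?thesis by blast
      next
        case False
        with 1 have "H = cylinder m {t \<in> carrier_vec m. t $ i = \<omega> ^ k * t $ j}"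
          by (subst cyl_coord) auto
        then show ?thesis using cyclotomic_arrangementI(1)[of i j m k] 1 False by auto
      qed
    next
      case (2 i j k)
      show ?thesis
      proof (cases "i = m")
        case True
        then have "H = graph_over m (\<lambda>t. \<omega> ^ k * z j) (carrier_vec m)" using 2 by (simp add: graph)
        moreover have "(\<lambda>t. \<omega> ^ k * z j) \<in> ?S"
          using 2 unfolding cyclotomic_sections_def
          by (intro UnI1 UnI2 image_eqI[of _ _ "(j, k)"]) auto
        ultimately show ?thesis by blast
      next
        case False
        with 2 have "H = cylinder m {t \<in> carrier_vec m. t $ i = \<omega> ^ k * z j}"
          by (subst cyl_const) auto
        then show ?thesis using cyclotomic_arrangementI(2)[of i m j N k] 2 False by auto
      qed
    next
      case (3 i)
      show ?thesis
      proof (cases "i = m")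
        case True
        then have "H = graph_over m (\<lambda>t. 0) (carrier_vec m)" using 3 by (simp add: graph)
        then show ?thesis unfolding cyclotomic_sections_def by blast
      next
        case False
        with 3 have "H = cylinder m {t \<in> carrier_vec m. t $ i = 0}"
          by (subst cyl_const) auto
        then show ?thesis using cyclotomic_arrangementI(3)[of i m] 3 False by auto
      qed
    qed
  next
    fix H assume "H \<in> cylinder m ` ?A \<union> (\<lambda>f. graph_over m f (carrier_vec m)) ` ?S"
    then consider K where "H = cylinder m K" "K \<in> ?A"
      | f where "H = graph_over m f (carrier_vec m)" "f \<in> ?S" by blast
    then show "H \<in> ?A'"
    proof cases
      case K: 1
      from K(2) show ?thesis
      proof (cases rule: cyclotomic_arrangement_cases)
        case (1 i j k)
        then show ?thesis using K(1) cyl_coord[of i j k] cyclotomic_arrangementI(1)[of i j "Suc m" k] by simp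
      next
        case (2 i j k)
        then show ?thesis using K(1) cyl_const[of i "\<omega> ^ k * z j"] cyclotomic_arrangementI(2)[of i "Suc m" j N k] by simp
      next
        case (3 i)
        then show ?thesis using K(1) cyl_const[of i 0] cyclotomic_arrangementI(3)[of i "Suc m"] by simp
      qed
    next
      case f: 2
      from f(2) show ?thesis
      proof (cases rule: cyclotomic_sections_cases)
        case 1
        then show ?thesis using f(1) cyclotomic_arrangementI(3)[of m "Suc m"] by (simp add: graph)
      next
        case (2 j k)
        then show ?thesis using f(1) cyclotomic_arrangementI(2)[of m "Suc m" j N k] by (simp add: graph)
      next
        case (3 i k)
        obtain r where r: "r < T" "\<And>a b. \<omega> ^ k * a = \<omega> ^ 0 * b \<longleftrightarrow> a = \<omega> ^ r * b"
          using root_quotient[OF \<omega> T, of k 0] by blast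
        have "t $ m = \<omega> ^ k * t $ i \<longleftrightarrow> t $ i = \<omega> ^ r * t $ m" for t
          using r(2)[of "t $ i" "t $ m"] by auto
        then have "H = {t \<in> carrier_vec (Suc m). t $ i = \<omega> ^ r * t $ m}"
          using f(1) 3 by (simp add: graph_coord)
        then show ?thesis using cyclotomic_arrangementI(1)[of i m "Suc m" r] 3 r(1) by simp
      qed
    qed
  qed
qed

lemma fibred_cyclotomic:
  "fibred_arrangement m (cyclotomic_arrangement m N T \<omega> z) (cyclotomic_arrangement (Suc m) N T \<omega> z)
    (cyclotomic_sections m N T \<omega> z)"
proof (rule fibred_arrangementI)
  show "affine_fun m f" if "f \<in> cyclotomic_sections m N T \<omega> z" for f
    using that by (cases rule: cyclotomic_sections_cases) (simp_all add: affine_fun_const affine_fun_coord)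
qed (simp_all only: finite_cyclotomic_sections flat_cyclotomic carrier_not_cyclotomic not_False_eq_True
  cyclotomic_arrangement_Suc coincidence_cyclotomic)

text \<open>The degree \<open>p\<close> is arbitrary in the induction because degree
  \<open>Suc q\<close> draws on both \<open>Suc q\<close> and \<open>q\<close> one dimension lower.
  The induction starts in dimension 0, where the product is empty and only degree 0
  contributes.\<close>

lemma has_flag_basis_cyclotomic:
  "\<exists>n. has_flag_basis m (cyclotomic_arrangement m N T \<omega> z) p n \<and>
    int n = coeff (\<Prod>q = 0..<m. [:1, 1 + (int q + int N) * int T:]) p"
proof (induction m arbitrary: p)
  case 0
  then show ?case
    using has_flag_basis_0 has_flag_basis_dim_0 by (cases p) (force simp: coeff_1)+
next
  case (Suc m)
  let ?P = "\<Prod>q = 0..<m. [:1, 1 + (int q + int N) * int T:]"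
  interpret fibred_arrangement m "cyclotomic_arrangement m N T \<omega> z"
    "cyclotomic_arrangement (Suc m) N T \<omega> z" "cyclotomic_sections m N T \<omega> z"
    by (rule fibred_cyclotomic)
  have P: "(\<Prod>q = 0..<Suc m. [:1, 1 + (int q + int N) * int T:]) =
      [:1, 1 + (int m + int N) * int T:] * ?P" by (simp add: mult.commute)
  show ?case
  proof (cases p)
    case 0
    have "coeff (\<Prod>q = 0..<n. [:1, 1 + (int q + int N) * int T:]) 0 = 1" for n
      by (induction n) (simp_all add: coeff_mult)
    then show ?thesis using has_flag_basis_0 0 by (intro exI[of _ 1]) simp
  next
    case (Suc q)
    from Suc.IH[of "Suc q"] Suc.IH[of q] obtain n n' where
      n: "has_flag_basis m (cyclotomic_arrangement m N T \<omega> z) (Suc q) n" "int n = coeff ?P (Suc q)"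
      "has_flag_basis m (cyclotomic_arrangement m N T \<omega> z) q n'" "int n' = coeff ?P q"
      by blast
    show ?thesis
      unfolding P using has_flag_basis_Suc[OF n(1,3)] n(2,4) Suc
      by (intro exI[of _ "n + (1 + (m + N) * T) * n'"])
        (simp add: card_cyclotomic_sections coeff_pCons algebra_simps)
  qed
qed

end

theorem theorem9p5:
  fixes m N T :: nat and \<omega> :: complex and z :: "nat \<Rightarrow> complex"
  assumes "m \<ge> 1" and "T \<ge> 1"
    and "primitive_root T \<omega>"
    and "\<And>j. j \<in> {1..N} \<Longrightarrow> z j \<noteq> 0"
    and "disjoint_family_on (\<lambda>j. {\<omega> ^ k * z j |k. True}) {1..N}"
  shows "(\<Sum>p = 0..m. monom (int (vectorspace.dim class_ring
            (flag_space m (cyclotomic_arrangement m N T \<omega> z) p))) p) =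
         (\<Prod>p = 0..<m. [:1, 1 + (int p + int N) * int T:])"
proof -
  interpret cyclotomic N T \<omega> z
    using assms(2-5) by unfold_locales
  let ?P = "\<Prod>p = 0..<m. [:1, 1 + (int p + int N) * int T:]"
  have dim: "int (vectorspace.dim class_ring (flag_space m (cyclotomic_arrangement m N T \<omega> z) p)) = coeff ?P p" for p
    using has_flag_basis_cyclotomic[of m p]
      has_flag_basis_imp_dim[OF finite_cyclotomic_arrangement, of m m N T \<omega> z p]
    by auto
  \<comment> \<open>The degree is at most \<open>m\<close>, so the coefficients in degrees up to
    \<open>m\<close> rebuild the product.\<close>
  have "degree ?P \<le> (\<Sum>p = 0..<m. degree [:1, 1 + (int p + int N) * int T:])"
    by (rule order_trans[OF degree_prod_sum_le]) simp_all
  also have "\<dots> \<le> (\<Sum>p = 0..<m. 1)" by (rule sum_mono) simp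
  finally have "degree ?P \<le> m" by simp
  then show ?thesis
    unfolding dim using poly_as_sum_of_monoms'[of ?P m] by (simp add: atLeast0AtMost)
qed

end
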